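(* Let $k\in\{1,2,\dots\}$, $N>1$, and let $\varphi$ be a superradius. Assume that the Orlicz--Sobolev inequality $$\|v\|_{L^{\Phi}_{\mu_B}}\le C\,\frac{\varphi(r(B))}{w(B)^{1/2}}\,\|\nabla_A v\|_{L^2},\qquad v\in Lip_c(B),$$ holds for every metric ball $B\subset\Omega$ with $\Phi=\Phi_{k,N}$ (with $C$ independent of $B$). Assume in addition that at every $(x,r)$ there exists an $(A,d,w;k,N)$-adapted sequence of Lipschitz cutoff functions. Suppose further that $\phi$ is $A$-admissible in $\Omega$. Then: (1) There are constants $C_1,C_2>0$, depending on $N$ and $k$ but not on $r$, such that every weak subsolution $u$ to $Lu=\phi$ in $\Omega$ satisfies $$\|u_+\|_{L^\infty(\frac12 B)}\le A_{k,N}(r)\left(\frac{1}{w(B)}\int_B u_+^2\,w\,dx\right)^{1/2}+\|\phi\|_{X(B)},$$ where $$A_{k,N}(r)=C_1\left[\exp^{(k)}\left(C_2\left(\frac{\varphi(r)}{r}\right)^{\frac{2}{N-1}}\right)\right]^{1/2},$$ for every ball $B\subset\Omega$ with radius $r$. (2) In particular, weak solutions of $Lu=\phi$ are locally bounded in $\Omega$.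
   Context: Setting. $\Omega\subset\mathbb{R}^n$ is a bounded domain and $w$ is a weight on $\Omega$ (a locally integrable function, positive a.e.); $d\mu=w\,dx$ and $w(E)=\int_E w\,dx$. $A(x)$ is an $n\times n$ symmetric nonnegative semidefinite matrix function on $\Omega$ with bounded coefficients such that, for some constant $k_0>0$, $|A(x)\xi|\le k_0 w(x)|\xi|$ for a.e. $x\in\Omega$ and all $\xi\in\mathbb{R}^n$. There is a Lipschitz continuous $n\times n$ real matrix function $\mathcal B(x)$ on $\Omega$ and constants $c,C>0$ with $c\,\xi^{tr}A(x)\xi\le|\mathcal B(x)\xi|^2\le C\,\xi^{tr}A(x)\xi$. Put $\nabla_A v=\mathcal B(x)\nabla v$ and $Lu=\nabla^{tr}A(x)\nabla u$. Function spaces. $W^{1,2}_A(\Omega)$ is the degenerate Sobolev space with norm $\left(\int_\Omega(|v|^2+\nabla v^{tr}A\nabla v)\right)^{1/2}$; $(W^{1,2}_A)_0(\Omega)$ is the closure in it of the Lipschitz functions with compact support in $\Omega$ (similarly on balls). $Lip_c(B)$ denotes Lipschitz functions with compact support in $B$. Metric. $d$ is a metric on $\Omega$; $B(x,r)$ denotes a metric ball, $r(B)$ the radius of $B$, and $\lambda B$ the concentric ball with radius $\lambda r(B)$. Admissibility. For a ball $B=B(x,\rho)$, $$\|\phi\|_{X(B)}=\sup_{v\in(W^{1,2}_A)_0(B)}w(\{y\in B: v(y)\ne0\})^{-1/2}\,\frac{\left|\int_B v\phi\,dy\right|}{\|\nabla_A v\|_{L^2(B)}}.$$ $\phi$ is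 $A$-admissible at $(x,\rho)$ if $\|\phi\|_{X(B(x,\rho))}<\infty$, and $A$-admissible in $\Omega$ (written $\phi\in X(\Omega)$) if this holds for all balls $B(x,\rho)$ contained in $\Omega$. Weak solutions. For $\phi\in L^2_{loc}(\Omega)\cup X(\Omega)$, $u\in W^{1,2}_A(\Omega)$ is a weak solution of $Lu=\phi$ if $-\int_\Omega\nabla g^{tr}A\nabla u=\int_\Omega\phi g$ for all nonnegative $g\in(W^{1,2}_A)_0(\Omega)$; it is a weak subsolution if $=$ is replaced by $\ge$ (supersolution: $\le$). $u_+=\max\{u,0\}$. Orlicz norms. $d\mu_B=\frac{w\,dx}{w(B)}$ and $\|f\|_{L^\Phi_{\mu_B}}=\inf\{a>0:\int_B\Phi(|f|/a)\,d\mu_B\le1\}$. Notation. $f^{(j)}$ is the $j$-fold composition of $f$ with itself ($\ln^{(0)}t=t$). With $E=E_{k,N}=\exp^{(k)}(2N)$, $$\Phi_{k,N}(t)=t^2\prod_{i=1}^{k-1}(\ln^{(i)}s)^2\cdot(\ln^{(k)}s)^{2N},\qquad s=\max\{t^2,E\},\ t\ge0.$$ Superradius. An increasing function $\varphi$ on some interval $[0,R]$ with $\varphi(0)=0$ and $\varphi(r)\ge r$; radii of the balls considered lie in $[0,R]$. Adapted cutoffs. Let $\kappa_{k,N}(j)=j^2$ for $j\le E$ and $\kappa_{k,N}(j)=\left(\prod_{i=0}^{k-2}\ln^{(i)}j\right)(\ln^{(k-1)}j)^{\frac{N+1}{2}}$ for $j>E$ (empty product $=1$). Let $r_1=r$,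 $r_j-r_{j+1}=cr/\kappa_{k,N}(j)$, where $c>0$ is determined by $\lim_j r_j=r/2$. An $(A,d,w;k,N)$-adapted sequence of Lipschitz cutoff functions at $(x,r)$ is a sequence of Lipschitz functions $\{\psi_j\}_{j\ge1}$ with $\mathrm{supp}\,\psi_j\subset B(x,r_j)$, $\psi_j=1$ on $B(x,r_{j+1})$, and $\left\|\,|\nabla_A\psi_j|/w^{1/2}\right\|_{L^\infty}\le C\kappa_{k,N}(j)/r$, with $C$ independent of $j,x,r$. *)

theory Defs
  imports "HOL-Analysis.Analysis" "HOL-Probability.Essential_Supremum"
begin

section \<open>Extended-valued norms\<close>

definition ennsqrt :: "ennreal \<Rightarrow> ennreal" where
  "ennsqrt a = (if a = top then top else ennreal (sqrt (enn2real a)))"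

text \<open>Norms with respect to Lebesgue measure on a set; they take the value \<open>top\<close> when infinite.\<close>

definition Linf_norm :: "(real ^ 'n) set \<Rightarrow> (real ^ 'n \<Rightarrow> real) \<Rightarrow> ennreal" where
  "Linf_norm E f = esssup (lebesgue_on E) (\<lambda>x. ennreal \<bar>f x\<bar>)"

definition L2_norm_on :: "(real ^ 'n) set \<Rightarrow> (real ^ 'n \<Rightarrow> real ^ 'n) \<Rightarrow> ennreal" where
  "L2_norm_on E F = ennsqrt (\<integral>\<^sup>+ x. ennreal ((norm (F x))\<^sup>2) \<partial>lebesgue_on E)"

text \<open>\<open>\<bar>\<integral>\<^sub>E f dx\<bar>\<close>. The Bochner integral of a non-integrable function is \<open>0\<close>; here such a function
  gets the value \<open>top\<close>, so that finiteness includes the existence of the integral.\<close>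

definition abs_integral :: "(real ^ 'n) set \<Rightarrow> (real ^ 'n \<Rightarrow> real) \<Rightarrow> ennreal" where
  "abs_integral E f = (if integrable (lebesgue_on E) f
     then ennreal \<bar>LINT x|lebesgue_on E. f x\<bar> else top)"

section \<open>Weight, matrix and degenerate Sobolev spaces\<close>

definition weight_on :: "(real ^ 'n) set \<Rightarrow> (real ^ 'n \<Rightarrow> real) \<Rightarrow> bool" where
  "weight_on \<Omega> w \<longleftrightarrow>
     w \<in> borel_measurable (lebesgue_on \<Omega>) \<and>
     (\<forall>K. compact K \<and> K \<subseteq> \<Omega> \<longrightarrow> integrable (lebesgue_on K) w) \<and>
     (AE x in lebesgue_on \<Omega>. 0 < w x)"

definition wmeas :: "(real ^ 'n \<Rightarrow> real) \<Rightarrow> (real ^ 'n) set \<Rightarrow> ennreal" where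
  "wmeas w E = (\<integral>\<^sup>+ x. ennreal (w x) \<partial>lebesgue_on E)"

definition degenerate_setting ::
  "(real ^ 'n) set \<Rightarrow> (real ^ 'n \<Rightarrow> real) \<Rightarrow> (real ^ 'n \<Rightarrow> real ^ 'n ^ 'n) \<Rightarrow>
   (real ^ 'n \<Rightarrow> real ^ 'n ^ 'n) \<Rightarrow> bool" where
  "degenerate_setting \<Omega> w A \<B> \<longleftrightarrow>
     open \<Omega> \<and> connected \<Omega> \<and> bounded \<Omega> \<and> \<Omega> \<noteq> {} \<and>
     weight_on \<Omega> w \<and>
     A \<in> borel_measurable (lebesgue_on \<Omega>) \<and>
     (\<exists>M. \<forall>x\<in>\<Omega>. \<forall>i j. \<bar>A x $ i $ j\<bar> \<le> M) \<and>
     (\<forall>x\<in>\<Omega>. transpose (A x) = A x \<and> (\<forall>\<xi>. 0 \<le> \<xi> \<bullet> (A x *v \<xi>))) \<and>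
     (\<exists>k0>0. AE x in lebesgue_on \<Omega>. \<forall>\<xi>. norm (A x *v \<xi>) \<le> k0 * w x * norm \<xi>) \<and>
     (\<exists>L. L-lipschitz_on \<Omega> \<B>) \<and>
     (\<exists>c>0. \<exists>C>0. \<forall>x\<in>\<Omega>. \<forall>\<xi>.
        c * (\<xi> \<bullet> (A x *v \<xi>)) \<le> (norm (\<B> x *v \<xi>))\<^sup>2 \<and>
        (norm (\<B> x *v \<xi>))\<^sup>2 \<le> C * (\<xi> \<bullet> (A x *v \<xi>)))"

text \<open>The gradient of a (locally) Lipschitz function exists almost everywhere; it is set to \<open>0\<close>
  at the remaining points.\<close>

definition grad :: "(real ^ 'n \<Rightarrow> real) \<Rightarrow> real ^ 'n \<Rightarrow> real ^ 'n" where
  "grad v x = (if \<exists>D. GDERIV v x :> D then THE D. GDERIV v x :> D else 0)"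

definition Lip_loc :: "(real ^ 'n) set \<Rightarrow> (real ^ 'n \<Rightarrow> real) set" where
  "Lip_loc E = {v. \<forall>x\<in>E. \<exists>e>0. \<exists>L. L-lipschitz_on (ball x e \<inter> E) v}"

text \<open>Lipschitz functions with compact support in \<open>E\<close>, extended by zero to the whole space.\<close>

definition Lip_c :: "(real ^ 'n) set \<Rightarrow> (real ^ 'n \<Rightarrow> real) set" where
  "Lip_c E = {v. (\<exists>L. L-lipschitz_on UNIV v) \<and>
     compact (closure {x. v x \<noteq> 0}) \<and> closure {x. v x \<noteq> 0} \<subseteq> E}"

text \<open>Square of the norm of \<open>W\<^sup>1\<^sup>,\<^sup>2\<^sub>A(E)\<close>, for a function \<open>v\<close> with gradient \<open>G\<close>.\<close>

definition energy ::
  "(real ^ 'n \<Rightarrow> real ^ 'n ^ 'n) \<Rightarrow> (real ^ 'n) set \<Rightarrow>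
   (real ^ 'n \<Rightarrow> real) \<Rightarrow> (real ^ 'n \<Rightarrow> real ^ 'n) \<Rightarrow> ennreal" where
  "energy A E v G = (\<integral>\<^sup>+ x. ennreal ((v x)\<^sup>2 + G x \<bullet> (A x *v G x)) \<partial>lebesgue_on E)"

text \<open>An element of the closure, in the \<open>W\<^sup>1\<^sup>,\<^sup>2\<^sub>A\<close> norm, of a class \<open>D\<close> of locally Lipschitz functions
  is represented by a function \<open>v\<close> together with a gradient field \<open>G\<close>. Since \<open>\<B>\<close> is Lipschitz,
  \<open>v \<mapsto> \<B>\<nabla>v\<close> is closable, so \<open>v\<close> determines \<open>\<B> G\<close> and \<open>A G\<close> almost everywhere.\<close>

definition sobolev_closure ::
  "(real ^ 'n \<Rightarrow> real) set \<Rightarrow> (real ^ 'n \<Rightarrow> real ^ 'n ^ 'n) \<Rightarrow> (real ^ 'n) set \<Rightarrow>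
   (real ^ 'n \<Rightarrow> real) \<Rightarrow> (real ^ 'n \<Rightarrow> real ^ 'n) \<Rightarrow> bool" where
  "sobolev_closure D A E v G \<longleftrightarrow>
     v \<in> borel_measurable (lebesgue_on E) \<and> G \<in> borel_measurable (lebesgue_on E) \<and>
     energy A E v G < top \<and>
     (\<exists>V. (\<forall>m::nat. V m \<in> D) \<and>
        (\<lambda>m. energy A E (\<lambda>x. v x - V m x) (\<lambda>x. G x - grad (V m) x)) \<longlonglongrightarrow> 0)"

text \<open>\<open>W\<^sup>1\<^sup>,\<^sup>2\<^sub>A(E)\<close> is the completion of the locally Lipschitz functions of finite norm (the
  approximants in \<open>sobolev_closure\<close> eventually have finite norm because the limit has);
  \<open>(W\<^sup>1\<^sup>,\<^sup>2\<^sub>A)\<^sub>0(E)\<close> is the closure of the Lipschitz functions with compact support.\<close>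

definition W12A ::
  "(real ^ 'n \<Rightarrow> real ^ 'n ^ 'n) \<Rightarrow> (real ^ 'n) set \<Rightarrow>
   (real ^ 'n \<Rightarrow> real) \<Rightarrow> (real ^ 'n \<Rightarrow> real ^ 'n) \<Rightarrow> bool" where
  "W12A A E = sobolev_closure (Lip_loc E) A E"

definition W12A0 ::
  "(real ^ 'n \<Rightarrow> real ^ 'n ^ 'n) \<Rightarrow> (real ^ 'n) set \<Rightarrow>
   (real ^ 'n \<Rightarrow> real) \<Rightarrow> (real ^ 'n \<Rightarrow> real ^ 'n) \<Rightarrow> bool" where
  "W12A0 A E = sobolev_closure (Lip_c E) A E"

section \<open>Metric balls\<close>

text \<open>The metric \<open>m\<close> lives on a set \<open>mspace m\<close> that contains \<open>\<Omega>\<close>. With \<open>mspace m = \<Omega>\<close> every ball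
  is contained in \<open>\<Omega>\<close>, and the inclusion below has content only for a larger carrier (for
  instance the Euclidean metric of the whole space). If \<open>\<Omega>\<close> is open for \<open>m\<close>, which is automatic for
  \<open>mspace m = \<Omega>\<close>, each point of \<open>\<Omega>\<close> is the centre of such a ball.\<close>

definition ball_in :: "(real ^ 'n) metric \<Rightarrow> (real ^ 'n) set \<Rightarrow> real ^ 'n \<Rightarrow> real \<Rightarrow> bool" where
  "ball_in m \<Omega> x r \<longleftrightarrow> x \<in> \<Omega> \<and> 0 < r \<and> mball_of m x r \<subseteq> \<Omega>"

section \<open>Admissibility and weak solutions\<close>

text \<open>In \<open>ennreal\<close>, \<open>a / 0\<close> is \<open>top\<close> for \<open>a > 0\<close> and \<open>0 / 0 = 0\<close>; so \<open>v = 0\<close> does not contribute.\<close>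

definition X_norm ::
  "(real ^ 'n \<Rightarrow> real) \<Rightarrow> (real ^ 'n \<Rightarrow> real ^ 'n ^ 'n) \<Rightarrow> (real ^ 'n \<Rightarrow> real ^ 'n ^ 'n) \<Rightarrow>
   (real ^ 'n) set \<Rightarrow> (real ^ 'n \<Rightarrow> real) \<Rightarrow> ennreal" where
  "X_norm w A \<B> B \<phi> =
     (SUP (v, G) \<in> {(v, G). W12A0 A B v G}.
        inverse (ennsqrt (wmeas w {y \<in> B. v y \<noteq> 0})) *
        (abs_integral B (\<lambda>y. v y * \<phi> y) / L2_norm_on B (\<lambda>y. \<B> y *v G y)))"

definition A_admissible ::
  "(real ^ 'n) metric \<Rightarrow> (real ^ 'n) set \<Rightarrow> (real ^ 'n \<Rightarrow> real) \<Rightarrow>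
   (real ^ 'n \<Rightarrow> real ^ 'n ^ 'n) \<Rightarrow> (real ^ 'n \<Rightarrow> real ^ 'n ^ 'n) \<Rightarrow> (real ^ 'n \<Rightarrow> real) \<Rightarrow> bool" where
  "A_admissible m \<Omega> w A \<B> \<phi> \<longleftrightarrow>
     \<phi> \<in> borel_measurable (lebesgue_on \<Omega>) \<and>
     (\<forall>x \<rho>. ball_in m \<Omega> x \<rho> \<longrightarrow> X_norm w A \<B> (mball_of m x \<rho>) \<phi> < top)"

text \<open>The tests are those \<open>g\<close> for which \<open>\<integral>\<^sub>\<Omega> \<phi> g\<close> exists: for \<open>\<phi> \<in> L\<^sup>2\<^sub>l\<^sub>o\<^sub>c(\<Omega>) \<union> X(\<Omega>)\<close>, which
  controls \<open>\<phi>\<close> only locally, it need not exist for every \<open>g\<close> in \<open>(W\<^sup>1\<^sup>,\<^sup>2\<^sub>A)\<^sub>0(\<Omega>)\<close>.\<close>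

definition weak_relation ::
  "(real \<Rightarrow> real \<Rightarrow> bool) \<Rightarrow> (real ^ 'n \<Rightarrow> real ^ 'n ^ 'n) \<Rightarrow> (real ^ 'n) set \<Rightarrow>
   (real ^ 'n \<Rightarrow> real) \<Rightarrow> (real ^ 'n \<Rightarrow> real) \<Rightarrow> bool" where
  "weak_relation rel A \<Omega> \<phi> u \<longleftrightarrow>
     (\<exists>G. W12A A \<Omega> u G \<and>
       (\<forall>g H. W12A0 A \<Omega> g H \<and> (AE x in lebesgue_on \<Omega>. 0 \<le> g x) \<and>
              integrable (lebesgue_on \<Omega>) (\<lambda>x. \<phi> x * g x) \<longrightarrow>
          rel (- (LINT x|lebesgue_on \<Omega>. H x \<bullet> (A x *v G x)))
              (LINT x|lebesgue_on \<Omega>. \<phi> x * g x)))"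

definition weak_solution ::
  "(real ^ 'n \<Rightarrow> real ^ 'n ^ 'n) \<Rightarrow> (real ^ 'n) set \<Rightarrow>
   (real ^ 'n \<Rightarrow> real) \<Rightarrow> (real ^ 'n \<Rightarrow> real) \<Rightarrow> bool" where
  "weak_solution = weak_relation (\<lambda>a b. a = b)"

definition weak_subsolution ::
  "(real ^ 'n \<Rightarrow> real ^ 'n ^ 'n) \<Rightarrow> (real ^ 'n) set \<Rightarrow>
   (real ^ 'n \<Rightarrow> real) \<Rightarrow> (real ^ 'n \<Rightarrow> real) \<Rightarrow> bool" where
  "weak_subsolution = weak_relation (\<lambda>a b. a \<ge> b)"

definition locally_bounded :: "(real ^ 'n) set \<Rightarrow> (real ^ 'n \<Rightarrow> real) \<Rightarrow> bool" where
  "locally_bounded \<Omega> u \<longleftrightarrow> (\<forall>K. compact K \<and> K \<subseteq> \<Omega> \<longrightarrow> Linf_norm K u < top)"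

section \<open>Orlicz--Sobolev inequality\<close>

definition E_const :: "nat \<Rightarrow> real \<Rightarrow> real" where
  "E_const k N = (exp ^^ k) (2 * N)"

definition Phi :: "nat \<Rightarrow> real \<Rightarrow> real \<Rightarrow> real" where
  "Phi k N t = (let s = max (t\<^sup>2) (E_const k N) in
     t\<^sup>2 * (\<Prod>i\<in>{1..<k}. ((ln ^^ i) s)\<^sup>2) * ((ln ^^ k) s) powr (2 * N))"

text \<open>The Luxemburg norm with respect to \<open>d\<mu>\<^sub>B = w dx / w(B)\<close>.\<close>

definition orlicz_norm ::
  "(real \<Rightarrow> real) \<Rightarrow> (real ^ 'n \<Rightarrow> real) \<Rightarrow> (real ^ 'n) set \<Rightarrow> (real ^ 'n \<Rightarrow> real) \<Rightarrow> ennreal" where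
  "orlicz_norm \<Psi> w B f =
     (INF a \<in> {a::real. 0 < a \<and>
        (\<integral>\<^sup>+ x. ennreal (\<Psi> (\<bar>f x\<bar> / a))
           \<partial>density (lebesgue_on B) (\<lambda>x. ennreal (w x) / wmeas w B)) \<le> 1}. ennreal a)"

definition superradius :: "real \<Rightarrow> (real \<Rightarrow> real) \<Rightarrow> bool" where
  "superradius R \<sigma> \<longleftrightarrow> mono_on {0..R} \<sigma> \<and> \<sigma> 0 = 0 \<and> (\<forall>r\<in>{0..R}. r \<le> \<sigma> r)"

text \<open>The normalised measure only makes sense for \<open>w(B) < \<infinity>\<close>, which the local integrability of \<open>w\<close>
  does not guarantee for a ball whose closure is not a compact subset of \<open>\<Omega>\<close>.\<close>

definition orlicz_sobolev ::
  "(real ^ 'n) metric \<Rightarrow> (real ^ 'n) set \<Rightarrow> (real ^ 'n \<Rightarrow> real) \<Rightarrow> (real ^ 'n \<Rightarrow> real ^ 'n ^ 'n) \<Rightarrow>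
   nat \<Rightarrow> real \<Rightarrow> real \<Rightarrow> (real \<Rightarrow> real) \<Rightarrow> real \<Rightarrow> bool" where
  "orlicz_sobolev m \<Omega> w \<B> k N R \<sigma> C \<longleftrightarrow>
     (\<forall>x r. ball_in m \<Omega> x r \<and> r \<le> R \<and> wmeas w (mball_of m x r) < top \<longrightarrow>
       (\<forall>v \<in> Lip_c (mball_of m x r).
          orlicz_norm (Phi k N) w (mball_of m x r) v \<le>
            ennreal (C * \<sigma> r) / ennsqrt (wmeas w (mball_of m x r)) *
            L2_norm_on (mball_of m x r) (\<lambda>y. \<B> y *v grad v y)))"

section \<open>Adapted cutoff functions\<close>

definition kappa :: "nat \<Rightarrow> real \<Rightarrow> nat \<Rightarrow> real" where
  "kappa k N j = (if real j \<le> E_const k N then (real j)\<^sup>2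
     else (\<Prod>i<k-1. (ln ^^ i) (real j)) * ((ln ^^ (k-1)) (real j)) powr ((N + 1) / 2))"

definition adapted_radii :: "nat \<Rightarrow> real \<Rightarrow> real \<Rightarrow> (nat \<Rightarrow> real) \<Rightarrow> bool" where
  "adapted_radii k N r rad \<longleftrightarrow>
     rad 1 = r \<and>
     (\<exists>c>0. \<forall>j\<ge>1. rad j - rad (Suc j) = c * r / kappa k N j) \<and>
     rad \<longlonglongrightarrow> r / 2"

definition adapted_cutoffs ::
  "(real ^ 'n) metric \<Rightarrow> (real ^ 'n) set \<Rightarrow> (real ^ 'n \<Rightarrow> real) \<Rightarrow> (real ^ 'n \<Rightarrow> real ^ 'n ^ 'n) \<Rightarrow>
   nat \<Rightarrow> real \<Rightarrow> real \<Rightarrow> real ^ 'n \<Rightarrow> real \<Rightarrow> (nat \<Rightarrow> real ^ 'n \<Rightarrow> real) \<Rightarrow> bool" where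
  "adapted_cutoffs m \<Omega> w \<B> k N C x r \<psi> \<longleftrightarrow>
     (\<exists>rad. adapted_radii k N r rad \<and>
       (\<forall>j\<ge>1.
          (\<exists>L. L-lipschitz_on UNIV (\<psi> j)) \<and>
          closure {y. \<psi> j y \<noteq> 0} \<subseteq> mball_of m x (rad j) \<and>
          (\<forall>y \<in> mball_of m x (rad (Suc j)). \<psi> j y = 1) \<and>
          Linf_norm \<Omega> (\<lambda>y. norm (\<B> y *v grad (\<psi> j) y) / sqrt (w y)) \<le>
            ennreal (C * kappa k N j / r)))"

end

theory Submission
  imports Defs
begin

text \<open>De Giorgi iteration. Testing with \<open>\<psi>\<^sup>2 (u - P)\<^sub>+\<close> gives a Caccioppoli inequality in which
  admissibility of \<open>\<phi>\<close> contributes \<open>\<parallel>\<phi>\<parallel>\<^sub>X\<^sup>2 w({u > P})\<close>. Chebyshev's inequality bounds this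
  measure by the mean square over the previous, lower level, so that any top level \<open>M \<ge> \<parallel>\<phi>\<parallel>\<^sub>X\<close>
  will do. On a set of small measure the Orlicz norm improves on the \<open>L\<^sup>2\<close> norm by the factor
  \<open>h(T) = \<Phi>(t) / t\<^sup>2\<close> at \<open>t\<^sup>2 = T\<close>. For the levels \<open>M (2 - 2 r\<^sub>j / r)\<close> and the value \<open>T = e\<^sup>b\<^sup>+\<^sup>j\<close>
  one obtains by induction that the mean square of the \<open>j\<close>-th truncation is at most
  \<open>M\<^sup>2 e\<^sup>-\<^sup>4\<^sup>(\<^sup>b\<^sup>+\<^sup>j\<^sup>)\<close>: the loss \<open>\<kappa>(j)\<^sup>2\<close> caused by the cutoff functions is dominated by \<open>h(e\<^sup>b\<^sup>+\<^sup>j)\<close> as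
  soon as the \<open>(k-1)\<close>-fold logarithm of \<open>b\<close> exceeds a multiple of \<open>(\<sigma>(r) / r)\<close> to the power
  \<open>2 / (N - 1)\<close>. The base case holds when \<open>M\<close> is also at least \<open>e\<^sup>2\<^sup>(\<^sup>b\<^sup>+\<^sup>1\<^sup>)\<close> times the root mean
  square of \<open>u\<^sub>+\<close>. Gradients are the pointwise ones of Lipschitz functions, so the product and
  truncation rules rest on Rademacher's theorem.\<close>

section \<open>Rademacher's theorem\<close>

text \<open>The exponent 2/(N-1) comes from one cancellation. With y = b + j and L the (k-1)-fold
  logarithm of y, the cutoff loss is at most Pi L^((N+1)/2) and the gain is h(e^y) = Pi^2 L^(2N),
  with the same product Pi of lower logarithms. Hence \<open>\<kappa>\<close>(j)^2 / h(e^y) <=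
  L^(1-N), and this has to beat (\<open>\<sigma>\<close>(r)/r)^2. The rate e^(-4(b+j)) is chosen
  because after multiplication by T it still leaves e^(-3(b+j)), which absorbs every remaining power
  of \<open>\<kappa>\<close>. M has two lower bounds; taking their sum gives the norm of
  \<open>\<phi>\<close> the coefficient 1. The square root in the final constant arises from e^(2b)
  = sqrt(e^(4b)). Three obstacles shape the rest. The levels must satisfy |{u = P}| = 0; only
  countably many values of M violate this, so M is first chosen generically and then lowered to its
  limit. The Sobolev space controls only the unweighted L2 norm of u, so the right-hand side may be
  infinite; local boundedness therefore needs a separate proof that it is finite on smaller balls.
  Lower bounds for solutions come from applying the estimate to -u.\<close>

definition straddle_gt :: "(real \<Rightarrow> real) \<Rightarrow> real \<Rightarrow> real \<Rightarrow> bool" where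
  "straddle_gt f q x \<longleftrightarrow>
     (\<forall>d>0. \<exists>a b. a < x \<and> x < b \<and> b - a < d \<and> q * (b - a) < f b - f a)"

text \<open>Straddling pairs a < x < b, instead of one-sided quotients, make each condition open in
  x. The sets where large slopes occur at all scales are then countable intersections of open sets,
  which settles their measurability.\<close>

lemma open_straddle_aux: "open {x::real. \<exists>a b. a < x \<and> x < b \<and> Q a b}"
proof -
  have "{x. \<exists>a b. a < x \<and> x < b \<and> Q a b} = (\<Union>(a,b)\<in>{(a,b). Q a b}. {a<..<b})"
    by (rule set_eqI) (simp, blast)
  then show ?thesis by (auto intro!: open_UN)
qed

lemma straddle_gt_Inter:
  "{x. straddle_gt f q x} =
     (\<Inter>n::nat. {x. \<exists>a b. a < x \<and> x < b \<and> (b - a < 1 / Suc n \<and> q * (b - a) < f b - f a)})"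
proof (intro set_eqI iffI)
  fix x assume "x \<in> {x. straddle_gt f q x}"
  then show "x \<in> (\<Inter>n::nat.
    {x. \<exists>a b. a < x \<and> x < b \<and> (b - a < 1 / Suc n \<and> q * (b - a) < f b - f a)})"
    by (fastforce simp: straddle_gt_def)
next
  fix x assume *:
    "x \<in> (\<Inter>n::nat. {x. \<exists>a b. a < x \<and> x < b \<and> (b - a < 1 / Suc n \<and> q * (b - a) < f b - f a)})"
  have "\<exists>a b. a < x \<and> x < b \<and> b - a < d \<and> q * (b - a) < f b - f a" if "d > 0" for d :: real
  proof -
    obtain n where n: "1 / Suc n < d" using nat_approx_posE[OF \<open>d > 0\<close>] by auto
    have "x \<in> {x. \<exists>a b. a < x \<and> x < b \<and> (b - a < 1 / Suc n \<and> q * (b - a) < f b - f a)}"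
      using * by blast
    then obtain a b where "a < x" "x < b" "b - a < 1 / Suc n" "q * (b - a) < f b - f a"
      by auto
    with n show ?thesis by (intro exI[of _ a] exI[of _ b]) linarith
  qed
  then show "x \<in> {x. straddle_gt f q x}" by (simp add: straddle_gt_def)
qed

lemma straddle_gt_borel: "{x. straddle_gt f q x} \<in> sets borel"
  unfolding straddle_gt_Inter
  by (intro sets.countable_INT'' borel_open open_straddle_aux) auto

text \<open>The intervals of slope above \<open>q\<close> around the points of \<open>E\<close> are
  arbitrarily short, hence form a Vitali cover. They are written as closed balls, with midpoint and
  half length, to fit the covering theorem.\<close>

lemma Vitali_interval:
  fixes E U :: "real set"
  assumes "open U" "E \<subseteq> U" and E: "\<And>x. x \<in> E \<Longrightarrow> straddle_gt f q x"
  obtains C where "countable C" "\<And>a b. (a,b) \<in> C \<Longrightarrow> a < b \<and> {a..b} \<subseteq> U \<and> q * (b - a) < f b - f a"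
    "disjoint_family_on (\<lambda>(a,b). {a..b}) C" "negligible (E - (\<Union>(a,b)\<in>C. {a..b}))"
proof -
  define K where "K = {(a,b). a < b \<and> {a..b} \<subseteq> U \<and> q * (b - a) < f b - f a}"
  define c r where "c = (\<lambda>(a,b). (a + b) / 2 :: real)" and "r = (\<lambda>(a,b). (b - a) / 2 :: real)"
  have cb: "cball (c i) (r i) = (case i of (a,b) \<Rightarrow> {a..b})" for i
    by (cases i) (auto simp: c_def r_def cball_eq_atLeastAtMost field_simps)
  obtain C where C: "countable C" "C \<subseteq> K"
     "pairwise (\<lambda>i j. disjnt (cball (c i) (r i)) (cball (c j) (r j))) C"
     "negligible (E - (\<Union>i \<in> C. cball (c i) (r i)))"
  proof (rule Vitali_covering_theorem_cballs[of K r E c])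
    show "0 < r i" if "i \<in> K" for i using that by (auto simp: K_def r_def)
    fix x d :: real assume "x \<in> E" "d > 0"
    then obtain e where e: "e > 0" "ball x e \<subseteq> U" using \<open>open U\<close> \<open>E \<subseteq> U\<close> openE by blast
    obtain a b where ab: "a < x" "x < b" "b - a < min d e" "q * (b - a) < f b - f a"
      using E[OF \<open>x \<in> E\<close>] \<open>d > 0\<close> \<open>e > 0\<close> unfolding straddle_gt_def by (metis min_less_iff_conj)
    have "{a..b} \<subseteq> ball x e" using ab by (auto simp: dist_real_def)
    then have "(a,b) \<in> K" using ab e by (auto simp: K_def)
    moreover have "x \<in> cball (c (a,b)) (r (a,b))" unfolding cb using ab by auto
    moreover have "r (a,b) < d" using ab by (auto simp: r_def)
    ultimately show "\<exists>i. i \<in> K \<and> x \<in> cball (c i) (r i) \<and> r i < d" by blast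
  qed
  show thesis
  proof
    show "countable C" by fact
    show "\<And>a b. (a,b) \<in> C \<Longrightarrow> a < b \<and> {a..b} \<subseteq> U \<and> q * (b - a) < f b - f a"
      using C(2) by (auto simp: K_def)
    show "disjoint_family_on (\<lambda>(a,b). {a..b}) C"
      using C(3) unfolding cb disjoint_family_on_def pairwise_def disjnt_def by blast
    show "negligible (E - (\<Union>(a,b)\<in>C. {a..b}))" using C(4) unfolding cb .
  qed
qed

text \<open>Lebesgue's argument: cover the exceptional set by disjoint intervals of slope below \<open>p\<close> inside
  an open set of almost the same measure, and then, inside these, by disjoint intervals of slope
  above \<open>q\<close>. Comparing Lebesgue measure with the Stieltjes measure of \<open>g\<close> gives
  \<open>q |E| \<le> p |E|\<close>.\<close>

lemma negligible_straddle_mono: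
  fixes g :: "real \<Rightarrow> real"
  assumes mono: "\<And>x y. x \<le> y \<Longrightarrow> g x \<le> g y" and cont: "continuous_on UNIV g" and pq: "0 < p" "p < q"
  shows "negligible {x. straddle_gt g q x \<and> straddle_gt (\<lambda>x. - g x) (-p) x}"
proof -
  define E where "E = {x. straddle_gt g q x \<and> straddle_gt (\<lambda>x. - g x) (-p) x}"
  define \<mu> where "\<mu> = interval_measure g"
  have E_borel: "E \<in> sets borel"
    unfolding E_def using straddle_gt_borel[of g q] straddle_gt_borel[of "\<lambda>x. - g x" "-p"]
    by (simp add: Collect_conj_eq)
  have rc: "continuous (at_right a) g" for a
    using cont by (auto simp: continuous_on_eq_continuous_within intro: continuous_within_subset)
  have \<mu>_Ioc: "emeasure \<mu> {a<..b} = ennreal (g b - g a)" if "a \<le> b" for a b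
    unfolding \<mu>_def by (rule emeasure_interval_measure_Ioc[OF that mono rc])
  have \<mu>_sets[simp]: "sets \<mu> = sets borel" by (simp add: \<mu>_def)
  have null: "emeasure lborel (E \<inter> ball 0 n) = 0" for n :: real
  proof -
    define F where "F = E \<inter> ball 0 n"
    have F_borel: "F \<in> sets borel" using E_borel by (simp add: F_def)
    have F_fin: "emeasure lborel F < \<infinity>"
    proof -
      have "emeasure lborel F \<le> emeasure lborel (ball (0::real) n)"
        unfolding F_def by (intro emeasure_mono) auto
      also have "\<dots> < \<infinity>" using emeasure_lborel_ball_finite by blast
      finally show ?thesis .
    qed
    have main: "ennreal q * emeasure lborel F \<le> ennreal p * (emeasure lborel F + ennreal e)"
      if "e > 0" for e :: real
    proof -
      obtain U where U: "open U" "F \<subseteq> U" "emeasure lborel (U - F) < ennreal e"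
        using outer_regular_lborel[OF F_borel \<open>e > 0\<close>] by metis
      have U_le: "emeasure lborel U \<le> emeasure lborel F + ennreal e"
      proof -
        have "emeasure lborel U = emeasure lborel F + emeasure lborel (U - F)"
          using U F_borel plus_emeasure[of F lborel "U - F"] by (simp add: Un_absorb1)
        then show ?thesis using U(3) by (simp add: add_left_mono less_imp_le)
      qed
      obtain C where C: "countable C"
        "\<And>a b. (a,b) \<in> C \<Longrightarrow> a < b \<and> {a..b} \<subseteq> U \<and> -p * (b - a) < - g b - - g a"
        "disjoint_family_on (\<lambda>(a,b). {a..b}) C" "negligible (F - (\<Union>(a,b)\<in>C. {a..b}))"
        by (rule Vitali_interval[OF U(1,2), of "\<lambda>x. - g x" "-p"]) (auto simp: F_def E_def)
      \<comment> \<open>Open intervals are taken because the second covering must be placed inside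
        an open set. Only the endpoints are lost, and they are countably many.\<close>
      define V where "V = (\<Union>(a,b)\<in>C. {a<..<b})"
      have V_open: "open V" unfolding V_def by auto
      have "V \<subseteq> U" unfolding V_def using C(2) by fastforce
      have \<mu>V: "emeasure \<mu> V \<le> ennreal p * emeasure lborel U"
      proof -
        have d: "disjoint_family_on (\<lambda>(a,b). {a<..<b}) C"
          using C(3) unfolding disjoint_family_on_def by fastforce
        have "emeasure \<mu> V = (\<integral>\<^sup>+i. emeasure \<mu> (case i of (a,b) \<Rightarrow> {a<..<b}) \<partial>count_space C)"
          unfolding V_def by (rule emeasure_UN_countable) (use C d in auto)
        also have "\<dots> \<le>
          (\<integral>\<^sup>+i. ennreal p * emeasure lborel (case i of (a,b) \<Rightarrow> {a<..<b}) \<partial>count_space C)"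
        proof (rule nn_integral_mono)
          fix i assume "i \<in> space (count_space C)"
          then obtain a b where i: "i = (a,b)" "(a,b) \<in> C" by (cases i) auto
          have "emeasure \<mu> {a<..<b} \<le> emeasure \<mu> {a<..b}" by (rule emeasure_mono) auto
          also have "\<dots> = ennreal (g b - g a)" using C(2)[OF i(2)] by (intro \<mu>_Ioc) auto
          also have "\<dots> \<le> ennreal (p * (b - a))" using C(2)[OF i(2)] by (intro ennreal_leI) auto
          also have "\<dots> = ennreal p * emeasure lborel {a<..<b}"
            using C(2)[OF i(2)] pq by (simp add: ennreal_mult)
          finally show "emeasure \<mu> (case i of (a,b) \<Rightarrow> {a<..<b}) \<le>
              ennreal p * emeasure lborel (case i of (a,b) \<Rightarrow> {a<..<b})" by (simp add: i)
        qed
        also have "\<dots> = ennreal p *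
          (\<integral>\<^sup>+i. emeasure lborel (case i of (a,b) \<Rightarrow> {a<..<b}) \<partial>count_space C)"
          by (rule nn_integral_cmult) auto
        also have "(\<integral>\<^sup>+i. emeasure lborel (case i of (a,b) \<Rightarrow> {a<..<b}) \<partial>count_space C) =
          emeasure lborel V"
          unfolding V_def by (rule emeasure_UN_countable[symmetric]) (use C d in auto)
        also have "\<dots> \<le> emeasure lborel U"
          using \<open>V \<subseteq> U\<close> U by (intro emeasure_mono) auto
        finally show ?thesis by (simp add: mult_left_mono)
      qed
      have FV: "negligible (F - V)"
      proof -
        have "negligible (\<Union>(a,b)\<in>C. {a,b})"
          using countable_imp_null_set_lborel[OF countable_UN[OF C(1), of "\<lambda>(a,b). {a,b}"]]
          by (auto simp: negligible_iff_null_sets null_sets_completionI)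
        then have "negligible ((F - (\<Union>(a,b)\<in>C. {a..b})) \<union> (\<Union>(a,b)\<in>C. {a,b}))"
          using C(4) by (rule negligible_Un[rotated])
        then show ?thesis
          by (rule negligible_subset) (fastforce simp: V_def)
      qed
      obtain D where D: "countable D"
        "\<And>a b. (a,b) \<in> D \<Longrightarrow> a < b \<and> {a..b} \<subseteq> V \<and> q * (b - a) < g b - g a"
        "disjoint_family_on (\<lambda>(a,b). {a..b}) D" "negligible ((F \<inter> V) - (\<Union>(a,b)\<in>D. {a..b}))"
        by (rule Vitali_interval[OF V_open, of "F \<inter> V" g q]) (auto simp: F_def E_def)
      define W where "W = (\<Union>(a,b)\<in>D. {a..b})"
      have W_borel: "W \<in> sets borel" unfolding W_def using D by (intro sets.countable_UN') auto
      have "W \<subseteq> V" unfolding W_def using D(2) by fastforce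
      have \<mu>W: "ennreal q * emeasure lborel W \<le> emeasure \<mu> W"
      proof -
        have "ennreal q * emeasure lborel W = ennreal q *
          (\<integral>\<^sup>+i. emeasure lborel (case i of (a,b) \<Rightarrow> {a..b}) \<partial>count_space D)"
          unfolding W_def by (subst emeasure_UN_countable) (use D in auto)
        also have "\<dots> =
          (\<integral>\<^sup>+i. ennreal q * emeasure lborel (case i of (a,b) \<Rightarrow> {a..b}) \<partial>count_space D)"
          by (rule nn_integral_cmult[symmetric]) auto
        also have "\<dots> \<le> (\<integral>\<^sup>+i. emeasure \<mu> (case i of (a,b) \<Rightarrow> {a..b}) \<partial>count_space D)"
        proof (rule nn_integral_mono)
          fix i assume "i \<in> space (count_space D)"
          then obtain a b where i: "i = (a,b)" "(a,b) \<in> D" by (cases i) auto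
          have "ennreal q * emeasure lborel {a..b} = ennreal (q * (b - a))"
            using D(2)[OF i(2)] pq by (simp add: ennreal_mult)
          also have "\<dots> \<le> ennreal (g b - g a)" using D(2)[OF i(2)] by (intro ennreal_leI) auto
          also have "\<dots> = emeasure \<mu> {a<..b}" using D(2)[OF i(2)] by (intro \<mu>_Ioc[symmetric]) auto
          also have "\<dots> \<le> emeasure \<mu> {a..b}" by (rule emeasure_mono) auto
          finally show "ennreal q * emeasure lborel (case i of (a,b) \<Rightarrow> {a..b}) \<le>
             emeasure \<mu> (case i of (a,b) \<Rightarrow> {a..b})" by (simp add: i)
        qed
        also have "\<dots> = emeasure \<mu> W"
          unfolding W_def by (rule emeasure_UN_countable[symmetric]) (use D in auto)
        finally show ?thesis .
      qed
      have "negligible (F - W)"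
        by (rule negligible_subset[OF negligible_Un[OF FV D(4)]]) (auto simp: W_def)
      then have "emeasure lborel (F - W) = 0"
        using F_borel W_borel by (simp add: negligible_iff_emeasure0 )
      then have "emeasure lborel F \<le> emeasure lborel W"
        using emeasure_subadditive[of "F - W" lborel W] emeasure_mono[of F "(F - W) \<union> W" lborel]
          F_borel W_borel
            by (metis (no_types, lifting) Un_Diff_cancel2 Un_upper1 add_0 order_trans sets.Diff
            sets.Un sets_lborel)
      then have "ennreal q * emeasure lborel F \<le> ennreal q * emeasure lborel W"
        by (rule mult_left_mono) simp
      also have "\<dots> \<le> emeasure \<mu> V"
        using \<mu>W \<open>W \<subseteq> V\<close> V_open emeasure_mono[of W V \<mu>] by (auto intro: order_trans)
      also have "\<dots> \<le> ennreal p * (emeasure lborel F + ennreal e)"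
        using \<mu>V U_le by (meson mult_left_mono order_trans zero_le)
      finally show ?thesis .
    qed
    obtain l where l: "l \<ge> 0" "emeasure lborel F = ennreal l"
      using F_fin by (metis ennreal_cases infinity_ennreal_def less_irrefl)
    have *: "q * l \<le> p * (l + e)" if "e > 0" for e
    proof -
      have "ennreal (q * l) \<le> ennreal (p * (l + e))"
        using main[OF that] l pq that by (simp add: ennreal_mult ennreal_plus)
      then show ?thesis using l pq that by (subst (asm) ennreal_le_iff) auto
    qed
    have "q * l \<le> p * l + e" if "e > 0" for e
      using *[of "e / p"] that pq by (simp add: distrib_left)
    then have "q * l \<le> p * l" by (rule field_le_epsilon)
    then have "l = 0" using l pq by (simp add: mult_le_cancel_right)
    then show ?thesis using l by (simp add: F_def)
  qed
  have "E = (\<Union>n::nat. E \<inter> ball 0 (real n))"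
    using reals_Archimedean2 by (auto simp: dist_real_def)
  moreover have "negligible (E \<inter> ball 0 (real n))" for n
    using null[of n] E_borel by (subst negligible_iff_emeasure0) auto
  ultimately have "negligible E" using negligible_Union_nat[of "\<lambda>n. E \<inter> ball 0 (real n)"] by metis
  then show ?thesis by (simp add: E_def)
qed

lemma straddle_gt_add_linear:
  "straddle_gt (\<lambda>x. f x + c * x) (q + c) x \<longleftrightarrow> straddle_gt f q x"
  by (simp add: straddle_gt_def algebra_simps)

text \<open>The upper limit of the slopes over intervals straddling \<open>x\<close> exceeds the
  lower one: \<open>straddle_gt\<close> for -f and -p means slopes below \<open>p\<close> at all
  scales. Rational witnesses turn the exceptional set into a countable union.\<close>

definition oscillating :: "(real \<Rightarrow> real) \<Rightarrow> real \<Rightarrow> bool" where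
  "oscillating f x \<longleftrightarrow>
     (\<exists>p\<in>\<rat>. \<exists>q\<in>\<rat>. p < q \<and> straddle_gt f q x \<and> straddle_gt (\<lambda>x. - f x) (-p) x)"

lemma negligible_oscillating:
  fixes f :: "real \<Rightarrow> real"
  assumes L: "L-lipschitz_on UNIV f"
  shows "negligible {x. oscillating f x}"
proof -
  have "negligible {x. straddle_gt f q x \<and> straddle_gt (\<lambda>x. - f x) (-p) x}" if "p < q" for p q
  proof -
    \<comment> \<open>Adding c x reduces to increasing functions and positive slopes: the summand
      \<open>L\<close> makes the sum increasing, and \<bar>p\<bar> + 1 makes p + c positive.\<close>
    define c where "c = \<bar>p\<bar> + 1 + L"
    have "L \<ge> 0" using L lipschitz_on_nonneg by blast
    have mono: "f x + c * x \<le> f y + c * y" if "x \<le> y" for x y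
    proof -
      have "\<bar>f x - f y\<bar> \<le> L * (y - x)" using lipschitz_onD[OF L, of x y] that
        by (simp add: dist_real_def)
      moreover have "L * (y - x) \<le> c * (y - x)" using that
        by (intro mult_right_mono) (auto simp: c_def)
      ultimately show ?thesis by (simp add: algebra_simps)
    qed
    have "continuous_on UNIV (\<lambda>x. f x + c * x)"
      using lipschitz_on_continuous_on[OF L] by (intro continuous_intros)
    from negligible_straddle_mono[OF mono this, of "p + c" "q + c"] \<open>p < q\<close> \<open>L \<ge> 0\<close>
    have "negligible {x. straddle_gt (\<lambda>x. f x + c * x) (q + c) x \<and>
      straddle_gt (\<lambda>x. - (f x + c * x)) (-(p + c)) x}"
      by (simp add: c_def)
    moreover have "straddle_gt (\<lambda>x. - (f x + c * x)) (-(p + c)) x \<longleftrightarrow> straddle_gt (\<lambda>x. - f x) (-p) x"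
      for x
      using straddle_gt_add_linear[of "\<lambda>x. - f x" "-c" "-p" x] by (simp add: algebra_simps)
    ultimately show ?thesis by (simp only: straddle_gt_add_linear)
  qed
  then have "negligible (\<Union>(p,q)\<in>{(p,q). p \<in> \<rat> \<and> q \<in> \<rat> \<and> p < q}.
      {x. straddle_gt f q x \<and> straddle_gt (\<lambda>x. - f x) (-p) x})"
  proof (intro negligible_countable_Union countable_image)
    have "countable (\<rat> \<times> \<rat> :: (real \<times> real) set)" by (intro countable_SIGMA countable_rat)
    then show "countable {(p::real,q::real). p \<in> \<rat> \<and> q \<in> \<rat> \<and> p < q}"
      by (rule countable_subset[rotated]) auto
  qed auto
  then show ?thesis
    by (rule negligible_subset) (auto simp: oscillating_def)
qed

text \<open>The derivative is the supremum \<open>D\<close> of the rational slopes exceeded at all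
  scales. Near \<open>x\<close> every straddling slope lies between rationals p < D < q as close to
  \<open>D\<close> as desired, and continuity carries this over to quotients with one endpoint at
  \<open>x\<close>.\<close>

lemma not_oscillating_imp_derivative:
  fixes f :: "real \<Rightarrow> real"
  assumes L: "L-lipschitz_on UNIV f" and x: "\<not> oscillating f x"
  shows "\<exists>D. (f has_real_derivative D) (at x)"
proof -
  define Q where "Q = {q\<in>\<rat>. straddle_gt f q x}"
  have cont: "continuous_on UNIV f" using L lipschitz_on_continuous_on by blast
  have Lb: "\<bar>f b - f a\<bar> \<le> L * (b - a)" if "a \<le> b" for a b
    using lipschitz_onD[OF L, of b a] that by (simp add: dist_real_def)
  \<comment> \<open>All slopes lie between -L and L, so a rational below -L shows that
    \<open>Q\<close> is nonempty; \<open>L\<close> itself is an upper bound.\<close>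
  obtain q0 where q0: "q0 \<in> \<rat>" "q0 < - L" using Rats_no_bot_less by blast
  have "straddle_gt f q0 x"
    unfolding straddle_gt_def
  proof (intro allI impI)
    fix d :: real assume "d > 0"
    show "\<exists>a b. a < x \<and> x < b \<and> b - a < d \<and> q0 * (b - a) < f b - f a"
    proof (intro exI conjI)
      show "x - d/3 < x" "x < x + d/3" "x + d/3 - (x - d/3) < d" using \<open>d > 0\<close> by auto
      have "q0 * (d/3+d/3) < - L * (d/3+d/3)" using q0 \<open>d > 0\<close>
        by (intro mult_strict_right_mono) auto
      moreover have "\<bar>f (x + d/3) - f (x - d/3)\<bar> \<le> L * (d/3+d/3)"
        using Lb[of "x - d/3" "x + d/3"] \<open>d > 0\<close> by simp
      moreover have "x + d/3 - (x - d/3) = d/3+d/3" by simp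
      ultimately show "q0 * (x + d/3 - (x - d/3)) < f (x + d/3) - f (x - d/3)"
        by (metis abs_le_D2 less_le_trans minus_le_iff minus_mult_left)
    qed
  qed
  then have Qne: "Q \<noteq> {}" using q0 by (auto simp: Q_def)
  have Qbd: "q \<le> L" if q: "q \<in> Q" for q
  proof -
    obtain a b where ab: "a < x" "x < b" "q * (b - a) < f b - f a"
      using q zero_less_one unfolding Q_def straddle_gt_def by blast
    then have "q * (b - a) \<le> L * (b - a)" using Lb[of a b] by linarith
    then show ?thesis using ab by (simp add: mult_le_cancel_right)
  qed
  then have bdd: "bdd_above Q" by (auto simp: bdd_above_def)
  define D where "D = Sup Q"
  have "(f has_real_derivative D) (at x)"
    unfolding has_field_derivative_iff
  proof (rule LIM_I)
    fix e :: real assume "e > 0"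
    obtain q where q: "q \<in> \<rat>" "D < q" "q < D + e" using Rats_dense_in_real[of D "D + e"] \<open>e > 0\<close>
      by auto
    obtain p where p: "p \<in> \<rat>" "D - e < p" "p < D" using Rats_dense_in_real[of "D - e" D] \<open>e > 0\<close>
      by auto
    obtain q' where q': "q' \<in> Q" "p < q'" using less_cSup_iff[OF Qne bdd] p by (auto simp: D_def)
    have "\<not> straddle_gt f q x"
    proof
      assume "straddle_gt f q x"
      then have "q \<in> Q" using q by (simp add: Q_def)
      then have "q \<le> D" unfolding D_def by (rule cSup_upper[OF _ bdd])
      then show False using q by simp
    qed
    then obtain d1 where d1: "d1 > 0" "\<And>a b. a < x \<Longrightarrow> x < b \<Longrightarrow> b - a < d1 \<Longrightarrow> f b - f a \<le> q * (b - a)"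
      unfolding straddle_gt_def by (meson not_less)
    have "\<not> straddle_gt (\<lambda>x. - f x) (-p) x"
      using x q' p by (auto simp: oscillating_def Q_def)
    then obtain d2 where d2: "d2 > 0" "\<And>a b. a < x \<Longrightarrow> x < b \<Longrightarrow> b - a < d2 \<Longrightarrow> p * (b - a) \<le> f b - f a"
      unfolding straddle_gt_def by (fastforce simp: not_less)
    define d where "d = min d1 d2"
    have "d > 0" using d1 d2 by (simp add: d_def)
    have slope: "p * (b - a) \<le> f b - f a \<and> f b - f a \<le> q * (b - a)"
      if "a < x" "x < b" "b - a < d" for a b using d1(2)[of a b] d2(2)[of a b] that
        by (auto simp: d_def)
    have contx: "(f \<longlongrightarrow> f x) (at x within S)" for S
      using cont by (meson continuous_on_def UNIV_I tendsto_within_subset subset_UNIV)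
    \<comment> \<open>The left endpoint tends to \<open>x\<close>; the bounds for straddling slopes
      survive the limit by continuity.\<close>
    have right: "p * (b - x) \<le> f b - f x \<and> f b - f x \<le> q * (b - x)" if "x < b" "b - x < d" for b
    proof -
      have ev: "\<forall>\<^sub>F a in at_left x. a < x \<and> b - a < d"
        using that by (auto simp: eventually_at_left_field intro!: exI[of _ "b - d"])
      have "((\<lambda>a. f b - f a - p * (b - a)) \<longlongrightarrow> f b - f x - p * (b - x)) (at_left x)"
        by (intro tendsto_intros contx)
      then have "0 \<le> f b - f x - p * (b - x)"
        by (rule tendsto_lowerbound) (use ev slope that in \<open>auto elim!: eventually_mono\<close>)
      moreover have "((\<lambda>a. q * (b - a) - (f b - f a)) \<longlongrightarrow> q * (b - x) - (f b - f x)) (at_left x)"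
        by (intro tendsto_intros contx)
      then have "0 \<le> q * (b - x) - (f b - f x)"
        by (rule tendsto_lowerbound) (use ev slope that in \<open>auto elim!: eventually_mono\<close>)
      ultimately show ?thesis by auto
    qed
    have left: "p * (x - a) \<le> f x - f a \<and> f x - f a \<le> q * (x - a)" if "a < x" "x - a < d" for a
    proof -
      have ev: "\<forall>\<^sub>F b in at_right x. x < b \<and> b - a < d"
        using that by (auto simp: eventually_at_right_field intro!: exI[of _ "a + d"])
      have "((\<lambda>b. f b - f a - p * (b - a)) \<longlongrightarrow> f x - f a - p * (x - a)) (at_right x)"
        by (intro tendsto_intros contx)
      then have "0 \<le> f x - f a - p * (x - a)"
        by (rule tendsto_lowerbound) (use ev slope that in \<open>auto elim!: eventually_mono\<close>)
      moreover have "((\<lambda>b. q * (b - a) - (f b - f a)) \<longlongrightarrow> q * (x - a) - (f x - f a)) (at_right x)"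
        by (intro tendsto_intros contx)
      then have "0 \<le> q * (x - a) - (f x - f a)"
        by (rule tendsto_lowerbound) (use ev slope that in \<open>auto elim!: eventually_mono\<close>)
      ultimately show ?thesis by auto
    qed
    show "\<exists>s>0. \<forall>y. y \<noteq> x \<and> norm (y - x) < s \<longrightarrow> norm ((f y - f x) / (y - x) - D) < e"
    proof (intro exI[of _ d] conjI allI impI)
      fix y assume y: "y \<noteq> x \<and> norm (y - x) < d"
      have "p \<le> (f y - f x) / (y - x) \<and> (f y - f x) / (y - x) \<le> q"
      proof (cases "x < y")
        case True
        then show ?thesis using right[of y] y by (auto simp: divide_simps)
      next
        case False
        then have "y < x" "x - y < d" using y by auto
        then have "p \<le> (f x - f y) / (x - y) \<and> (f x - f y) / (x - y) \<le> q"
          using left[of y] by (simp add: pos_le_divide_eq pos_divide_le_eq)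
        moreover have "(f y - f x) / (y - x) = (f x - f y) / (x - y)"
          by (metis minus_diff_eq minus_divide_divide)
        ultimately show ?thesis by simp
      qed
      then show "norm ((f y - f x) / (y - x) - D) < e" using p q by (auto simp: abs_less_iff)
    qed fact
  qed
  then show ?thesis by blast
qed

section \<open>Directional derivatives of Lipschitz functions almost everywhere\<close>

lemma open_directional_straddle:
  fixes F :: "'a::euclidean_space \<Rightarrow> real"
  assumes "continuous_on UNIV F"
  shows "open {x. \<exists>a b. a < 0 \<and> 0 < b \<and> b - a < d \<and> q * (b - a) <
    F (x + b *\<^sub>R v) - F (x + a *\<^sub>R v)}"
proof -
  have "{x. \<exists>a b. a < 0 \<and> 0 < b \<and> b - a < d \<and> q * (b - a) < F (x + b *\<^sub>R v) - F (x + a *\<^sub>R v)} =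
    (\<Union>(a,b)\<in>{(a,b). a < 0 \<and> 0 < b \<and> b - a < d}.
      {x. q * (b - a) < F (x + b *\<^sub>R v) - F (x + a *\<^sub>R v)})"
    by auto
  also have "open \<dots>"
    by (intro open_UN ballI)
       (auto intro!: open_Collect_less continuous_intros continuous_on_compose2[OF assms])
  finally show ?thesis .
qed

lemma directional_oscillating_borel:
  fixes F :: "'a::euclidean_space \<Rightarrow> real"
  assumes F: "continuous_on UNIV F"
  shows "{x. oscillating (\<lambda>t. F (x + t *\<^sub>R v)) 0} \<in> sets borel"
proof -
  have *: "{x. straddle_gt (\<lambda>t. G (x + t *\<^sub>R v)) q 0} \<in> sets borel" if G: "continuous_on UNIV G"
    for G q
  proof -
    have "straddle_gt (\<lambda>t. G (x + t *\<^sub>R v)) q 0 \<longleftrightarrow>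
      (\<forall>n::nat. x \<in>
        {x. \<exists>a b. a < 0 \<and> 0 < b \<and> b - a < 1 / Suc n \<and> q * (b - a) < G (x + b *\<^sub>R v) - G
        (x + a *\<^sub>R v)})" for x
      using set_eq_iff[THEN iffD1, OF straddle_gt_Inter[of "\<lambda>t. G (x + t *\<^sub>R v)" q], rule_format,
        of 0] by simp
    then have "{x. straddle_gt (\<lambda>t. G (x + t *\<^sub>R v)) q 0} =
      (\<Inter>n::nat. {x. \<exists>a b. a < 0 \<and> 0 < b \<and> b - a < 1 / Suc n \<and> q * (b - a) < G (x + b *\<^sub>R v) - G
        (x + a *\<^sub>R v)})"
      by auto
    also have "\<dots> \<in> sets borel"
      by (intro sets.countable_INT'' borel_open open_directional_straddle[OF G]) auto
    finally show ?thesis .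
  qed
  have "{x. oscillating (\<lambda>t. F (x + t *\<^sub>R v)) 0} =
    (\<Union>p\<in>\<rat>. \<Union>q\<in>{q\<in>\<rat>. p < q}. {x. straddle_gt (\<lambda>t. F (x + t *\<^sub>R v)) q 0} \<inter>
      {x. straddle_gt (\<lambda>t. - F (x + t *\<^sub>R v)) (-p) 0})"
    by (auto simp: oscillating_def)
  also have "\<dots> \<in> sets borel"
    by (intro sets.countable_UN'' sets.Int * *[where G="\<lambda>x. - F x"] F continuous_on_minus
      countable_rat
        countable_subset[OF _ countable_rat]) blast
  finally show ?thesis .
qed

lemma straddle_gt_shift: "straddle_gt (\<lambda>s. f (t + s)) q 0 \<longleftrightarrow> straddle_gt f q t"
proof
  assume *: "straddle_gt (\<lambda>s. f (t + s)) q 0"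
  show "straddle_gt f q t" unfolding straddle_gt_def
  proof (intro allI impI)
    fix d :: real assume "d > 0"
    then obtain a b where "a < 0" "0 < b" "b - a < d" "q * (b - a) < f (t + b) - f (t + a)"
      using * unfolding straddle_gt_def by blast
    then show "\<exists>a b. a < t \<and> t < b \<and> b - a < d \<and> q * (b - a) < f b - f a"
      by (intro exI[of _ "t + a"] exI[of _ "t + b"]) auto
  qed
next
  assume *: "straddle_gt f q t"
  show "straddle_gt (\<lambda>s. f (t + s)) q 0" unfolding straddle_gt_def
  proof (intro allI impI)
    fix d :: real assume "d > 0"
    then obtain a b where "a < t" "t < b" "b - a < d" "q * (b - a) < f b - f a"
      using * unfolding straddle_gt_def by blast
    then show "\<exists>a b. a < 0 \<and> 0 < b \<and> b - a < d \<and> q * (b - a) < f (t + b) - f (t + a)"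
      by (intro exI[of _ "a - t"] exI[of _ "b - t"]) auto
  qed
qed

lemma lipschitz_on_line:
  fixes F :: "'a::real_normed_vector \<Rightarrow> real"
  assumes L: "L-lipschitz_on UNIV F"
  shows "(L * norm v)-lipschitz_on UNIV (\<lambda>t. F (x + t *\<^sub>R v))"
proof (rule lipschitz_onI)
  fix s t :: real
  have "dist (F (x + s *\<^sub>R v)) (F (x + t *\<^sub>R v)) \<le> L * dist (x + s *\<^sub>R v) (x + t *\<^sub>R v)"
    by (rule lipschitz_onD[OF L]) auto
  also have "dist (x + s *\<^sub>R v) (x + t *\<^sub>R v) = norm v * dist s t"
    by (simp add: dist_norm flip: scaleR_left.diff)
  finally show "dist (F (x + s *\<^sub>R v)) (F (x + t *\<^sub>R v)) \<le> L * norm v * dist s t"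
    by (simp add: mult.assoc)
qed (use lipschitz_on_nonneg[OF L] in auto)

text \<open>Fubini in the pair \<open>(t, x)\<close> for the set \<open>{x + t v \<in> N}\<close>: its sections in \<open>t\<close> are null
  by the one-dimensional case, its sections in \<open>x\<close> are translates of \<open>N\<close>.\<close>

lemma null_directional_oscillating:
  fixes F :: "'a::euclidean_space \<Rightarrow> real"
  assumes L: "L-lipschitz_on UNIV F"
  shows "AE x in lborel. \<not> oscillating (\<lambda>t. F (x + t *\<^sub>R v)) 0"
proof -
  define N where "N = {x. oscillating (\<lambda>t. F (x + t *\<^sub>R v)) 0}"
  have N[measurable]: "N \<in> sets borel"
    unfolding N_def
      by (rule directional_oscillating_borel) (use L lipschitz_on_continuous_on in blast)
  have slice: "(\<integral>\<^sup>+t. indicator N (x + t *\<^sub>R v) \<partial>lborel) = 0" for x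
  proof -
    have "{t. x + t *\<^sub>R v \<in> N} = {t. oscillating (\<lambda>t. F (x + t *\<^sub>R v)) t}"
      using straddle_gt_shift[of "\<lambda>t. F (x + t *\<^sub>R v)"]
        straddle_gt_shift[of "\<lambda>t. - F (x + t *\<^sub>R v)"]
      by (auto simp: N_def oscillating_def algebra_simps)
    moreover have "negligible {t. oscillating (\<lambda>t. F (x + t *\<^sub>R v)) t}"
      by (rule negligible_oscillating[OF lipschitz_on_line[OF L]])
    moreover have m: "{t. x + t *\<^sub>R v \<in> N} \<in> sets borel" by measurable
    ultimately have "emeasure lborel {t. x + t *\<^sub>R v \<in> N} = 0"
      using negligible_iff_emeasure0[of "{t. x + t *\<^sub>R v \<in> N}"] by auto
    moreover have
      "(\<integral>\<^sup>+t. indicator N (x + t *\<^sub>R v) \<partial>lborel) = (\<integral>\<^sup>+t. indicator {t. x + t *\<^sub>R v \<in> N} t \<partial>lborel)"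
      by (intro nn_integral_cong) (auto simp: indicator_def)
    ultimately show ?thesis using m by simp
  qed
  have shift: "(\<integral>\<^sup>+x. indicator N (x + t *\<^sub>R v) \<partial>lborel) = emeasure lborel N" for t :: real
  proof -
    have "emeasure lborel N = (\<integral>\<^sup>+x. indicator N x \<partial>(distr lborel borel ((+) (t *\<^sub>R v))))"
      by (simp add: lborel_distr_plus)
    also have "\<dots> = (\<integral>\<^sup>+x. indicator N (t *\<^sub>R v + x) \<partial>lborel)"
      by (rule nn_integral_distr) measurable
    finally show ?thesis by (simp add: add.commute)
  qed
  have "(\<integral>\<^sup>+t. (\<integral>\<^sup>+x. indicator N (x + t *\<^sub>R v) \<partial>lborel) \<partial>(lborel :: real measure)) =
    (\<integral>\<^sup>+x. (\<integral>\<^sup>+t. indicator N (x + t *\<^sub>R v) \<partial>(lborel :: real measure)) \<partial>lborel)"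
    by (rule lborel_pair.Fubini') measurable
  \<comment> \<open>In one order of integration every section in t is null; in the other every
    section in x has measure |N|, integrated over the whole line of t. So |N| = 0.\<close>
  then have "\<infinity> * emeasure lborel N = 0"
    by (simp add: slice shift mult.commute)
  then have "N \<in> null_sets lborel" by (auto simp: null_sets_def)
  then have "AE x in lborel. x \<notin> N" by (rule AE_not_in)
  then show ?thesis by (simp add: N_def)
qed

text \<open>The limit runs along the single sequence 1/(n+1), so that the function is Borel for
  every Borel \<open>F\<close>; where the directional derivative exists, the two agree.\<close>

definition dir_deriv :: "('a::real_normed_vector \<Rightarrow> real) \<Rightarrow> 'a \<Rightarrow> 'a \<Rightarrow> real" where
  "dir_deriv F v x = lim (\<lambda>n::nat. (F (x + (1 / Suc n) *\<^sub>R v) - F x) * real (Suc n))"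

definition dir_diff :: "('a::real_normed_vector \<Rightarrow> real) \<Rightarrow> 'a \<Rightarrow> 'a \<Rightarrow> bool" where
  "dir_diff F v x \<longleftrightarrow> (\<exists>D. ((\<lambda>t. F (x + t *\<^sub>R v)) has_real_derivative D) (at 0))"

lemma dir_deriv_tendsto:
  fixes F :: "'a::real_normed_vector \<Rightarrow> real"
  assumes D: "((\<lambda>t. F (x + t *\<^sub>R v)) has_real_derivative D) (at 0)"
  shows "(\<lambda>n::nat. (F (x + (1 / Suc n) *\<^sub>R v) - F x) * real (Suc n)) \<longlonglongrightarrow> D"
proof -
  have "((\<lambda>t. (F (x + t *\<^sub>R v) - F x) / t) \<longlongrightarrow> D) (at 0)"
    using D by (simp only: has_field_derivative_iff diff_zero scaleR_zero_left add_0_right)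
  moreover have "filterlim (\<lambda>n::nat. 1 / real (Suc n)) (at 0) sequentially"
    unfolding filterlim_at
    using LIMSEQ_inverse_real_of_nat by (simp add: inverse_eq_divide)
  ultimately have "(\<lambda>n::nat. (F (x + (1 / Suc n) *\<^sub>R v) - F x) / (1 / Suc n)) \<longlonglongrightarrow> D"
    by (rule filterlim_compose)
  then show ?thesis by simp
qed

lemma dir_deriv_eqI:
  assumes "((\<lambda>t. F (x + t *\<^sub>R v)) has_real_derivative D) (at 0)"
  shows "dir_deriv F v x = D"
  unfolding dir_deriv_def using dir_deriv_tendsto[OF assms] by (rule limI)

lemma dir_diff_derivative:
  "dir_diff F v x \<Longrightarrow> ((\<lambda>t. F (x + t *\<^sub>R v)) has_real_derivative dir_deriv F v x) (at 0)"
  unfolding dir_diff_def using dir_deriv_eqI by metis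

lemma dir_deriv_scale:
  assumes "dir_diff F v x"
  shows "dir_deriv F (c *\<^sub>R v) x = c * dir_deriv F v x"
proof (rule dir_deriv_eqI)
  have "((\<lambda>t. F (x + t *\<^sub>R v)) has_real_derivative dir_deriv F v x) (at (0 * c))"
    using dir_diff_derivative[OF assms] by simp
  moreover have "((\<lambda>t. t * c) has_real_derivative c) (at 0)"
    by (auto intro!: derivative_eq_intros)
  ultimately have "((\<lambda>t. F (x + (t * c) *\<^sub>R v)) has_real_derivative dir_deriv F v x * c) (at 0)"
    by (rule DERIV_chain2[where f="\<lambda>t. F (x + t *\<^sub>R v)"])
  then show "((\<lambda>t. F (x + t *\<^sub>R c *\<^sub>R v)) has_real_derivative c * dir_deriv F v x) (at 0)"
    by (simp add: mult.commute)
qed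

lemma AE_dir_diff:
  fixes F :: "'a::euclidean_space \<Rightarrow> real"
  assumes L: "L-lipschitz_on UNIV F"
  shows "AE x in lborel. dir_diff F v x"
  using null_directional_oscillating[OF L, of v]
proof eventually_elim
  case (elim x)
  from not_oscillating_imp_derivative[OF lipschitz_on_line[OF L] elim]
  show ?case by (simp add: dir_diff_def)
qed

lemma dir_quotient_bound:
  fixes F :: "'a::real_normed_vector \<Rightarrow> real"
  assumes L: "L-lipschitz_on UNIV F"
  shows "\<bar>(F (x + (1 / Suc n) *\<^sub>R v) - F x) * real (Suc n)\<bar> \<le> L * norm v"
proof -
  have "\<bar>F (x + (1 / Suc n) *\<^sub>R v) - F x\<bar> \<le> L * norm ((1 / Suc n) *\<^sub>R v)"
    using lipschitz_onD[OF L, of "x + (1 / Suc n) *\<^sub>R v" x] by (simp add: dist_norm)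
  then have "\<bar>F (x + (1 / Suc n) *\<^sub>R v) - F x\<bar> * real (Suc n) \<le> L * norm ((1 / Suc n) *\<^sub>R v) *
    real (Suc n)"
    by (rule mult_right_mono) simp
  then show ?thesis by (simp add: abs_mult)
qed

lemma AE_dir_deriv_bound:
  fixes F :: "'a::euclidean_space \<Rightarrow> real"
  assumes L: "L-lipschitz_on UNIV F"
  shows "AE x in lborel. \<bar>dir_deriv F v x\<bar> \<le> L * norm v"
  using AE_dir_diff[OF L, of v]
proof eventually_elim
  case (elim x)
  have "(\<lambda>n::nat. \<bar>(F (x + (1 / Suc n) *\<^sub>R v) - F x) * real (Suc n)\<bar>) \<longlonglongrightarrow> \<bar>dir_deriv F v x\<bar>"
    by (intro tendsto_rabs dir_deriv_tendsto dir_diff_derivative elim)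
  then show ?case by (rule LIMSEQ_le_const2) (use dir_quotient_bound[OF L] in blast)
qed

lemma borel_measurable_dir_deriv[measurable]:
  fixes F :: "'a::euclidean_space \<Rightarrow> real"
  assumes "F \<in> borel_measurable borel"
  shows "dir_deriv F v \<in> borel_measurable borel"
  unfolding dir_deriv_def[abs_def] using assms by measurable

section \<open>Additivity of the directional derivative in the direction\<close>

lemma integral_lborel_translate:
  fixes f :: "'a::euclidean_space \<Rightarrow> real"
  assumes "f \<in> borel_measurable borel"
  shows "(\<integral>x. f (c + x) \<partial>lborel) = (\<integral>x. f x \<partial>lborel)"
proof -
  have "(\<integral>x. f x \<partial>lborel) = (\<integral>x. f x \<partial>(distr lborel borel ((+) c)))"
    by (simp add: lborel_distr_plus)
  also have "\<dots> = (\<integral>x. f (c + x) \<partial>lborel)"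
    by (rule integral_distr) (use assms in auto)
  finally show ?thesis by simp
qed

text \<open>Adding \<open>C\<close> makes both functions nonnegative almost everywhere, hence
  densities of measures. These agree on boxes, an intersection-stable generator of the Borel sets,
  and densities are unique almost everywhere.\<close>

lemma AE_eq_if_box_integrals_eq:
  fixes f g :: "'a::euclidean_space \<Rightarrow> real"
  assumes [measurable]: "f \<in> borel_measurable borel" "g \<in> borel_measurable borel"
    and f: "AE x in lborel. \<bar>f x\<bar> \<le> C" and g: "AE x in lborel. \<bar>g x\<bar> \<le> C"
    and eq: "\<And>a b. (\<integral>x. indicator (box a b) x * f x \<partial>lborel) =
      (\<integral>x. indicator (box a b) x * g x \<partial>lborel)"
  shows "AE x in lborel. f x = g x"
proof -
  have int: "integrable lborel (\<lambda>x. indicator (box a b) x * h x)"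
    if [measurable]: "h \<in> borel_measurable borel" and h: "AE x in lborel. \<bar>h x\<bar> \<le> C"
      for h :: "'a \<Rightarrow> real" and a b
  proof (rule Bochner_Integration.integrable_bound)
    show "integrable lborel (\<lambda>x::'a. indicator (box a b) x * C)"
      by (intro integrable_mult_left)
        (auto intro!: integrable_real_indicator simp: emeasure_lborel_box_eq)
    show "AE x in lborel. norm (indicator (box a b) x * h x) \<le> norm (indicator (box a b) x * C)"
      using h by eventually_elim (auto simp: indicator_def)
  qed measurable
  have dens: "emeasure (density lborel (\<lambda>x. ennreal (h x + C))) (box a b) =
    ennreal ((\<integral>x. indicator (box a b) x * h x \<partial>lborel) + (\<integral>x. indicator (box a b) x * C \<partial>lborel))"
    if [measurable]: "h \<in> borel_measurable borel" and h: "AE x in lborel. \<bar>h x\<bar> \<le> C"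
      for h :: "'a \<Rightarrow> real" and a b
  proof -
    have C: "AE x::'a in lborel. \<bar>C\<bar> \<le> C" using h by eventually_elim auto
    have "emeasure (density lborel (\<lambda>x. ennreal (h x + C))) (box a b) =
      (\<integral>\<^sup>+x. ennreal (h x + C) * indicator (box a b) x \<partial>lborel)"
      by (rule emeasure_density) auto
    also have "\<dots> =
      (\<integral>\<^sup>+x. ennreal (indicator (box a b) x * h x + indicator (box a b) x * C) \<partial>lborel)"
      by (intro nn_integral_cong) (auto simp: indicator_def)
    also have "\<dots> = ennreal (\<integral>x. indicator (box a b) x * h x + indicator (box a b) x * C \<partial>lborel)"
    proof (rule nn_integral_eq_integral)
      show "integrable lborel (\<lambda>x. indicator (box a b) x * h x + indicator (box a b) x * C)"
        by (intro Bochner_Integration.integrable_add int h C) auto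
      show "AE x in lborel. 0 \<le> indicator (box a b) x * h x + indicator (box a b) x * C"
        using h by eventually_elim (auto simp: indicator_def)
    qed
    also have "(\<integral>x. indicator (box a b) x * h x + indicator (box a b) x * C \<partial>lborel) =
      (\<integral>x. indicator (box a b) x * h x \<partial>lborel) + (\<integral>x. indicator (box a b) x * C \<partial>lborel)"
      by (intro Bochner_Integration.integral_add int h C) auto
    finally show ?thesis .
  qed
  let ?M = "\<lambda>h. density lborel (\<lambda>x. ennreal (h x + C)) :: 'a measure"
  have "?M f = ?M g"
  proof (rule measure_eqI_generator_eq)
    let ?E = "range (\<lambda>(a, b). box a b::'a set)"
    show "Int_stable ?E" by (auto simp: Int_stable_def box_Int_box)
    show "?E \<subseteq> Pow UNIV" "sets (?M f) = sigma_sets UNIV ?E" "sets (?M g) = sigma_sets UNIV ?E"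
      by (simp_all add: borel_eq_box)
    let ?A = "\<lambda>n::nat. box (- (real n *\<^sub>R One)) (real n *\<^sub>R One) :: 'a set"
    show "range ?A \<subseteq> ?E" "(\<Union>i. ?A i) = UNIV" unfolding UN_box_eq_UNIV by auto
    show "emeasure (?M f) (?A i) \<noteq> \<infinity>" for i using f by (subst dens) auto
    show "emeasure (?M f) X = emeasure (?M g) X" if "X \<in> ?E" for X
      using that f g eq by (auto simp: dens)
  qed
  then have "AE x in lborel. ennreal (f x + C) = ennreal (g x + C)"
    by (intro sigma_finite_measure.density_unique[OF sigma_finite_lborel]) auto
  then show ?thesis using f g by eventually_elim auto
qed

text \<open>Additivity holds in the mean over every box: the quotient of \<open>F\<close> in direction \<open>v\<close> at
  \<open>x + u / n\<close> is
  translated back to \<open>x\<close>, which moves the box only by \<open>u / n\<close>.\<close>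

lemma AE_dir_deriv_add:
  fixes F :: "'a::euclidean_space \<Rightarrow> real"
  assumes L: "L-lipschitz_on UNIV F"
  shows "AE x in lborel. dir_deriv F (u + v) x = dir_deriv F u x + dir_deriv F v x"
proof -
  have [measurable]: "F \<in> borel_measurable borel"
    using lipschitz_on_continuous_on[OF L] by (rule borel_measurable_continuous_onI)
  have L0: "L \<ge> 0" using lipschitz_on_nonneg[OF L] .
  define q where "q = (\<lambda>v (n::nat) x. (F (x + (1 / Suc n) *\<^sub>R v) - F x) * real (Suc n))"
  have q_meas[measurable]: "q v n \<in> borel_measurable borel" for v n unfolding q_def by measurable
  have q_bound: "\<bar>q v n x\<bar> \<le> L * norm v" for v n x unfolding q_def
    by (rule dir_quotient_bound[OF L])
  have q_lim: "AE x in lborel. (\<lambda>n. q v n x) \<longlonglongrightarrow> dir_deriv F v x" for v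
    using AE_dir_diff[OF L, of v] unfolding q_def
      by eventually_elim (intro dir_deriv_tendsto dir_diff_derivative)
  show ?thesis
  proof (rule AE_eq_if_box_integrals_eq[where C="L * (norm u + norm v)"])
    show "dir_deriv F (u + v) \<in> borel_measurable borel"
      "(\<lambda>x. dir_deriv F u x + dir_deriv F v x) \<in> borel_measurable borel"
      by measurable
    have uv: "L * norm (u + v) \<le> L * (norm u + norm v)" using L0 norm_triangle_ineq
      by (intro mult_left_mono) auto
    show "AE x in lborel. \<bar>dir_deriv F (u + v) x\<bar> \<le> L * (norm u + norm v)"
      using AE_dir_deriv_bound[OF L, of "u + v"] by eventually_elim (use uv in auto)
    show "AE x in lborel. \<bar>dir_deriv F u x + dir_deriv F v x\<bar> \<le> L * (norm u + norm v)"
      using AE_dir_deriv_bound[OF L, of u] AE_dir_deriv_bound[OF L, of v]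
      by eventually_elim (auto simp: distrib_left)
    fix a b :: 'a
    define I :: "'a \<Rightarrow> real" where "I = indicator (box a b)"
    have [measurable]: "I \<in> borel_measurable borel" unfolding I_def by measurable
    have lim1: "(\<lambda>n. \<integral>x. I x * q w n x \<partial>lborel) \<longlonglongrightarrow> (\<integral>x. I x * dir_deriv F w x \<partial>lborel)" for w
    proof (rule integral_dominated_convergence[where w="\<lambda>x. I x * (L * norm w)"])
      show "integrable lborel (\<lambda>x. I x * (L * norm w))"
        unfolding I_def
          by (intro integrable_mult_left)
          (auto intro!: integrable_real_indicator simp: emeasure_lborel_box_eq)
      show "AE x in lborel. (\<lambda>n. I x * q w n x) \<longlonglongrightarrow> I x * dir_deriv F w x"
        using q_lim[of w] by eventually_elim (intro tendsto_intros)
      show "AE x in lborel. norm (I x * q w n x) \<le> I x * (L * norm w)" for n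
        using q_bound by (auto simp: abs_mult I_def indicator_def)
    qed measurable
    \<comment> \<open>The translates of the box by u/(n+1) all lie in the enlarged box
      \<open>Q\<close>, which gives an integrable majorant independent of n.\<close>
    define Q where "Q = box (a - (\<Sum>i\<in>Basis. norm u *\<^sub>R i)) (b + (\<Sum>i\<in>Basis. norm u *\<^sub>R i))"
    have [measurable]: "Q \<in> sets borel" by (simp add: Q_def)
    have lim2: "(\<lambda>n. \<integral>x. I (x - (1 / Suc n) *\<^sub>R u) * q v n x \<partial>lborel)
      \<longlonglongrightarrow> (\<integral>x. I x * dir_deriv F v x \<partial>lborel)"
    proof (rule integral_dominated_convergence[where w="\<lambda>x. indicator Q x * (L * norm v)"])
      show "integrable lborel (\<lambda>x. indicator Q x * (L * norm v))"
        unfolding Q_def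
          by (intro integrable_mult_left)
          (auto intro!: integrable_real_indicator simp: emeasure_lborel_box_eq)
      show "AE x in lborel. norm (I (x - (1 / Suc n) *\<^sub>R u) * q v n x) \<le> indicator Q x *
        (L * norm v)" for n
      proof (rule AE_I2)
        fix x
        show "norm (I (x - (1 / Suc n) *\<^sub>R u) * q v n x) \<le> indicator Q x * (L * norm v)"
        proof (cases "x - (1 / Suc n) *\<^sub>R u \<in> box a b")
          case True
          have "a \<bullet> i - norm u < x \<bullet> i \<and> x \<bullet> i < b \<bullet> i + norm u" if i: "i \<in> Basis" for i
          proof -
            have "\<bar>((1 / Suc n) *\<^sub>R u) \<bullet> i\<bar> \<le> norm ((1 / Suc n) *\<^sub>R u)" using Basis_le_norm[OF i]
              by blast
            also have "\<dots> \<le> norm u" by (simp add: divide_simps mult_le_cancel_left1)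
            finally have "\<bar>((1 / Suc n) *\<^sub>R u) \<bullet> i\<bar> \<le> norm u" .
            moreover have "a \<bullet> i < x \<bullet> i - ((1 / Suc n) *\<^sub>R u) \<bullet> i"
              "x \<bullet> i - ((1 / Suc n) *\<^sub>R u) \<bullet> i < b \<bullet> i"
              using True i by (auto simp: mem_box inner_diff_left)
            ultimately show ?thesis by linarith
          qed
          then have "x \<in> Q"
            by (simp add: Q_def mem_box inner_diff_left inner_add_left inner_sum_left_Basis)
          then show ?thesis using q_bound[of v n x] True by (simp add: I_def)
        qed (simp add: I_def L0)
      qed
      \<comment> \<open>Off the null boundary of the box the translated indicators are eventually
        equal to the indicator itself.\<close>
      have "negligible (frontier (box a b))" by (intro negligible_convex_frontier convex_box)
      then have fr: "AE x in lborel. x \<notin> frontier (box a b)"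
        by (intro AE_not_in) (simp add: negligible_iff_null_sets null_sets_completion_iff)
      show "AE x in lborel. (\<lambda>n. I (x - (1 / Suc n) *\<^sub>R u) * q v n x) \<longlonglongrightarrow> I x * dir_deriv F v x"
        using q_lim[of v] fr
      proof eventually_elim
        case (elim x)
        have "(\<lambda>n. (1 / real (Suc n)) *\<^sub>R u) \<longlonglongrightarrow> 0 *\<^sub>R u"
          by (intro tendsto_intros)
            (use LIMSEQ_inverse_real_of_nat in \<open>simp add: inverse_eq_divide\<close>)
        then have lim: "(\<lambda>n. x - (1 / real (Suc n)) *\<^sub>R u) \<longlonglongrightarrow> x"
          using tendsto_diff[OF tendsto_const[of x]] by fastforce
        have "eventually (\<lambda>n. I (x - (1 / real (Suc n)) *\<^sub>R u) = I x) sequentially"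
        proof (cases "x \<in> box a b")
          case True
          show ?thesis using topological_tendstoD[OF lim open_box True]
            by eventually_elim (use True in \<open>auto simp: I_def\<close>)
        next
          case False
          then have "x \<in> - closure (box a b)" using elim closure_Un_frontier by blast
          then have "\<forall>\<^sub>F n in sequentially. x - (1 / real (Suc n)) *\<^sub>R u \<in> - closure (box a b)"
            by (intro topological_tendstoD[OF lim]) auto
          then show ?thesis
            by eventually_elim
              (use False closure_subset[of "box a b"] in \<open>auto simp: I_def indicator_def\<close>)
        qed
        then have "(\<lambda>n. I (x - (1 / real (Suc n)) *\<^sub>R u)) \<longlonglongrightarrow> I x" by (rule tendsto_eventually)
        then show ?case using elim by (intro tendsto_mult)
      qed
    qed measurable
    have int: "integrable lborel (\<lambda>x. I x * g x)"
      if [measurable]: "g \<in> borel_measurable borel" and g: "\<And>x. \<bar>g x\<bar> \<le> C" for g C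
    proof (rule Bochner_Integration.integrable_bound)
      show "integrable lborel (\<lambda>x. I x * C)"
        unfolding I_def
          by (intro integrable_mult_left)
          (auto intro!: integrable_real_indicator simp: emeasure_lborel_box_eq)
      show "AE x in lborel. norm (I x * g x) \<le> norm (I x * C)"
        using order_trans[OF g abs_ge_self] by (intro AE_I2) (auto simp: I_def indicator_def)
    qed measurable
    \<comment> \<open>Exact before the limit: the increment from x to x + (u+v)/n is the increment
      in direction u at x plus the increment in direction v at x + u/n; the latter is then
      translated.\<close>
    have split:
      "(\<integral>x. I x * q (u + v) n x \<partial>lborel) = (\<integral>x. I x * q u n x \<partial>lborel) +
      (\<integral>x. I (x - (1 / Suc n) *\<^sub>R u) * q v n x \<partial>lborel)" for n
    proof -
      have "(\<integral>x. I x * q (u + v) n x \<partial>lborel) =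
        (\<integral>x. I x * q u n x + I x * q v n ((1 / Suc n) *\<^sub>R u + x) \<partial>lborel)"
        by (intro Bochner_Integration.integral_cong)
          (auto simp: q_def algebra_simps scaleR_add_right)
      also have "\<dots> = (\<integral>x. I x * q u n x \<partial>lborel) +
        (\<integral>x. I x * q v n ((1 / Suc n) *\<^sub>R u + x) \<partial>lborel)"
        by (intro Bochner_Integration.integral_add int[of _ "L * norm u"] int[of _ "L * norm v"]
          q_bound) measurable
      also have "(\<integral>x. I x * q v n ((1 / Suc n) *\<^sub>R u + x) \<partial>lborel) =
        (\<integral>x. I (x - (1 / Suc n) *\<^sub>R u) * q v n x \<partial>lborel)"
        by (subst integral_lborel_translate[symmetric, where c="(1 / Suc n) *\<^sub>R u"]) auto
      finally show ?thesis .
    qed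
    have "(\<integral>x. I x * dir_deriv F (u + v) x \<partial>lborel) = (\<integral>x. I x * dir_deriv F u x \<partial>lborel) +
      (\<integral>x. I x * dir_deriv F v x \<partial>lborel)"
      using lim1[of "u + v"] tendsto_add[OF lim1[of u] lim2] unfolding split by (rule LIMSEQ_unique)
    also have "\<dots> = (\<integral>x. I x * dir_deriv F u x + I x * dir_deriv F v x \<partial>lborel)"
    proof -
      have "integrable lborel (\<lambda>x. I x * dir_deriv F w x)" for w
      proof (rule Bochner_Integration.integrable_bound)
        show "integrable lborel (\<lambda>x. I x * (L * norm w))"
          unfolding I_def
            by (intro integrable_mult_left)
            (auto intro!: integrable_real_indicator simp: emeasure_lborel_box_eq)
        show "AE x in lborel. norm (I x * dir_deriv F w x) \<le> norm (I x * (L * norm w))"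
          using AE_dir_deriv_bound[OF L, of w] by eventually_elim (auto simp: I_def indicator_def)
      qed measurable
      then show ?thesis by (intro Bochner_Integration.integral_add[symmetric])
    qed
    finally show
      "(\<integral>x. indicator (box a b) x * dir_deriv F (u + v) x \<partial>lborel) =
      (\<integral>x. indicator (box a b) x * (dir_deriv F u x + dir_deriv F v x) \<partial>lborel)"
      by (simp add: I_def distrib_left)
  qed
qed

section \<open>From directional derivatives to total differentiability\<close>

lemma rational_combinations_dense:
  fixes x :: "'a::euclidean_space"
  assumes "e > 0"
  obtains f where "f \<in> PiE Basis (\<lambda>_. \<rat>)" "norm (x - (\<Sum>b\<in>Basis. f b *\<^sub>R b)) < e"
proof -
  define d where "d = e / (2 * DIM('a))"
  have "d > 0" using assms by (simp add: d_def)
  have "\<exists>q\<in>\<rat>. \<bar>x \<bullet> b - q\<bar> < d" for b :: 'a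
    using Rats_dense_in_real[of "x \<bullet> b - d" "x \<bullet> b + d"] \<open>d > 0\<close>
      by (auto simp: abs_less_iff intro!: bexI)
  then obtain q where q: "\<And>b::'a. q b \<in> \<rat>" "\<And>b::'a. \<bar>x \<bullet> b - q b\<bar> < d" by metis
  define f where "f = restrict q Basis"
  have "norm (x - (\<Sum>b\<in>Basis. f b *\<^sub>R b)) \<le> (\<Sum>i\<in>Basis. \<bar>(x - (\<Sum>b\<in>Basis. f b *\<^sub>R b)) \<bullet> i\<bar>)"
    by (rule norm_le_l1)
  also have "\<dots> \<le> (\<Sum>i\<in>(Basis::'a set). d)"
    using q by (intro sum_mono) (simp add: inner_diff_left f_def inner_sum_left_Basis less_imp_le)
  also have "\<dots> < e" using assms by (simp add: d_def)
  finally show thesis using q by (intro that[of f]) (auto simp: f_def)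
qed

text \<open>By compactness of the unit sphere finitely many directions from \<open>T\<close> are
  \<open>d\<close>-dense in it, so their derivatives converge at a common rate. The Lipschitz bound
  transfers this to all other directions.\<close>

lemma differentiable_if_dense_directions:
  fixes F :: "'a::euclidean_space \<Rightarrow> real"
  assumes L: "L-lipschitz_on UNIV F"
    and T: "\<And>v e. e > 0 \<Longrightarrow> \<exists>w\<in>T. norm (v - w) < e"
    and D: "\<And>v. v \<in> T \<Longrightarrow> ((\<lambda>t. F (x + t *\<^sub>R v)) has_real_derivative a \<bullet> v) (at 0)"
  shows "(F has_derivative (\<lambda>h. a \<bullet> h)) (at x)"
  unfolding has_derivative_within_alt
proof (intro conjI allI impI)
  show "bounded_linear ((\<bullet>) a)" by (rule bounded_linear_inner_right)
  fix e :: real assume "e > 0"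
  have L0: "L \<ge> 0" using lipschitz_on_nonneg[OF L] .
  \<comment> \<open>Three errors of size d t, L d t and |a| d t have to add up to at most e t: the
    quotient in the nearby direction, the change of \<open>F\<close>, and the change of the linear
    form.\<close>
  define d where "d = e / (1 + L + norm a)"
  have d0: "d > 0" using \<open>e > 0\<close> L0 by (simp add: d_def add_pos_nonneg)
  have "sphere (0::'a) 1 \<subseteq> (\<Union>w\<in>T. ball w d)"
  proof
    fix v :: 'a
    obtain w where "w \<in> T" "norm (v - w) < d" using T[OF d0] by blast
    then show "v \<in> (\<Union>w\<in>T. ball w d)" by (auto simp: dist_norm norm_minus_commute)
  qed
  then obtain S where S: "S \<subseteq> T" "finite S" "sphere (0::'a) 1 \<subseteq> (\<Union>w\<in>S. ball w d)"
    using compactE_image[OF compact_sphere, of T "\<lambda>w. ball w d" 0 1] open_ball by metis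
  have "\<forall>w\<in>S. \<exists>r>0. \<forall>t. \<bar>t\<bar> < r \<longrightarrow> \<bar>F (x + t *\<^sub>R w) - F x - t * (a \<bullet> w)\<bar> \<le> d * \<bar>t\<bar>"
  proof
    fix w assume "w \<in> S"
    then have "((\<lambda>t. F (x + t *\<^sub>R w)) has_derivative (\<lambda>t. (a \<bullet> w) * t)) (at 0)"
      using D S(1) by (auto simp: has_field_derivative_def)
    then have "\<exists>r>0. \<forall>t\<in>UNIV. norm (t - 0) < r \<longrightarrow>
        norm (F (x + t *\<^sub>R w) - F (x + 0 *\<^sub>R w) - (a \<bullet> w) * (t - 0)) \<le> d * norm (t - 0)"
      unfolding has_derivative_within_alt using d0 by blast
    then show "\<exists>r>0. \<forall>t. \<bar>t\<bar> < r \<longrightarrow> \<bar>F (x + t *\<^sub>R w) - F x - t * (a \<bullet> w)\<bar> \<le> d * \<bar>t\<bar>"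
      by (auto simp: mult.commute)
  qed
  then obtain r where r: "\<And>w. w \<in> S \<Longrightarrow> r w > 0"
    "\<And>w t. w \<in> S \<Longrightarrow> \<bar>t\<bar> < r w \<Longrightarrow> \<bar>F (x + t *\<^sub>R w) - F x - t * (a \<bullet> w)\<bar> \<le> d * \<bar>t\<bar>"
    by metis
  define R where "R = Min (insert 1 (r ` S))"
  have R: "R > 0" "\<And>w. w \<in> S \<Longrightarrow> R \<le> r w"
    unfolding R_def using S(2) r(1) by (auto simp: Min_gr_iff)
  show "\<exists>R>0. \<forall>y\<in>UNIV. norm (y - x) < R \<longrightarrow> norm (F y - F x - a \<bullet> (y - x)) \<le> e * norm (y - x)"
  proof (intro exI[of _ R] conjI ballI impI)
    fix y assume y: "norm (y - x) < R"
    show "norm (F y - F x - a \<bullet> (y - x)) \<le> e * norm (y - x)"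
    proof (cases "y = x")
      case False
      define t where "t = norm (y - x)"
      define v where "v = (y - x) /\<^sub>R t"
      have t: "t > 0" "t < R" using False y by (auto simp: t_def)
      have "norm v = 1" using t by (simp add: v_def t_def)
      have yv: "y = x + t *\<^sub>R v" using t by (simp add: v_def)
      obtain w where w: "w \<in> S" "norm (w - v) < d"
      proof -
        have "v \<in> sphere 0 1" using \<open>norm v = 1\<close> by simp
        then obtain w where "w \<in> S" "v \<in> ball w d" using S(3) by blast
        then show thesis using that[of w] by (simp add: dist_norm)
      qed
      have "\<bar>F (x + t *\<^sub>R v) - F (x + t *\<^sub>R w)\<bar> \<le> L * norm (t *\<^sub>R v - t *\<^sub>R w)"
        using lipschitz_onD[OF L, of "x + t *\<^sub>R v" "x + t *\<^sub>R w"] by (simp add: dist_norm)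
      also have "norm (t *\<^sub>R v - t *\<^sub>R w) = t * norm (w - v)"
        using t by (simp flip: scaleR_diff_right add: norm_minus_commute)
      also have "L * (t * norm (w - v)) \<le> L * (t * d)"
        using w t L0 by (intro mult_left_mono) auto
      finally have 1: "\<bar>F (x + t *\<^sub>R v) - F (x + t *\<^sub>R w)\<bar> \<le> L * (t * d)" .
      have 2: "\<bar>F (x + t *\<^sub>R w) - F x - t * (a \<bullet> w)\<bar> \<le> d * t"
        using r(2)[OF w(1), of t] R(2)[OF w(1)] t by auto
      have "\<bar>a \<bullet> (w - v)\<bar> \<le> norm a * norm (w - v)" by (rule Cauchy_Schwarz_ineq2)
      also have "\<dots> \<le> norm a * d" using w by (intro mult_left_mono) auto
      finally have "t * \<bar>a \<bullet> (w - v)\<bar> \<le> t * (norm a * d)" using t by (intro mult_left_mono) auto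
      then have 3: "\<bar>t * (a \<bullet> w) - t * (a \<bullet> v)\<bar> \<le> t * (norm a * d)"
        using t by (simp add: inner_diff_right abs_mult flip: right_diff_distrib)
      have "\<bar>F (x + t *\<^sub>R v) - F x - t * (a \<bullet> v)\<bar> \<le> L * (t * d) + d * t + t * (norm a * d)"
        using 1 2 3 by linarith
      also have "\<dots> = (d * (1 + L + norm a)) * t" by (simp add: algebra_simps)
      also have "d * (1 + L + norm a) = e"
      proof -
        have "1 + L + norm a > 0" using L0 norm_ge_zero[of a] by linarith
        then show ?thesis by (simp add: d_def)
      qed
      finally show ?thesis using t by (simp add: yv \<open>norm v = 1\<close>)
    qed simp
  qed (rule R(1))
qed

text \<open>Linearity in the direction holds off a null set depending on the directions involved.
  Only rational combinations of the basis are used: they are countably many, so one null set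
  suffices, and they are dense.\<close>

theorem Rademacher:
  fixes F :: "'a::euclidean_space \<Rightarrow> real"
  assumes L: "L-lipschitz_on UNIV F"
  shows "AE x in lborel. F differentiable (at x)"
proof -
  have sum: "AE x in lborel. dir_deriv F (\<Sum>b\<in>S. f b *\<^sub>R b) x = (\<Sum>b\<in>S. f b * dir_deriv F b x)"
    if "finite S" for S :: "'a set" and f
    using that
  proof induction
    case empty
    show ?case by (auto simp: dir_deriv_def)
  next
    case (insert c S)
    show ?case
      using insert.IH AE_dir_deriv_add[OF L, of "f c *\<^sub>R c" "\<Sum>b\<in>S. f b *\<^sub>R b"]
        AE_dir_diff[OF L, of c]
      by eventually_elim (use insert.hyps in \<open>simp add: dir_deriv_scale\<close>)
  qed
  let ?P = "PiE Basis (\<lambda>_. \<rat>) :: ('a \<Rightarrow> real) set"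
  have P: "countable ?P" by (intro countable_PiE countable_rat) auto
  have "AE x in lborel. \<forall>f\<in>?P. dir_deriv F (\<Sum>b\<in>Basis. f b *\<^sub>R b) x =
    (\<Sum>b\<in>Basis. f b * dir_deriv F b x)"
    unfolding AE_ball_countable[OF P] by (intro ballI sum finite_Basis)
  moreover have "AE x in lborel. \<forall>f\<in>?P. dir_diff F (\<Sum>b\<in>Basis. f b *\<^sub>R b) x"
    unfolding AE_ball_countable[OF P] by (intro ballI AE_dir_diff[OF L])
  ultimately show ?thesis
  proof eventually_elim
    case (elim x)
    define a where "a = (\<Sum>b\<in>Basis. dir_deriv F b x *\<^sub>R b)"
    have "(F has_derivative (\<lambda>h. a \<bullet> h)) (at x)"
    proof (rule differentiable_if_dense_directions[OF L, of "(\<lambda>f. \<Sum>b\<in>Basis. f b *\<^sub>R b) ` ?P"])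
      show "\<exists>w\<in>(\<lambda>f. \<Sum>b\<in>Basis. f b *\<^sub>R b) ` ?P. norm (v - w) < e" if "e > 0" for v :: 'a and e
        by (rule rational_combinations_dense[OF \<open>e > 0\<close>, of v]) blast
      fix v assume "v \<in> (\<lambda>f. \<Sum>b\<in>Basis. f b *\<^sub>R b) ` ?P"
      then obtain f where f: "f \<in> ?P" "v = (\<Sum>b\<in>Basis. f b *\<^sub>R b)" by blast
      have "a \<bullet> v = (\<Sum>b\<in>Basis. f b * dir_deriv F b x)"
        by (simp add: f a_def inner_sum_right inner_sum_left_Basis mult.commute)
      then have "a \<bullet> v = dir_deriv F v x"
        using elim(1)[rule_format, OF f(1)] f(2) by metis
      moreover have "dir_diff F v x" using elim(2)[rule_format, OF f(1)] f(2) by metis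
      ultimately show "((\<lambda>t. F (x + t *\<^sub>R v)) has_real_derivative a \<bullet> v) (at 0)"
        using dir_diff_derivative by metis
    qed
    then show ?case by (auto simp: differentiable_def)
  qed
qed

text \<open>Composition with the nearest-point projection onto a small closed ball gives a globally
  Lipschitz function that agrees with \<open>F\<close> inside the ball. Negligibility is a local
  property, so this is enough.\<close>

lemma negligible_nondifferentiable_locally_lipschitz:
  fixes F :: "'a::euclidean_space \<Rightarrow> real"
  assumes S: "open S" and F: "\<And>x. x \<in> S \<Longrightarrow> \<exists>e>0. \<exists>L. L-lipschitz_on (ball x e \<inter> S) F"
  shows "negligible {x\<in>S. \<not> F differentiable (at x)}"
  unfolding locally_negligible_alt[of "{x\<in>S. \<not> F differentiable (at x)}"]
proof
  fix x assume x: "x \<in> {x\<in>S. \<not> F differentiable (at x)}"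
  then obtain e0 L where e0: "e0 > 0" "L-lipschitz_on (ball x e0 \<inter> S) F" using F by blast
  obtain e1 where e1: "e1 > 0" "ball x e1 \<subseteq> S" using S x openE by blast
  define e where "e = min e0 e1 / 2"
  have e: "e > 0" "cball x e \<subseteq> ball x e0 \<inter> S"
    using e0(1) e1 by (auto simp: e_def subset_iff)
  define G where "G = F \<circ> closest_point (cball x e)"
  have cp: "closest_point (cball x e) y \<in> cball x e" for y
    using e by (intro closest_point_in_set) auto
  have "L-lipschitz_on (cball x e) F" using e0(2) e(2) by (rule lipschitz_on_subset)
  moreover have "1-lipschitz_on UNIV (closest_point (cball x e))"
    using e by (intro lipschitz_onI) (auto intro!: closest_point_lipschitz)
  moreover have "closest_point (cball x e) ` UNIV \<subseteq> cball x e" using cp by blast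
  ultimately have "(L * 1)-lipschitz_on UNIV G"
    unfolding G_def by (intro lipschitz_on_compose) (auto intro: lipschitz_on_subset)
  then have "AE y in lborel. G differentiable (at y)" using Rademacher by auto
  then obtain N where N: "N \<in> null_sets lborel" "{y. \<not> G differentiable (at y)} \<subseteq> N"
    by (auto simp: eventually_ae_filter)
  then have neg: "negligible {y. \<not> G differentiable (at y)}"
    by (meson negligible_iff_null_sets negligible_subset null_sets_completionI)
  have "F differentiable (at y)" if "G differentiable (at y)" "y \<in> ball x e" for y
  proof -
    have "(F has_derivative D) (at y)" if "(G has_derivative D) (at y)" for D
      by (rule has_derivative_transform_within_open[OF that open_ball \<open>y \<in> ball x e\<close>])
         (simp add: G_def closest_point_self)
    then show ?thesis using \<open>G differentiable (at y)\<close> by (auto simp: differentiable_def)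
  qed
  then have "{x\<in>S. \<not> F differentiable (at x)} \<inter> ball x e \<subseteq> {y. \<not> G differentiable (at y)}" by auto
  with neg have "negligible ({x\<in>S. \<not> F differentiable (at x)} \<inter> ball x e)"
    by (rule negligible_subset)
  then show "\<exists>U. openin (top_of_set {x\<in>S. \<not> F differentiable (at x)}) U \<and> x \<in> U \<and> negligible U"
    using x e by (intro exI[of _ "{x\<in>S. \<not> F differentiable (at x)} \<inter> ball x e"]) auto
qed

section \<open>Gradients of Lipschitz functions\<close>

lemma grad_eqI:
  assumes "GDERIV v x :> D"
  shows "grad v x = D"
proof -
  have "D' = D" if "GDERIV v x :> D'" for D'
  proof -
    have "(\<lambda>h. h \<bullet> D') = (\<lambda>h. h \<bullet> D)"
      using that assms unfolding gderiv_def by (rule has_derivative_unique)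
    from fun_cong[OF this, of "D' - D"] have "(D' - D) \<bullet> D' = (D' - D) \<bullet> D" .
    then have "(D' - D) \<bullet> (D' - D) = 0" by (simp add: inner_diff_right)
    then show ?thesis by simp
  qed
  then have "(THE D. GDERIV v x :> D) = D" using assms by (intro the_equality)
  then show ?thesis using assms by (auto simp: grad_def)
qed

lemma GDERIV_grad:
  assumes "f differentiable (at x)"
  shows "GDERIV f x :> grad f x"
proof -
  obtain D where D: "(f has_derivative D) (at x)" using assms by (auto simp: differentiable_def)
  interpret bounded_linear D using D by (rule has_derivative_bounded_linear)
  define a where "a = (\<Sum>b\<in>Basis. D b *\<^sub>R b)"
  have "D h = h \<bullet> a" for h
  proof -
    have "D h = D (\<Sum>b\<in>Basis. (h \<bullet> b) *\<^sub>R b)" by (simp add: euclidean_representation)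
    also have "\<dots> = (\<Sum>b\<in>Basis. (h \<bullet> b) * D b)" by (simp add: sum scaleR)
    finally show ?thesis by (simp add: a_def inner_sum_right mult.commute)
  qed
  then have "D = (\<lambda>h. h \<bullet> a)" by auto
  with D have "GDERIV f x :> a" by (simp add: gderiv_def)
  with grad_eqI[OF this] show ?thesis by simp
qed

lemma GDERIV_imp_differentiable: "GDERIV f x :> D \<Longrightarrow> f differentiable (at x)"
  by (auto simp: gderiv_def differentiable_def)

lemma grad_mult:
  assumes "f differentiable (at x)" "g differentiable (at x)"
  shows "grad (\<lambda>x. f x * g x) x = f x *\<^sub>R grad g x + g x *\<^sub>R grad f x"
  by (intro grad_eqI GDERIV_mult GDERIV_grad assms)

lemma grad_cong_open:
  assumes "open S" "x \<in> S" "\<And>y. y \<in> S \<Longrightarrow> f y = g y"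
  shows "grad f x = grad g x"
proof -
  have "GDERIV f x :> D \<longleftrightarrow> GDERIV g x :> D" for D
    unfolding gderiv_def using has_derivative_transform_within_open[OF _ assms(1,2)] assms(3)
      by metis
  then have "gderiv f x = gderiv g x" by (intro ext)
  then show ?thesis by (simp add: grad_def)
qed

lemma grad_const: "grad (\<lambda>_. c) x = 0"
  by (intro grad_eqI GDERIV_const)

lemma grad_eq_0_local_min:
  assumes "open S" "x \<in> S" "\<And>y. y \<in> S \<Longrightarrow> f x \<le> f y"
  shows "grad f x = 0"
proof (cases "f differentiable (at x)")
  case True
  have "(f has_derivative (\<lambda>h. h \<bullet> grad f x)) (at x)" using GDERIV_grad[OF True]
    by (simp add: gderiv_def)
  then have "(\<lambda>h. h \<bullet> grad f x) = (\<lambda>h. 0)"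
    using differential_zero_maxmin[OF assms(2,1)] assms(3) by blast
  then have "grad f x \<bullet> grad f x = 0" by metis
  then show ?thesis by simp
qed (auto simp: grad_def dest: GDERIV_imp_differentiable)

lemma grad_eq_0_local_max:
  assumes "open S" "x \<in> S" "\<And>y. y \<in> S \<Longrightarrow> f y \<le> f x"
  shows "grad f x = 0"
proof (cases "f differentiable (at x)")
  case True
  have "(f has_derivative (\<lambda>h. h \<bullet> grad f x)) (at x)" using GDERIV_grad[OF True]
    by (simp add: gderiv_def)
  then have "(\<lambda>h. h \<bullet> grad f x) = (\<lambda>h. 0)"
    using differential_zero_maxmin[OF assms(2,1)] assms(3) by blast
  then have "grad f x \<bullet> grad f x = 0" by metis
  then show ?thesis by simp
qed (auto simp: grad_def dest: GDERIV_imp_differentiable)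

text \<open>Where f x <= P the truncation attains its minimum 0, so its gradient vanishes there, or
  is 0 by the default value in \<open>grad\<close>. This includes the points with f x = P.\<close>

lemma grad_max_0:
  assumes f: "f differentiable (at x)"
  shows "grad (\<lambda>y. max (f y - P) 0) x = (if P < f x then grad f x else 0)"
proof -
  have cont: "isCont f x" using f differentiable_imp_continuous_within by blast
  consider "P < f x" | "f x \<le> P" by linarith
  then show ?thesis
  proof cases
    case 1
    then have "eventually (\<lambda>y. P < f y) (nhds x)"
      using cont order_tendstoD(1)[of f "f x" "nhds x" P]
        by (simp add: isCont_def tendsto_at_iff_tendsto_nhds)
    then obtain S where S: "open S" "x \<in> S" "\<And>y. y \<in> S \<Longrightarrow> P < f y" by (auto simp: eventually_nhds)
    have "grad (\<lambda>y. max (f y - P) 0) x = grad (\<lambda>y. f y - P) x"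
      by (rule grad_cong_open[OF S(1,2)]) (simp add: S(3) less_imp_le)
    also have "\<dots> = grad f x" using GDERIV_diff[OF GDERIV_grad[OF f] GDERIV_const[of P x]]
      by (intro grad_eqI) simp
    finally show ?thesis using 1 by simp
  next
    case 2
    then show ?thesis by (subst grad_eq_0_local_min[of UNIV]) auto
  qed
qed

text \<open>\<open>adapted_cutoffs\<close> does not confine the functions to [0,1], whereas the
  Caccioppoli inequality wants values in this interval. Clamping does not increase the
  gradient.\<close>

lemma grad_clamp:
  fixes f :: "real ^ 'n \<Rightarrow> real"
  assumes "isCont f x"
  shows "grad (\<lambda>y. max 0 (min 1 (f y))) x = grad f x \<or> grad (\<lambda>y. max 0 (min 1 (f y))) x = 0"
proof -
  have ev: "eventually (\<lambda>y. a < f y) (nhds x)" if "a < f x" for a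
    using \<open>isCont f x\<close> order_tendstoD(1)[of f "f x" "nhds x" a] that
      by (simp add: isCont_def tendsto_at_iff_tendsto_nhds)
  have ev': "eventually (\<lambda>y. f y < a) (nhds x)" if "f x < a" for a
    using \<open>isCont f x\<close> order_tendstoD(2)[of f "f x" "nhds x" a] that
      by (simp add: isCont_def tendsto_at_iff_tendsto_nhds)
  consider "f x \<le> 0" | "f x \<ge> 1" | "0 < f x" "f x < 1" by linarith
  then show ?thesis
  proof cases
    case 1
    then show ?thesis by (intro disjI2 grad_eq_0_local_min[of UNIV]) auto
  next
    case 2
    then show ?thesis by (intro disjI2 grad_eq_0_local_max[of UNIV]) auto
  next
    case 3
    then have "eventually (\<lambda>y. 0 < f y \<and> f y < 1) (nhds x)" using ev ev'
      by (auto intro: eventually_conj)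
    then obtain S where S: "open S" "x \<in> S" "\<And>y. y \<in> S \<Longrightarrow> 0 < f y \<and> f y < 1"
      by (auto simp: eventually_nhds)
    then show ?thesis by (intro disjI1 grad_cong_open[OF S(1,2)]) (simp add: S(3) less_imp_le)
  qed
qed

lemma grad_eq_0_outside_support:
  assumes "x \<notin> closure {y. f y \<noteq> 0}"
  shows "grad f x = 0"
proof -
  have "grad f x = grad (\<lambda>_. 0) x"
    by (rule grad_cong_open[of "- closure {y. f y \<noteq> 0}"])
      (use assms closure_subset[of "{y. f y \<noteq> 0}"] in auto)
  then show ?thesis by (simp add: grad_const)
qed

text \<open>Differentiation along the gradient D itself gives D . D <= L |D|.\<close>

lemma norm_grad_le:
  assumes L: "L-lipschitz_on UNIV f"
  shows "norm (grad f x) \<le> L"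
proof (cases "f differentiable (at x)")
  case True
  define D where "D = grad f x"
  have "((\<lambda>t. f (x + t *\<^sub>R D)) has_derivative (\<lambda>t. (t *\<^sub>R D) \<bullet> D)) (at 0)"
  proof (rule has_derivative_compose[of "\<lambda>t. x + t *\<^sub>R D", where g=f])
    show "((\<lambda>t. x + t *\<^sub>R D) has_derivative (\<lambda>t. t *\<^sub>R D)) (at 0)"
      by (auto intro!: derivative_eq_intros)
    show "(f has_derivative (\<lambda>h. h \<bullet> D)) (at (x + 0 *\<^sub>R D))"
      using GDERIV_grad[OF True] by (simp add: gderiv_def D_def)
  qed
  then have "((\<lambda>t. f (x + t *\<^sub>R D)) has_real_derivative D \<bullet> D) (at 0)"
    by (simp add: has_field_derivative_def mult_commute_abs)
  then have "(\<lambda>n::nat. \<bar>(f (x + (1 / Suc n) *\<^sub>R D) - f x) * real (Suc n)\<bar>) \<longlonglongrightarrow> \<bar>D \<bullet> D\<bar>"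
    by (intro tendsto_rabs dir_deriv_tendsto)
  then have "\<bar>D \<bullet> D\<bar> \<le> L * norm D"
    by (rule LIMSEQ_le_const2) (use dir_quotient_bound[OF L] in blast)
  then have "norm D * norm D \<le> L * norm D" by (simp add: dot_square_norm power2_eq_square)
  then show ?thesis using lipschitz_on_nonneg[OF L] by (cases "D = 0") (auto simp: D_def)
next
  case False
  then have "grad f x = 0" using GDERIV_imp_differentiable by (auto simp: grad_def)
  then show ?thesis using lipschitz_on_nonneg[OF L] by simp
qed

lemma lipschitz_imp_Lip_loc: "L-lipschitz_on UNIV f \<Longrightarrow> f \<in> Lip_loc S"
  using lipschitz_on_subset[of L UNIV f] zero_less_one unfolding Lip_loc_def by blast

lemma AE_differentiable_Lip_loc:
  assumes "open S" "f \<in> Lip_loc S"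
  shows "AE x in lebesgue_on S. f differentiable (at x)"
proof -
  have "negligible {x\<in>S. \<not> f differentiable (at x)}"
    by (rule negligible_nondifferentiable_locally_lipschitz) (use assms in \<open>auto simp: Lip_loc_def\<close>)
  then have "AE x in lebesgue. x \<notin> {x\<in>S. \<not> f differentiable (at x)}"
    by (intro AE_not_in) (simp add: negligible_iff_null_sets)
  then show ?thesis using assms(1) by (subst AE_restrict_space_iff) (auto elim: eventually_mono)
qed

lemma continuous_on_Lip_loc:
  assumes S: "open S" and "f \<in> Lip_loc S"
  shows "continuous_on S f"
  unfolding continuous_on_eq_continuous_at[OF S]
proof
  fix x assume "x \<in> S"
  then obtain e L where "e > 0" "L-lipschitz_on (ball x e \<inter> S) f" using assms
    by (auto simp: Lip_loc_def)
  then have "continuous_on (ball x e \<inter> S) f" using lipschitz_on_continuous_on by blast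
  then show "isCont f x"
    using continuous_on_eq_continuous_at[OF open_Int[OF open_ball S], of x e f] \<open>x \<in> S\<close> \<open>e > 0\<close>
      by auto
qed

text \<open>The extension of \<open>f\<close> by zero is Borel, hence so are its directional
  derivatives along the basis. The vector they form agrees with the gradient almost everywhere on
  \<open>S\<close>, and Lebesgue measure is complete.\<close>

lemma borel_measurable_grad_Lip_loc:
  fixes f :: "real ^ 'n \<Rightarrow> real"
  assumes S: "open S" and f: "f \<in> Lip_loc S"
  shows "grad f \<in> borel_measurable (lebesgue_on S)"
proof -
  define g where "g = (\<lambda>x. if x \<in> S then f x else 0)"
  have [measurable]: "g \<in> borel_measurable borel"
    unfolding g_def using S continuous_on_Lip_loc[OF S f]
    by (intro borel_measurable_continuous_on_if) auto
  define h where "h = (\<lambda>x. if x \<in> S then (\<Sum>b\<in>Basis. dir_deriv g b x *\<^sub>R b) else 0)"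
  have "h \<in> borel_measurable lborel" unfolding h_def using borel_open[OF S] by measurable
  then have h: "h \<in> borel_measurable lebesgue" by (rule measurable_completion)
  have "AE x in lebesgue. x \<in> S \<longrightarrow> f differentiable (at x)"
    using AE_differentiable_Lip_loc[OF S f] S by (subst (asm) AE_restrict_space_iff) auto
  then have "AE x in lebesgue. h x = (if x \<in> S then grad f x else 0)"
  proof eventually_elim
    case (elim x)
    show ?case
    proof (cases "x \<in> S")
      case True
      have G: "GDERIV f x :> grad f x" using elim True by (intro GDERIV_grad) auto
      have Gg: "(g has_derivative (\<lambda>h. h \<bullet> grad f x)) (at x)"
        using G unfolding gderiv_def
        by (rule has_derivative_transform_within_open[OF _ S True]) (simp add: g_def)
      have "dir_deriv g b x = b \<bullet> grad f x" for b
      proof (rule dir_deriv_eqI)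
        have "((\<lambda>t. g (x + t *\<^sub>R b)) has_derivative (\<lambda>t. (t *\<^sub>R b) \<bullet> grad f x)) (at 0)"
        proof (rule has_derivative_compose[of "\<lambda>t. x + t *\<^sub>R b", where g=g])
          show "((\<lambda>t. x + t *\<^sub>R b) has_derivative (\<lambda>t. t *\<^sub>R b)) (at 0)"
            by (auto intro!: derivative_eq_intros)
          show "(g has_derivative (\<lambda>h. h \<bullet> grad f x)) (at (x + 0 *\<^sub>R b))" using Gg by simp
        qed
        then show "((\<lambda>t. g (x + t *\<^sub>R b)) has_real_derivative b \<bullet> grad f x) (at 0)"
          by (simp add: has_field_derivative_def mult_commute_abs)
      qed
      then show ?thesis using True euclidean_representation[of "grad f x"]
        by (simp add: h_def inner_commute)
    qed (simp add: h_def)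
  qed
  with h have "(\<lambda>x. if x \<in> S then grad f x else 0) \<in> borel_measurable lebesgue"
    by (rule borel_measurable_AE)
  then show ?thesis using S by (simp add: borel_measurable_if)
qed

text \<open>Indices with integrals at most 2^(-n) make the series of the functions integrable, so
  its terms tend to 0 almost everywhere. The indices tend to infinity but may repeat, which is
  harmless for limits.\<close>

lemma AE_subsequence:
  fixes g :: "nat \<Rightarrow> 'a \<Rightarrow> real"
  assumes [measurable]: "\<And>n. g n \<in> borel_measurable M" and nn: "\<And>n x. x \<in> space M \<Longrightarrow> 0 \<le> g n x"
    and lim: "(\<lambda>n. \<integral>\<^sup>+x. ennreal (g n x) \<partial>M) \<longlonglongrightarrow> 0"
  obtains r where "filterlim r at_top sequentially" "AE x in M. (\<lambda>n. g (r n) x) \<longlonglongrightarrow> 0"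
proof -
  have "\<exists>m\<ge>n. (\<integral>\<^sup>+x. ennreal (g m x) \<partial>M) \<le> ennreal ((1/2)^n)" for n
  proof -
    have "\<forall>\<^sub>F m in sequentially. (\<integral>\<^sup>+x. ennreal (g m x) \<partial>M) < ennreal ((1/2)^n)"
      using lim by (rule order_tendstoD) simp
    then obtain N where "\<forall>m\<ge>N. (\<integral>\<^sup>+x. ennreal (g m x) \<partial>M) < ennreal ((1/2)^n)"
      unfolding eventually_sequentially by blast
    then show ?thesis by (intro exI[of _ "max n N"]) (auto intro: less_imp_le)
  qed
  then obtain r where r: "\<And>n. n \<le> r n" "\<And>n. (\<integral>\<^sup>+x. ennreal (g (r n) x) \<partial>M) \<le> ennreal ((1/2)^n)"
    by metis
  have "filterlim r at_top sequentially"
    by (rule filterlim_at_top_mono[OF filterlim_ident]) (simp add: r(1))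
  moreover have "(\<integral>\<^sup>+x. (\<Sum>n. ennreal (g (r n) x)) \<partial>M) \<noteq> \<infinity>"
  proof -
    have "(\<integral>\<^sup>+x. (\<Sum>n. ennreal (g (r n) x)) \<partial>M) = (\<Sum>n. \<integral>\<^sup>+x. ennreal (g (r n) x) \<partial>M)"
      by (rule nn_integral_suminf) auto
    also have "\<dots> \<le> (\<Sum>n. ennreal ((1/2)^n))"
      using r(2) by (intro suminf_le) auto
    also have "\<dots> = ennreal (\<Sum>n. (1/2)^n)" by (intro suminf_ennreal2) auto
    finally show ?thesis by (auto simp: top_unique)
  qed
  then have "AE x in M. (\<Sum>n. ennreal (g (r n) x)) \<noteq> \<infinity>"
    by (intro nn_integral_PInf_AE) auto
  then have "AE x in M. (\<lambda>n. g (r n) x) \<longlonglongrightarrow> 0"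
  proof (rule AE_mp[OF _ AE_I2], intro impI)
    fix x assume "x \<in> space M" "(\<Sum>n. ennreal (g (r n) x)) \<noteq> \<infinity>"
    then have "summable (\<lambda>n. g (r n) x)"
      using nn by (intro summable_suminf_not_top) auto
    then show "(\<lambda>n. g (r n) x) \<longlonglongrightarrow> 0" by (rule summable_LIMSEQ_zero)
  qed
  ultimately show thesis by (rule that)
qed

section \<open>Restriction to subsets, and compactly supported Lipschitz functions\<close>

lemma nn_integral_lebesgue_on_mono_set:
  assumes "E \<subseteq> S" "E \<in> sets lebesgue" "S \<in> sets lebesgue"
  shows "(\<integral>\<^sup>+x. f x \<partial>lebesgue_on E) \<le> (\<integral>\<^sup>+x. f x \<partial>lebesgue_on S)"
  using assms
    by (subst (1 2) nn_integral_restrict_space) (auto intro!: nn_integral_mono simp: indicator_def)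

lemma AE_lebesgue_on_mono_set:
  assumes "AE x in lebesgue_on S. P x" "E \<subseteq> S" "E \<in> sets lebesgue" "S \<in> sets lebesgue"
  shows "AE x in lebesgue_on E. P x"
  using assms by (auto simp: AE_restrict_space_iff elim!: eventually_mono)

lemma borel_measurable_matrix_vector_mult:
  fixes A :: "'a \<Rightarrow> real ^ 'n ^ 'm"
  assumes "A \<in> borel_measurable M" "G \<in> borel_measurable M"
  shows "(\<lambda>x. A x *v G x) \<in> borel_measurable M"
  by (rule borel_measurable_continuous_Pair[OF assms])
     (auto simp: matrix_vector_mult_def intro!: continuous_intros)

lemma Lip_c_lipschitz:
  assumes "\<eta> \<in> Lip_c E" obtains L where "L-lipschitz_on UNIV \<eta>"
  using assms by (auto simp: Lip_c_def)

lemma Lip_c_imp_Lip_loc: "\<eta> \<in> Lip_c E \<Longrightarrow> \<eta> \<in> Lip_loc S"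
  by (auto elim!: Lip_c_lipschitz intro: lipschitz_imp_Lip_loc)

lemma Lip_c_mono: "\<eta> \<in> Lip_c E \<Longrightarrow> E \<subseteq> S \<Longrightarrow> \<eta> \<in> Lip_c S"
  by (auto simp: Lip_c_def)

lemma Lip_c_eq_0: "\<eta> \<in> Lip_c E \<Longrightarrow> x \<notin> E \<Longrightarrow> \<eta> x = 0"
  using closure_subset[of "{x. \<eta> x \<noteq> 0}"] by (auto simp: Lip_c_def)

lemma grad_Lip_c_eq_0: "\<eta> \<in> Lip_c E \<Longrightarrow> x \<notin> E \<Longrightarrow> grad \<eta> x = 0"
  by (rule grad_eq_0_outside_support) (auto simp: Lip_c_def)

lemma bounded_on_compact_continuous:
  fixes f :: "'a::metric_space \<Rightarrow> real"
  assumes "compact K" "continuous_on K f"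
  shows "\<exists>H\<ge>0. \<forall>x\<in>K. \<bar>f x\<bar> \<le> H"
proof -
  have "bounded (f ` K)" using assms by (intro compact_imp_bounded compact_continuous_image)
  then obtain H where "\<forall>x\<in>K. \<bar>f x\<bar> \<le> H" by (auto simp: bounded_iff)
  then have "\<forall>x\<in>K. \<bar>f x\<bar> \<le> max H 0" by (meson max.coboundedI1)
  then show ?thesis by (intro exI[of _ "max H 0"]) auto
qed

lemma Lip_c_bounded:
  assumes "\<eta> \<in> Lip_c E"
  shows "\<exists>H\<ge>0. \<forall>x. \<bar>\<eta> x\<bar> \<le> H"
proof -
  obtain L where L: "L-lipschitz_on UNIV \<eta>" using assms by (rule Lip_c_lipschitz)
  let ?K = "closure {x. \<eta> x \<noteq> 0}"
  have "compact ?K" using assms by (simp add: Lip_c_def)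
  moreover have "continuous_on ?K \<eta>" using lipschitz_on_continuous_on[OF L] continuous_on_subset
    by blast
  ultimately have "\<exists>H\<ge>0. \<forall>x\<in>?K. \<bar>\<eta> x\<bar> \<le> H" by (rule bounded_on_compact_continuous)
  then obtain H where H: "H \<ge> 0" "\<forall>x\<in>?K. \<bar>\<eta> x\<bar> \<le> H" by blast
  have "\<bar>\<eta> x\<bar> \<le> H" for x
  proof (cases "\<eta> x = 0")
    case False
    then show ?thesis using H(2) closure_subset[of "{x. \<eta> x \<noteq> 0}"] by blast
  qed (use H in auto)
  with H(1) show ?thesis by blast
qed

text \<open>Compactness merges the local constants into one. The singleton {0} is a dummy for the
  time parameter in \<open>local_lipschitz\<close>.\<close>

lemma Lip_loc_lipschitz_compact:
  assumes "f \<in> Lip_loc S" "compact K" "K \<subseteq> S"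
  obtains L where "L-lipschitz_on K f"
proof (rule local_lipschitz_compact_implies_lipschitz[where X=K and T="{0::real}" and f="\<lambda>_. f"])
  show "local_lipschitz {0::real} K (\<lambda>_. f)"
    unfolding local_lipschitz_def
  proof (intro ballI)
    fix x t assume "x \<in> K"
    then have "x \<in> S" using assms(3) by blast
    then obtain e L where e: "e > 0" "L-lipschitz_on (ball x e \<inter> S) f"
      using assms(1) unfolding Lip_loc_def by blast
    then have "L-lipschitz_on (cball x (e/2) \<inter> K) f"
      using assms(3) by (intro lipschitz_on_subset[OF e(2)]) auto
    then show "\<exists>u>0. \<exists>L. \<forall>t\<in>cball t u \<inter> {0::real}. L-lipschitz_on (cball x u \<inter> K) f"
      using e(1) by (intro exI[of _ "e/2"]) auto
  qed
  show "\<And>L. (\<And>t. t \<in> {0::real} \<Longrightarrow> L-lipschitz_on K f) \<Longrightarrow> thesis" using that by blast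
qed (use assms in auto)

lemma Lip_c_mult:
  assumes \<eta>: "\<eta> \<in> Lip_c E" and f: "f \<in> Lip_loc S" and "open S" "E \<subseteq> S"
  shows "(\<lambda>x. \<eta> x * f x) \<in> Lip_c E"
proof -
  let ?K = "closure {x. \<eta> x \<noteq> 0}"
  have K: "compact ?K" "?K \<subseteq> S" "?K \<subseteq> E" using \<eta> \<open>E \<subseteq> S\<close> by (auto simp: Lip_c_def)
  have out: "\<eta> x = 0" if "x \<notin> ?K" for x using that closure_subset[of "{x. \<eta> x \<noteq> 0}"] by auto
  obtain L where L: "L-lipschitz_on UNIV \<eta>" using \<eta> by (rule Lip_c_lipschitz)
  obtain M where M: "M-lipschitz_on ?K f" using Lip_loc_lipschitz_compact[OF f K(1,2)] .
  obtain H where H: "H \<ge> 0" "\<And>x. \<bar>\<eta> x\<bar> \<le> H" using Lip_c_bounded[OF \<eta>] by blast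
  obtain F where F: "F \<ge> 0" "\<And>x. x \<in> ?K \<Longrightarrow> \<bar>f x\<bar> \<le> F"
    using bounded_on_compact_continuous[OF K(1) lipschitz_on_continuous_on[OF M]] by blast
  have L0: "L \<ge> 0" "M \<ge> 0" using lipschitz_on_nonneg L M by blast+
  \<comment> \<open>The product rule is arranged so that \<open>f\<close> is bounded at
    \<open>x\<close>, a point of the support. If \<open>y\<close> lies outside the support, \<eta> y
    = 0 removes the difference f x - f y, over which there is no control.\<close>
  have one: "\<bar>\<eta> x * f x - \<eta> y * f y\<bar> \<le> (L * F + H * M) * dist x y" if x: "x \<in> ?K" for x y
  proof -
    have 1: "\<bar>\<eta> x - \<eta> y\<bar> * \<bar>f x\<bar> \<le> (L * dist x y) * F"
      using lipschitz_onD[OF L, of x y] F(2)[OF x] L0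
        by (intro mult_mono) (auto simp: dist_real_def)
    have 2: "\<bar>\<eta> y\<bar> * \<bar>f x - f y\<bar> \<le> H * (M * dist x y)"
    proof (cases "y \<in> ?K")
      case True
      then show ?thesis using lipschitz_onD[OF M x True] H(2)[of y] L0 H(1)
        by (intro mult_mono) (auto simp: dist_real_def)
    next
      case False
      then show ?thesis using out[OF False] H(1) L0 by simp
    qed
    have "\<eta> x * f x - \<eta> y * f y = (\<eta> x - \<eta> y) * f x + \<eta> y * (f x - f y)"
      by (simp add: algebra_simps)
    also have "\<bar>\<dots>\<bar> \<le> \<bar>\<eta> x - \<eta> y\<bar> * \<bar>f x\<bar> + \<bar>\<eta> y\<bar> * \<bar>f x - f y\<bar>"
      using abs_triangle_ineq[of "(\<eta> x - \<eta> y) * f x" "\<eta> y * (f x - f y)"] by (simp add: abs_mult)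
    also have "\<dots> \<le> (L * dist x y) * F + H * (M * dist x y)" using 1 2 by (rule add_mono)
    finally show ?thesis by (simp add: algebra_simps)
  qed
  have "(L * F + H * M)-lipschitz_on UNIV (\<lambda>x. \<eta> x * f x)"
  proof (rule lipschitz_onI)
    show "0 \<le> L * F + H * M" using L0 F H by simp
    fix x y
    consider "x \<in> ?K" | "y \<in> ?K" | "x \<notin> ?K" "y \<notin> ?K" by blast
    then show "dist (\<eta> x * f x) (\<eta> y * f y) \<le> (L * F + H * M) * dist x y"
    proof cases
      case 1 then show ?thesis using one[of x y] by (simp add: dist_real_def)
    next
      case 2 then show ?thesis using one[of y x]
        by (simp add: dist_real_def dist_commute abs_minus_commute)
    next
      case 3 show ?thesis using out[OF 3(1)] out[OF 3(2)] \<open>0 \<le> L * F + H * M\<close> by simp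
    qed
  qed
  moreover have sub: "closure {x. \<eta> x * f x \<noteq> 0} \<subseteq> ?K" by (intro closure_mono) auto
  moreover have "compact (closure {x. \<eta> x * f x \<noteq> 0})"
    using compact_Int_closed[OF K(1) closed_closure, of "{x. \<eta> x * f x \<noteq> 0}"] sub
      by (simp add: Int_absorb1)
  ultimately show ?thesis using K(3) by (auto simp: Lip_c_def)
qed

lemma abs_max_diff_le: "\<bar>max (a - P) 0 - max (b - P) 0\<bar> \<le> \<bar>a - b\<bar>" for a b P :: real
  by (auto simp: max_def)

lemma Lip_loc_max_0:
  assumes "f \<in> Lip_loc S"
  shows "(\<lambda>x. max (f x - P) 0) \<in> Lip_loc S"
proof -
  have "L-lipschitz_on X (\<lambda>x. max (f x - P) 0)" if "L-lipschitz_on X f" for L X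
  proof (rule lipschitz_onI)
    show "0 \<le> L" using that lipschitz_on_nonneg by blast
    fix x y assume "x \<in> X" "y \<in> X"
    then have "dist (f x) (f y) \<le> L * dist x y" using that lipschitz_onD by blast
    then show "dist (max (f x - P) 0) (max (f y - P) 0) \<le> L * dist x y"
      using abs_max_diff_le[of "f x" P "f y"] by (simp add: dist_real_def)
  qed
  then show ?thesis using assms unfolding Lip_loc_def by blast
qed

lemma Lip_c_square: "\<eta> \<in> Lip_c E \<Longrightarrow> (\<lambda>x. (\<eta> x)\<^sup>2) \<in> Lip_c E"
  using Lip_c_mult[of \<eta> E \<eta> UNIV] Lip_c_imp_Lip_loc[of \<eta> E UNIV] by (simp add: power2_eq_square)

section \<open>Truncations in the degenerate Sobolev space\<close>

text \<open>The constants hidden by existential quantifiers in \<open>degenerate_setting\<close>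
  become parameters, so that the later constants are explicit. \<open>A_bound\<close> is the
  boundedness of the entries of \<open>A\<close>, restated for the quadratic form.\<close>

locale degenerate =
  fixes \<Omega> :: "(real ^ 'n) set" and w :: "real ^ 'n \<Rightarrow> real" and A \<B> :: "real ^ 'n \<Rightarrow> real ^ 'n ^ 'n"
    and Q\<^sub>A c\<^sub>A C\<^sub>A L\<^sub>B :: real
  assumes open_\<Omega>: "open \<Omega>" and bounded_\<Omega>: "bounded \<Omega>"
    and w_meas: "w \<in> borel_measurable (lebesgue_on \<Omega>)"
    and w_loc: "\<And>K. compact K \<Longrightarrow> K \<subseteq> \<Omega> \<Longrightarrow> integrable (lebesgue_on K) w"
    and w_pos: "AE x in lebesgue_on \<Omega>. 0 < w x"
    and A_meas: "A \<in> borel_measurable (lebesgue_on \<Omega>)"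
    and A_psd: "\<And>x \<xi>. x \<in> \<Omega> \<Longrightarrow> 0 \<le> \<xi> \<bullet> (A x *v \<xi>)"
    and A_sym: "\<And>x. x \<in> \<Omega> \<Longrightarrow> transpose (A x) = A x"
    and A_bound: "\<And>x \<xi>. x \<in> \<Omega> \<Longrightarrow> \<xi> \<bullet> (A x *v \<xi>) \<le> Q\<^sub>A * (norm \<xi>)\<^sup>2"
    and Q\<^sub>A: "0 \<le> Q\<^sub>A"
    and \<B>_lipschitz: "L\<^sub>B-lipschitz_on \<Omega> \<B>"
    and c\<^sub>A: "0 < c\<^sub>A" and C\<^sub>A: "0 < C\<^sub>A"
    and lower: "\<And>x \<xi>. x \<in> \<Omega> \<Longrightarrow> c\<^sub>A * (\<xi> \<bullet> (A x *v \<xi>)) \<le> (norm (\<B> x *v \<xi>))\<^sup>2"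
    and upper: "\<And>x \<xi>. x \<in> \<Omega> \<Longrightarrow> (norm (\<B> x *v \<xi>))\<^sup>2 \<le> C\<^sub>A * (\<xi> \<bullet> (A x *v \<xi>))"

lemma degenerate_setting_imp_degenerate:
  assumes "degenerate_setting \<Omega> w A \<B>"
  obtains Q c C L where "degenerate \<Omega> w A \<B> Q c C L"
proof -
  obtain M where M: "\<forall>x\<in>\<Omega>. \<forall>i j. \<bar>A x $ i $ j\<bar> \<le> M" using assms
    by (auto simp: degenerate_setting_def)
  obtain L where L: "L-lipschitz_on \<Omega> \<B>" using assms by (auto simp: degenerate_setting_def)
  obtain c C where cC: "c > 0" "C > 0" "\<forall>x\<in>\<Omega>. \<forall>\<xi>.
        c * (\<xi> \<bullet> (A x *v \<xi>)) \<le> (norm (\<B> x *v \<xi>))\<^sup>2 \<and>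
        (norm (\<B> x *v \<xi>))\<^sup>2 \<le> C * (\<xi> \<bullet> (A x *v \<xi>))"
    using assms unfolding degenerate_setting_def by blast
  define Q where "Q = \<bar>real CARD('a) * real CARD('a) * M\<bar>"
  have Q: "\<xi> \<bullet> (A x *v \<xi>) \<le> Q * (norm \<xi>)\<^sup>2" if "x \<in> \<Omega>" for x \<xi>
  proof -
    have "onorm ((*v) (A x)) \<le> real CARD('a) * real CARD('a) * M"
      using M that by (intro onorm_le_matrix_component) auto
    then have "onorm ((*v) (A x)) \<le> Q" by (simp add: Q_def)
    then have "onorm ((*v) (A x)) * norm \<xi> \<le> Q * norm \<xi>" by (intro mult_right_mono) auto
    moreover have "norm (A x *v \<xi>) \<le> onorm ((*v) (A x)) * norm \<xi>"
      by (rule onorm) (rule matrix_vector_mul_bounded_linear)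
    ultimately have "norm (A x *v \<xi>) \<le> Q * norm \<xi>" by linarith
    then have "norm \<xi> * norm (A x *v \<xi>) \<le> norm \<xi> * (Q * norm \<xi>)" by (intro mult_left_mono) auto
    moreover have "\<xi> \<bullet> (A x *v \<xi>) \<le> norm \<xi> * norm (A x *v \<xi>)" by (rule norm_cauchy_schwarz)
    ultimately show ?thesis by (simp add: power2_eq_square mult.left_commute)
  qed
  have "degenerate \<Omega> w A \<B> Q c C L"
    using assms cC L Q unfolding degenerate_setting_def weight_on_def degenerate_def
      by (simp add: Q_def)
  then show thesis by (rule that)
qed

lemma matrix_form_parallelogram:
  fixes M :: "real ^ 'n ^ 'n"
  shows "(a + b) \<bullet> (M *v (a + b)) + (a - b) \<bullet> (M *v (a - b)) = 2 * (a \<bullet> (M *v a)) + 2 *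
    (b \<bullet> (M *v b))"
  by (simp add: matrix_vector_right_distrib matrix_vector_mult_diff_distrib inner_add_left
    inner_add_right
      inner_diff_left inner_diff_right)

lemma matrix_form_scaleR:
  fixes M :: "real ^ 'n ^ 'n"
  shows "(c *\<^sub>R a) \<bullet> (M *v (c *\<^sub>R a)) = c\<^sup>2 * (a \<bullet> (M *v a))"
  by (simp add: matrix_vector_mult_scaleR power2_eq_square)

lemma tendsto_of_square_sum:
  fixes V q :: "nat \<Rightarrow> real"
  assumes "(\<lambda>n. (u - V n)\<^sup>2 + q n) \<longlonglongrightarrow> 0" "\<And>n. 0 \<le> q n"
  shows "V \<longlonglongrightarrow> u"
proof -
  have "(\<lambda>n. (u - V n)\<^sup>2) \<longlonglongrightarrow> 0"
    by (rule tendsto_sandwich[OF _ _ tendsto_const assms(1)]) (auto simp: assms(2))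
  then have "(\<lambda>n. sqrt ((u - V n)\<^sup>2)) \<longlonglongrightarrow> sqrt 0" by (rule tendsto_real_sqrt)
  then have "(\<lambda>n. u - V n) \<longlonglongrightarrow> 0" by (simp add: tendsto_rabs_zero_iff)
  then have "(\<lambda>n. u - (u - V n)) \<longlonglongrightarrow> u - 0" by (intro tendsto_intros)
  then show ?thesis by simp
qed

lemma norm_diff_square_le: "(norm (a - b))\<^sup>2 \<le> 2 * (norm a)\<^sup>2 + 2 * (norm b)\<^sup>2"
  for a b :: "'a::real_inner"
proof -
  have "(norm (a - b))\<^sup>2 + (norm (a + b))\<^sup>2 = 2 * (norm a)\<^sup>2 + 2 * (norm b)\<^sup>2"
    by (simp add: power2_norm_eq_inner inner_diff_left inner_diff_right inner_add_left
      inner_add_right)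
  then show ?thesis using zero_le_power2[of "norm (a + b)"] by linarith
qed

context degenerate
begin

lemma \<Omega>_lebesgue[measurable]: "\<Omega> \<in> sets lebesgue"
  using open_\<Omega> by auto

text \<open>The parallelogram identity, in which the form at a - b is nonnegative and may be
  dropped.\<close>

lemma form_add_le:
  assumes "x \<in> \<Omega>"
  shows "(a + b) \<bullet> (A x *v (a + b)) \<le> 2 * (a \<bullet> (A x *v a)) + 2 * (b \<bullet> (A x *v b))"
  using matrix_form_parallelogram[of a b "A x"] A_psd[OF assms, of "a - b"] by linarith

lemma form_add3_le:
  assumes x: "x \<in> \<Omega>"
  shows "(a + (b + c)) \<bullet> (A x *v (a + (b + c))) \<le> 2 * (a \<bullet> (A x *v a)) + 4 * (b \<bullet> (A x *v b)) + 4 *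
    (c \<bullet> (A x *v c))"
  using form_add_le[OF x, of a "b + c"] form_add_le[OF x, of b c] by linarith

lemma measurable_form:
  assumes "G \<in> borel_measurable (lebesgue_on E)" "E \<subseteq> \<Omega>"
  shows "(\<lambda>x. G x \<bullet> (A x *v G x)) \<in> borel_measurable (lebesgue_on E)"
proof -
  have "A \<in> borel_measurable (lebesgue_on E)" using A_meas assms(2)
    by (rule measurable_restrict_mono)
  then have [measurable]: "(\<lambda>x. A x *v G x) \<in> borel_measurable (lebesgue_on E)"
    using assms(1) by (rule borel_measurable_matrix_vector_mult)
  show ?thesis using assms(1) by measurable
qed

lemma emeasure_\<Omega>_finite: "emeasure lebesgue \<Omega> < top"
  using bounded_set_imp_lmeasurable[OF bounded_\<Omega> \<Omega>_lebesgue] by (auto simp: fmeasurable_def)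

end

lemma measurable_lipschitz_lebesgue:
  assumes "L-lipschitz_on UNIV f"
  shows "f \<in> borel_measurable (lebesgue_on E)"
proof -
  have "f \<in> borel_measurable lborel"
    using borel_measurable_continuous_onI[OF lipschitz_on_continuous_on[OF assms]] by simp
  then have "f \<in> borel_measurable lebesgue" by (rule measurable_completion)
  then show ?thesis by (rule measurable_restrict_space1)
qed

text \<open>The level \<open>P\<close> is chosen with \<open>{u = P}\<close> null. This makes the indicators of \<open>{V\<^sub>m > P}\<close> converge
  almost everywhere along \<open>V\<^sub>m \<rightarrow> u\<close>, so that one need not know that \<open>A G\<close> vanishes on \<open>{u = P}\<close>.\<close>

lemma (in degenerate) W12A0_cutoff_truncation:
  assumes u: "W12A A \<Omega> u G" and E: "open E" "E \<subseteq> \<Omega>" and \<eta>: "\<eta> \<in> Lip_c E"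
    and P: "AE x in lebesgue_on \<Omega>. u x \<noteq> P"
  shows "W12A0 A E (\<lambda>x. \<eta> x * max (u x - P) 0)
           (\<lambda>x. max (u x - P) 0 *\<^sub>R grad \<eta> x + (if P < u x then \<eta> x else 0) *\<^sub>R G x)"
proof -
  have E_leb[measurable]: "E \<in> sets lebesgue" using E(1) by auto
  have [measurable]: "u \<in> borel_measurable (lebesgue_on \<Omega>)" "G \<in> borel_measurable (lebesgue_on \<Omega>)"
    and fin: "energy A \<Omega> u G < top"
    using u by (auto simp: W12A_def sobolev_closure_def)
  obtain V where V: "\<And>m::nat. V m \<in> Lip_loc \<Omega>"
    and lim: "(\<lambda>m. energy A \<Omega> (\<lambda>x. u x - V m x) (\<lambda>x. G x - grad (V m) x)) \<longlonglongrightarrow> 0"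
    using u by (auto simp: W12A_def sobolev_closure_def)
  have V_meas[measurable]: "V m \<in> borel_measurable (lebesgue_on \<Omega>)" for m
    using continuous_on_Lip_loc[OF open_\<Omega> V] \<Omega>_lebesgue
      by (rule continuous_imp_measurable_on_sets_lebesgue)
  have gV_meas[measurable]: "grad (V m) \<in> borel_measurable (lebesgue_on \<Omega>)" for m
    by (rule borel_measurable_grad_Lip_loc[OF open_\<Omega> V])
  have [measurable]: "(\<lambda>x. G x \<bullet> (A x *v G x)) \<in> borel_measurable (lebesgue_on \<Omega>)"
    "\<And>m. (\<lambda>x. (G x - grad (V m) x) \<bullet> (A x *v (G x - grad (V m) x))) \<in> borel_measurable
      (lebesgue_on \<Omega>)"
    by (rule measurable_form; measurable)+
  obtain L where L: "L-lipschitz_on UNIV \<eta>" using \<eta> by (rule Lip_c_lipschitz)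
  have [measurable]: "\<eta> \<in> borel_measurable (lebesgue_on \<Omega>)"
    by (rule measurable_lipschitz_lebesgue[OF L])
  have [measurable]: "grad \<eta> \<in> borel_measurable (lebesgue_on \<Omega>)"
    by (rule borel_measurable_grad_Lip_loc[OF open_\<Omega> lipschitz_imp_Lip_loc[OF L]])
  obtain H where H: "H \<ge> 0" "\<And>x. \<bar>\<eta> x\<bar> \<le> H" using Lip_c_bounded[OF \<eta>] by blast
  have H2: "(\<eta> x)\<^sup>2 \<le> H\<^sup>2" for x using H(2)[of x] H(1) by (simp add: abs_le_square_iff[symmetric])
  define q where "q = (\<lambda>x \<xi>. \<xi> \<bullet> (A x *v \<xi>))"
  have q_nn: "x \<in> \<Omega> \<Longrightarrow> 0 \<le> q x \<xi>" for x \<xi> using A_psd by (simp add: q_def)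
  have q_grad: "q x (grad \<eta> x) \<le> Q\<^sub>A * L\<^sup>2" if "x \<in> \<Omega>" for x
  proof -
    have "Q\<^sub>A * (norm (grad \<eta> x))\<^sup>2 \<le> Q\<^sub>A * L\<^sup>2"
      using norm_grad_le[OF L, of x] Q\<^sub>A by (intro mult_left_mono power_mono) auto
    then show ?thesis using A_bound[OF that, of "grad \<eta> x"] by (simp add: q_def)
  qed
  define v where "v = (\<lambda>x. \<eta> x * max (u x - P) 0)"
  define F where "F = (\<lambda>x. max (u x - P) 0 *\<^sub>R grad \<eta> x + (if P < u x then \<eta> x else 0) *\<^sub>R G x)"
  have [measurable]: "v \<in> borel_measurable (lebesgue_on \<Omega>)" "F \<in> borel_measurable (lebesgue_on \<Omega>)"
    unfolding v_def F_def by measurable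
  have vF_meas: "v \<in> borel_measurable (lebesgue_on E)" "F \<in> borel_measurable (lebesgue_on E)"
    by (rule measurable_restrict_mono[OF _ E(2)], measurable)+
  have Gfin: "(\<integral>\<^sup>+x. ennreal (q x (G x)) \<partial>lebesgue_on \<Omega>) < top"
  proof -
    have "(\<integral>\<^sup>+x. ennreal (q x (G x)) \<partial>lebesgue_on \<Omega>) \<le> energy A \<Omega> u G"
      unfolding energy_def q_def by (intro nn_integral_mono ennreal_leI) auto
    then show ?thesis using fin by (rule le_less_trans)
  qed
  have vF_fin: "energy A E v F < top"
  proof -
    have "energy A E v F \<le> (\<integral>\<^sup>+x. ennreal ((v x)\<^sup>2 + q x (F x)) \<partial>lebesgue_on \<Omega>)"
      unfolding energy_def q_def by (rule nn_integral_lebesgue_on_mono_set[OF E(2)]) auto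
    \<comment> \<open>The truncation is bounded by |u| and |P|. The constant part contributes a
      multiple of the measure of \<Omega>, which is finite because \<Omega> is bounded.\<close>
    also have "\<dots> \<le>
      (\<integral>\<^sup>+x. ennreal (2 * (H\<^sup>2 + 2 * (Q\<^sub>A * L\<^sup>2)) + 2 * H\<^sup>2) * ennreal ((u x)\<^sup>2 + q x (G x)) +
      ennreal (2 * (H\<^sup>2 + 2 * (Q\<^sub>A * L\<^sup>2)) * P\<^sup>2) \<partial>lebesgue_on \<Omega>)"
    proof (rule nn_integral_mono)
      fix x assume "x \<in> space (lebesgue_on \<Omega>)"
      then have x: "x \<in> \<Omega>" by simp
      have m: "(max (u x - P) 0)\<^sup>2 \<le> 2 * (u x)\<^sup>2 + 2 * P\<^sup>2"
      proof -
        have "(max (u x - P) 0)\<^sup>2 \<le> (u x - P)\<^sup>2" by (auto simp: max_def)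
        moreover have "0 \<le> (u x + P)\<^sup>2" by simp
        ultimately show ?thesis by (simp add: power2_eq_square algebra_simps)
      qed
      have 1: "(v x)\<^sup>2 \<le> H\<^sup>2 * (max (u x - P) 0)\<^sup>2"
        unfolding v_def power_mult_distrib by (intro mult_right_mono H2) auto
      have 2: "q x (F x) \<le> 2 * ((max (u x - P) 0)\<^sup>2 * q x (grad \<eta> x)) + 2 *
        ((if P < u x then \<eta> x else 0)\<^sup>2 * q x (G x))"
        unfolding F_def q_def
          using form_add_le[OF x, of "max (u x - P) 0 *\<^sub>R grad \<eta> x"
          "(if P < u x then \<eta> x else 0) *\<^sub>R G x"]
        unfolding matrix_form_scaleR .
      have 3: "(max (u x - P) 0)\<^sup>2 * q x (grad \<eta> x) \<le> (max (u x - P) 0)\<^sup>2 * (Q\<^sub>A * L\<^sup>2)"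
        by (intro mult_left_mono q_grad x) auto
      have 4: "(if P < u x then \<eta> x else 0)\<^sup>2 * q x (G x) \<le> H\<^sup>2 * q x (G x)"
        using H2[of x] by (intro mult_right_mono q_nn x) auto
      have "(v x)\<^sup>2 + q x (F x) \<le> (H\<^sup>2 + 2 * (Q\<^sub>A * L\<^sup>2)) * (max (u x - P) 0)\<^sup>2 + 2 * H\<^sup>2 *
        q x (G x)"
        using 1 2 3 4 by (simp add: algebra_simps)
      also have "\<dots> \<le> (H\<^sup>2 + 2 * (Q\<^sub>A * L\<^sup>2)) * (2 * (u x)\<^sup>2 + 2 * P\<^sup>2) + 2 * H\<^sup>2 * q x (G x)"
        using Q\<^sub>A by (intro add_right_mono mult_left_mono m) auto
      also have "\<dots> \<le> (2 * (H\<^sup>2 + 2 * (Q\<^sub>A * L\<^sup>2)) + 2 * H\<^sup>2) * ((u x)\<^sup>2 + q x (G x)) + 2 *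
        (H\<^sup>2 + 2 * (Q\<^sub>A * L\<^sup>2)) * P\<^sup>2"
        using Q\<^sub>A q_nn[OF x, of "G x"] by (simp add: algebra_simps)
      finally show
        "ennreal ((v x)\<^sup>2 + q x (F x)) \<le> ennreal (2 * (H\<^sup>2 + 2 * (Q\<^sub>A * L\<^sup>2)) + 2 * H\<^sup>2) *
        ennreal ((u x)\<^sup>2 + q x (G x)) + ennreal (2 * (H\<^sup>2 + 2 * (Q\<^sub>A * L\<^sup>2)) * P\<^sup>2)"
        using Q\<^sub>A q_nn[OF x, of "G x"] by (simp flip: ennreal_mult ennreal_plus add: ennreal_leI)
    qed
    also have "\<dots> = ennreal (2 * (H\<^sup>2 + 2 * (Q\<^sub>A * L\<^sup>2)) + 2 * H\<^sup>2) * energy A \<Omega> u G +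
      ennreal (2 * (H\<^sup>2 + 2 * (Q\<^sub>A * L\<^sup>2)) * P\<^sup>2) * emeasure (lebesgue_on \<Omega>) \<Omega>"
      unfolding energy_def q_def by (subst nn_integral_add) (auto simp: nn_integral_cmult)
    also have "\<dots> < top"
      using fin emeasure_\<Omega>_finite by (auto simp: ennreal_mult_less_top emeasure_restrict_space)
    finally show ?thesis .
  qed
  obtain r where r: "filterlim r at_top sequentially"
    "AE x in lebesgue_on \<Omega>. (\<lambda>n. (u x - V (r n) x)\<^sup>2 + q x (G x - grad (V (r n)) x)) \<longlonglongrightarrow> 0"
  proof (rule
    AE_subsequence[where M="lebesgue_on \<Omega>" and
    g="\<lambda>n x. (u x - V n x)\<^sup>2 + q x (G x - grad (V n) x)"])
    show "(\<lambda>n. \<integral>\<^sup>+x. ennreal ((u x - V n x)\<^sup>2 + q x (G x - grad (V n) x)) \<partial>lebesgue_on \<Omega>) \<longlonglongrightarrow> 0"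
      using lim by (simp add: energy_def q_def)
    show "(\<lambda>x. (u x - V n x)\<^sup>2 + q x (G x - grad (V n) x)) \<in> borel_measurable (lebesgue_on \<Omega>)" for n
      unfolding q_def by measurable
  qed (auto intro: add_nonneg_nonneg q_nn)
  define W where "W = (\<lambda>n x. \<eta> x * max (V (r n) x - P) 0)"
  \<comment> \<open>The indicator of the set where u and its approximant lie on different sides of
    the level \<open>P\<close>.\<close>
  define \<delta> where "\<delta> = (\<lambda>n x. if (P < u x) = (P < V (r n) x) then 0 else 1 :: real)"
  have [measurable]: "\<delta> n \<in> borel_measurable (lebesgue_on \<Omega>)" for n
    unfolding \<delta>_def by measurable
  define K where "K = H\<^sup>2 + 2 * (Q\<^sub>A * L\<^sup>2) + 4 * H\<^sup>2"
  have K0: "K \<ge> 0" using Q\<^sub>A by (simp add: K_def)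
  have bound: "energy A E (\<lambda>x. v x - W n x) (\<lambda>x. F x - grad (W n) x) \<le>
     ennreal K * energy A \<Omega> (\<lambda>x. u x - V (r n) x) (\<lambda>x. G x - grad (V (r n)) x) +
     ennreal K * (\<integral>\<^sup>+x. ennreal (\<delta> n x * q x (G x)) \<partial>lebesgue_on \<Omega>)" for n
  proof -
    have ae: "AE x in lebesgue_on \<Omega>. V (r n) differentiable (at x)"
      "AE x in lebesgue_on \<Omega>. \<eta> differentiable (at x)"
      "AE x in lebesgue_on \<Omega>. (\<lambda>y. max (V (r n) y - P) 0) differentiable (at x)"
      by (intro AE_differentiable_Lip_loc[OF open_\<Omega>] V Lip_loc_max_0 lipschitz_imp_Lip_loc[OF L])+
    have "energy A E (\<lambda>x. v x - W n x) (\<lambda>x. F x - grad (W n) x) \<le>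
      (\<integral>\<^sup>+x. ennreal ((v x - W n x)\<^sup>2 + q x (F x - grad (W n) x)) \<partial>lebesgue_on \<Omega>)"
      unfolding energy_def q_def by (rule nn_integral_lebesgue_on_mono_set[OF E(2)]) auto
    also have "\<dots> \<le>
      (\<integral>\<^sup>+x. ennreal K * ennreal ((u x - V (r n) x)\<^sup>2 + q x (G x - grad (V (r n)) x)) + ennreal K *
      ennreal (\<delta> n x * q x (G x)) \<partial>lebesgue_on \<Omega>)"
    proof (rule nn_integral_mono_AE)
      have "AE x in lebesgue_on \<Omega>. x \<in> \<Omega>" using AE_space[of "lebesgue_on \<Omega>"] by simp
      then show "AE x in lebesgue_on \<Omega>. ennreal ((v x - W n x)\<^sup>2 + q x (F x - grad (W n) x)) \<le>
         ennreal K * ennreal ((u x - V (r n) x)\<^sup>2 + q x (G x - grad (V (r n)) x)) + ennreal K *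
           ennreal (\<delta> n x * q x (G x))"
        using ae
      proof eventually_elim
        case (elim x)
        note x = elim(1)
        let ?tu = "max (u x - P) 0" and ?tV = "max (V (r n) x - P) 0"
        let ?iu = "if P < u x then \<eta> x else 0" and ?iV = "if P < V (r n) x then \<eta> x else 0"
        have gW: "grad (W n) x = ?tV *\<^sub>R grad \<eta> x + ?iV *\<^sub>R grad (V (r n)) x"
          unfolding W_def using grad_mult[OF elim(3,4)] grad_max_0[OF elim(2), of P] by simp
        \<comment> \<open>Three sources of error: the truncated values, the gradients of the
          approximants, and the mismatch of the two indicators. The first two are controlled by the
          energy of the difference; the third multiplies the fixed field \<open>G\<close> and needs
          dominated convergence.\<close>
        have dF: "F x - grad (W n) x = (?tu - ?tV) *\<^sub>R grad \<eta> x +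
          (?iV *\<^sub>R (G x - grad (V (r n)) x) + (?iu - ?iV) *\<^sub>R G x)"
          unfolding gW F_def by (simp add: algebra_simps)
        have 2: "q x (F x - grad (W n) x) \<le> 2 * ((?tu - ?tV)\<^sup>2 * q x (grad \<eta> x)) +
            4 * (?iV\<^sup>2 * q x (G x - grad (V (r n)) x)) + 4 * ((?iu - ?iV)\<^sup>2 * q x (G x))"
          unfolding dF q_def
            using form_add3_le[OF x, of "(?tu - ?tV) *\<^sub>R grad \<eta> x"
            "?iV *\<^sub>R (G x - grad (V (r n)) x)" "(?iu - ?iV) *\<^sub>R G x"]
          unfolding matrix_form_scaleR .
        have t: "(?tu - ?tV)\<^sup>2 \<le> (u x - V (r n) x)\<^sup>2"
          using abs_max_diff_le[of "u x" P "V (r n) x"] by (simp add: abs_le_square_iff)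
        have 1: "(v x - W n x)\<^sup>2 \<le> H\<^sup>2 * (u x - V (r n) x)\<^sup>2"
        proof -
          have "v x - W n x = \<eta> x * (?tu - ?tV)" by (simp add: v_def W_def algebra_simps)
          then show ?thesis using H2[of x] t by (simp add: power_mult_distrib mult_mono)
        qed
        have 3: "(?tu - ?tV)\<^sup>2 * q x (grad \<eta> x) \<le> (u x - V (r n) x)\<^sup>2 * (Q\<^sub>A * L\<^sup>2)"
          by (intro mult_mono t q_grad q_nn x) auto
        have 4: "?iV\<^sup>2 * q x (G x - grad (V (r n)) x) \<le> H\<^sup>2 * q x (G x - grad (V (r n)) x)"
          using H2[of x] by (intro mult_right_mono q_nn x) auto
        have 5: "(?iu - ?iV)\<^sup>2 * q x (G x) \<le> H\<^sup>2 * (\<delta> n x * q x (G x))"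
        proof -
          have "(?iu - ?iV)\<^sup>2 \<le> H\<^sup>2 * \<delta> n x" using H2[of x] by (auto simp: \<delta>_def)
          then have "(?iu - ?iV)\<^sup>2 * q x (G x) \<le> (H\<^sup>2 * \<delta> n x) * q x (G x)"
            by (intro mult_right_mono q_nn x)
          then show ?thesis by (simp add: mult.assoc)
        qed
        let ?X = "(u x - V (r n) x)\<^sup>2" and ?Y = "q x (G x - grad (V (r n)) x)"
          and ?Z = "\<delta> n x * q x (G x)"
        have nn: "0 \<le> ?X" "0 \<le> ?Y" "0 \<le> ?Z" using q_nn[OF x] by (auto simp: \<delta>_def)
        have "(v x - W n x)\<^sup>2 + q x (F x - grad (W n) x) \<le> H\<^sup>2 * ?X + 2 * (Q\<^sub>A * L\<^sup>2) * ?X + 4 *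
          H\<^sup>2 * ?Y + 4 * H\<^sup>2 * ?Z"
          using 1 2 3 4 5 by (simp add: algebra_simps)
        also have "\<dots> \<le> K * ?X + K * ?Y + K * ?Z"
        proof -
          have "4 * H\<^sup>2 * ?Y \<le> K * ?Y" "4 * H\<^sup>2 * ?Z \<le> K * ?Z"
            using nn Q\<^sub>A by (auto intro!: mult_right_mono simp: K_def)
          moreover have "H\<^sup>2 * ?X + 2 * (Q\<^sub>A * L\<^sup>2) * ?X = (H\<^sup>2 + 2 * (Q\<^sub>A * L\<^sup>2)) * ?X"
            by (simp add: algebra_simps)
          moreover have "(H\<^sup>2 + 2 * (Q\<^sub>A * L\<^sup>2)) * ?X \<le> K * ?X"
            using nn by (intro mult_right_mono) (auto simp: K_def)
          ultimately show ?thesis by linarith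
        qed
        finally have "(v x - W n x)\<^sup>2 + q x (F x - grad (W n) x) \<le> K * (?X + ?Y) + K * ?Z"
          by (simp add: distrib_left)
        then show ?case
          using K0 nn by (simp flip: ennreal_mult ennreal_plus add: ennreal_leI)
      qed
    qed
    also have "\<dots> = ennreal K * energy A \<Omega> (\<lambda>x. u x - V (r n) x) (\<lambda>x. G x - grad (V (r n)) x) +
     ennreal K * (\<integral>\<^sup>+x. ennreal (\<delta> n x * q x (G x)) \<partial>lebesgue_on \<Omega>)"
      unfolding energy_def q_def by (subst nn_integral_add) (auto simp: nn_integral_cmult)
    finally show ?thesis .
  qed
  \<comment> \<open>Since |{u = P}| = 0, almost every point has u strictly above or below
    \<open>P\<close>, and the approximants eventually fall on the same side. The form of
    \<open>G\<close> is an integrable majorant.\<close>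
  have lim2: "(\<lambda>n. \<integral>\<^sup>+x. ennreal (\<delta> n x * q x (G x)) \<partial>lebesgue_on \<Omega>) \<longlonglongrightarrow> (\<integral>\<^sup>+x. 0 \<partial>lebesgue_on \<Omega>)"
  proof (rule nn_integral_dominated_convergence[where w="\<lambda>x. ennreal (q x (G x))"])
    show "AE x in lebesgue_on \<Omega>. ennreal (\<delta> n x * q x (G x)) \<le> ennreal (q x (G x))" for n
      by (intro AE_I2 ennreal_leI) (auto simp: \<delta>_def q_nn)
    show "(\<integral>\<^sup>+x. ennreal (q x (G x)) \<partial>lebesgue_on \<Omega>) < \<infinity>" using Gfin by simp
    have "AE x in lebesgue_on \<Omega>. x \<in> \<Omega>" using AE_space[of "lebesgue_on \<Omega>"] by simp
    then show "AE x in lebesgue_on \<Omega>. (\<lambda>n. ennreal (\<delta> n x * q x (G x))) \<longlonglongrightarrow> 0"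
      using r(2) P
    proof eventually_elim
      case (elim x)
      have V: "(\<lambda>n. V (r n) x) \<longlonglongrightarrow> u x"
        using elim(2) by (rule tendsto_of_square_sum) (rule q_nn[OF elim(1)])
      have "eventually (\<lambda>n. \<delta> n x = 0) sequentially"
      proof (cases "P < u x")
        case True
        with order_tendstoD(1)[OF V True] show ?thesis by (auto simp: \<delta>_def elim: eventually_mono)
      next
        case False
        then have "u x < P" using elim(3) by simp
        with order_tendstoD(2)[OF V this] show ?thesis by (auto simp: \<delta>_def elim: eventually_mono)
      qed
      then have "eventually (\<lambda>n. ennreal (\<delta> n x * q x (G x)) = 0) sequentially"
        by eventually_elim simp
      then show ?case by (rule tendsto_eventually)
    qed
  qed (auto simp: q_def)
  have lim1: "(\<lambda>n. energy A \<Omega> (\<lambda>x. u x - V (r n) x) (\<lambda>x. G x - grad (V (r n)) x)) \<longlonglongrightarrow> 0"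
    using filterlim_compose[OF lim r(1)] by simp
  have "(\<lambda>n. ennreal K * energy A \<Omega> (\<lambda>x. u x - V (r n) x) (\<lambda>x. G x - grad (V (r n)) x) +
     ennreal K * (\<integral>\<^sup>+x. ennreal (\<delta> n x * q x (G x)) \<partial>lebesgue_on \<Omega>)) \<longlonglongrightarrow> ennreal K * 0 + ennreal K *
       0"
    using lim2 by (intro tendsto_add ennreal_tendsto_cmult lim1) auto
  then have lim3: "(\<lambda>n. ennreal K * energy A \<Omega> (\<lambda>x. u x - V (r n) x) (\<lambda>x. G x - grad (V (r n)) x) +
     ennreal K * (\<integral>\<^sup>+x. ennreal (\<delta> n x * q x (G x)) \<partial>lebesgue_on \<Omega>)) \<longlonglongrightarrow> 0" by simp
  have "(\<lambda>n. energy A E (\<lambda>x. v x - W n x) (\<lambda>x. F x - grad (W n) x)) \<longlonglongrightarrow> 0"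
    by (rule tendsto_sandwich[OF _ _ tendsto_const lim3])
      (intro always_eventually allI bound zero_le)+
  moreover have "W n \<in> Lip_c E" for n
    unfolding W_def by (intro Lip_c_mult[OF \<eta> _ open_\<Omega> E(2)] Lip_loc_max_0 V)
  ultimately have "W12A0 A E v F"
    unfolding W12A0_def sobolev_closure_def using vF_meas vF_fin by blast
  then show ?thesis by (simp add: v_def F_def)
qed

section \<open>The Orlicz-Sobolev and admissibility inequalities on the closure\<close>

lemma ennsqrt_ennreal: "0 \<le> x \<Longrightarrow> ennsqrt (ennreal x) = ennreal (sqrt x)"
  by (simp add: ennsqrt_def)

context degenerate
begin

lemma \<B>_measurable:
  assumes "E \<subseteq> \<Omega>"
  shows "\<B> \<in> borel_measurable (lebesgue_on E)"
proof -
  have "\<B> \<in> borel_measurable (lebesgue_on \<Omega>)"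
    using lipschitz_on_continuous_on[OF \<B>_lipschitz] \<Omega>_lebesgue
    by (rule continuous_imp_measurable_on_sets_lebesgue)
  then show ?thesis using assms by (rule measurable_restrict_mono)
qed

lemma \<B>_mult_measurable:
  assumes "G \<in> borel_measurable (lebesgue_on E)" "E \<subseteq> \<Omega>"
  shows "(\<lambda>x. \<B> x *v G x) \<in> borel_measurable (lebesgue_on E)"
  using \<B>_measurable[OF assms(2)] assms(1) by (rule borel_measurable_matrix_vector_mult)

lemma w_measurable: "E \<subseteq> \<Omega> \<Longrightarrow> w \<in> borel_measurable (lebesgue_on E)"
  using w_meas by (rule measurable_restrict_mono)

lemma W12A0_\<B>_finite:
  assumes "W12A0 A D v G" "D \<subseteq> \<Omega>"
  shows "(\<integral>\<^sup>+x. ennreal ((norm (\<B> x *v G x))\<^sup>2) \<partial>lebesgue_on D) < top"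
proof -
  have "v \<in> borel_measurable (lebesgue_on D)" "G \<in> borel_measurable (lebesgue_on D)"
    and fin: "energy A D v G < top"
    using assms by (auto simp: W12A0_def sobolev_closure_def)
  note [measurable] = this(1,2) measurable_form[OF this(2) assms(2)]
  have "(\<integral>\<^sup>+x. ennreal ((norm (\<B> x *v G x))\<^sup>2) \<partial>lebesgue_on D) \<le>
    (\<integral>\<^sup>+x. ennreal C\<^sub>A * ennreal ((v x)\<^sup>2 + G x \<bullet> (A x *v G x)) \<partial>lebesgue_on D)"
  proof (rule nn_integral_mono)
    fix x assume "x \<in> space (lebesgue_on D)"
    then have x: "x \<in> \<Omega>" using assms(2) by auto
    have "(norm (\<B> x *v G x))\<^sup>2 \<le> C\<^sub>A * (G x \<bullet> (A x *v G x))" by (rule upper[OF x])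
    also have "\<dots> \<le> C\<^sub>A * ((v x)\<^sup>2 + G x \<bullet> (A x *v G x))" using C\<^sub>A by simp
    finally have "(norm (\<B> x *v G x))\<^sup>2 \<le> C\<^sub>A * ((v x)\<^sup>2 + G x \<bullet> (A x *v G x))" .
    moreover have
      "ennreal C\<^sub>A * ennreal ((v x)\<^sup>2 + G x \<bullet> (A x *v G x)) =
      ennreal (C\<^sub>A * ((v x)\<^sup>2 + G x \<bullet> (A x *v G x)))"
      using C\<^sub>A A_psd[OF x, of "G x"] by (intro ennreal_mult[symmetric]) auto
    ultimately show
      "ennreal ((norm (\<B> x *v G x))\<^sup>2) \<le> ennreal C\<^sub>A * ennreal ((v x)\<^sup>2 + G x \<bullet> (A x *v G x))"
      by (simp only: ennreal_leI)
  qed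
  also have "\<dots> = ennreal C\<^sub>A * energy A D v G" unfolding energy_def
    by (rule nn_integral_cmult) measurable
  also have "\<dots> < top" using fin by (simp add: ennreal_mult_less_top)
  finally show ?thesis .
qed

text \<open>Fatou's lemma only needs the lower bound \<open>\<Psi> t \<ge> h t\<^sup>2\<close> for \<open>t\<^sup>2 > T\<close>, no continuity of \<open>\<Psi>\<close>.\<close>

lemma W12A0_orlicz_gain:
  assumes D: "open D" "D \<subseteq> \<Omega>" and W: "wmeas w D = ennreal W" "0 < W"
    and OS: "\<And>v. v \<in> Lip_c D \<Longrightarrow> orlicz_norm \<Psi> w D v \<le>
       ennreal \<kappa> / ennsqrt (wmeas w D) * L2_norm_on D (\<lambda>y. \<B> y *v grad v y)" and "0 < \<kappa>"
    and \<Psi>: "\<And>t. T < t\<^sup>2 \<Longrightarrow> h * t\<^sup>2 \<le> \<Psi> t" and "0 < T" "0 < h"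
    and vG: "W12A0 A D v G"
    and a: "0 < a"
      "ennreal (2 * \<kappa>\<^sup>2 / W) * (\<integral>\<^sup>+x. ennreal ((norm (\<B> x *v G x))\<^sup>2) \<partial>lebesgue_on D) <
      ennreal (a\<^sup>2)"
  shows "(\<integral>\<^sup>+x. ennreal ((if a\<^sup>2 * T < (v x)\<^sup>2 then (v x)\<^sup>2 else 0) * w x) \<partial>lebesgue_on D) \<le>
    ennreal (a\<^sup>2 * W / h)"
proof -
  define q where "q = (\<lambda>x \<xi>. \<xi> \<bullet> (A x *v \<xi>))"
  have q_nn: "x \<in> D \<Longrightarrow> 0 \<le> q x \<xi>" for x \<xi> using A_psd D(2) by (auto simp: q_def)
  have D_leb[measurable]: "D \<in> sets lebesgue" using D(1) by auto
  have [measurable]: "v \<in> borel_measurable (lebesgue_on D)" "G \<in> borel_measurable (lebesgue_on D)"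
    using vG by (auto simp: W12A0_def sobolev_closure_def)
  obtain V where V: "\<And>m::nat. V m \<in> Lip_c D"
    and lim: "(\<lambda>m. energy A D (\<lambda>x. v x - V m x) (\<lambda>x. G x - grad (V m) x)) \<longlonglongrightarrow> 0"
    using vG by (auto simp: W12A0_def sobolev_closure_def)
  have V_meas[measurable]: "V m \<in> borel_measurable (lebesgue_on D)" for m
    using V[of m] by (auto elim!: Lip_c_lipschitz intro: measurable_lipschitz_lebesgue)
  have gV_meas[measurable]: "grad (V m) \<in> borel_measurable (lebesgue_on D)" for m
    by (rule borel_measurable_grad_Lip_loc[OF D(1) Lip_c_imp_Lip_loc[OF V]])
  have [measurable]: "\<And>m. (\<lambda>x. q x (G x - grad (V m) x)) \<in> borel_measurable (lebesgue_on D)"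
    "(\<lambda>x. \<B> x *v G x) \<in> borel_measurable (lebesgue_on D)"
    "\<And>m. (\<lambda>x. \<B> x *v grad (V m) x) \<in> borel_measurable (lebesgue_on D)"
    "w \<in> borel_measurable (lebesgue_on D)"
    unfolding q_def
      by (auto intro!: measurable_form[OF _ D(2)] \<B>_mult_measurable[OF _ D(2)] w_measurable D(2)
      borel_measurable_diff)
  define I where "I = (\<integral>\<^sup>+x. ennreal ((norm (\<B> x *v G x))\<^sup>2) \<partial>lebesgue_on D)"
  define e where "e = (\<lambda>m. energy A D (\<lambda>x. v x - V m x) (\<lambda>x. G x - grad (V m) x))"
  define Im where "Im = (\<lambda>m. \<integral>\<^sup>+x. ennreal ((norm (\<B> x *v grad (V m) x))\<^sup>2) \<partial>lebesgue_on D)"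
  \<comment> \<open>The factor 2 is the price for passing from \<open>G\<close> to the gradients of
    the approximants and explains the constant in the hypothesis on \<open>a\<close>. As that
    hypothesis is a strict inequality, the vanishing error e m fits eventually.\<close>
  have Im: "Im m \<le> 2 * I + ennreal (2 * C\<^sub>A) * e m" for m
  proof -
    have "Im m \<le>
      (\<integral>\<^sup>+x. 2 * ennreal ((norm (\<B> x *v G x))\<^sup>2) + ennreal (2 * C\<^sub>A) * ennreal
      ((v x - V m x)\<^sup>2 + q x (G x - grad (V m) x)) \<partial>lebesgue_on D)"
      unfolding Im_def
    proof (rule nn_integral_mono)
      fix x assume "x \<in> space (lebesgue_on D)"
      then have x: "x \<in> D" "x \<in> \<Omega>" using D(2) by auto
      let ?a = "\<B> x *v G x" and ?b = "\<B> x *v (G x - grad (V m) x)"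
      have "(norm (?a - ?b))\<^sup>2 \<le> 2 * (norm ?a)\<^sup>2 + 2 * (norm ?b)\<^sup>2" by (rule norm_diff_square_le)
      moreover have "?a - ?b = \<B> x *v grad (V m) x" by (simp add: matrix_vector_mult_diff_distrib)
      moreover have "(norm ?b)\<^sup>2 \<le> C\<^sub>A * q x (G x - grad (V m) x)" unfolding q_def
        by (rule upper[OF x(2)])
      moreover have
        "C\<^sub>A * q x (G x - grad (V m) x) \<le> C\<^sub>A * ((v x - V m x)\<^sup>2 + q x (G x - grad (V m) x))"
        using C\<^sub>A by simp
      ultimately have *:
        "(norm (\<B> x *v grad (V m) x))\<^sup>2 \<le> 2 * (norm ?a)\<^sup>2 + (2 * C\<^sub>A) *
        ((v x - V m x)\<^sup>2 + q x (G x - grad (V m) x))"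
        by simp
      have "2 * ennreal ((norm ?a)\<^sup>2) + ennreal (2 * C\<^sub>A) *
        ennreal ((v x - V m x)\<^sup>2 + q x (G x - grad (V m) x)) =
        ennreal (2 * (norm ?a)\<^sup>2 + (2 * C\<^sub>A) * ((v x - V m x)\<^sup>2 + q x (G x - grad (V m) x)))"
        using C\<^sub>A q_nn[OF x(1), of "G x - grad (V m) x"] by (simp add: ennreal_plus ennreal_mult)
      then show "ennreal ((norm (\<B> x *v grad (V m) x))\<^sup>2) \<le>
         2 * ennreal ((norm ?a)\<^sup>2) + ennreal (2 * C\<^sub>A) * ennreal
           ((v x - V m x)\<^sup>2 + q x (G x - grad (V m) x))"
        using * by (simp only: ennreal_leI)
    qed
    also have "\<dots> = 2 * I + ennreal (2 * C\<^sub>A) *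
      (\<integral>\<^sup>+x. ennreal ((v x - V m x)\<^sup>2 + q x (G x - grad (V m) x)) \<partial>lebesgue_on D)"
      unfolding I_def by (subst nn_integral_add) (auto simp: nn_integral_cmult)
    finally show ?thesis by (simp add: e_def energy_def q_def)
  qed
  have "(\<lambda>m. ennreal (\<kappa>\<^sup>2 / W) * (2 * I + ennreal (2 * C\<^sub>A) * e m)) \<longlonglongrightarrow> ennreal (\<kappa>\<^sup>2 / W) *
    (2 * I + ennreal (2 * C\<^sub>A) * 0)"
    using lim unfolding e_def[symmetric]
      by (intro ennreal_tendsto_cmult tendsto_add tendsto_const) auto
  moreover have "ennreal (\<kappa>\<^sup>2 / W) * (2 * I + ennreal (2 * C\<^sub>A) * 0) = ennreal (2 * \<kappa>\<^sup>2 / W) * I"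
  proof -
    have "ennreal (\<kappa>\<^sup>2 / W) * ennreal 2 = ennreal (2 * \<kappa>\<^sup>2 / W)"
      using W(2) by (subst ennreal_mult[symmetric]) (auto simp: mult.commute)
    then show ?thesis by (simp flip: mult.assoc)
  qed
  ultimately have ev:
    "\<forall>\<^sub>F m in sequentially. ennreal (\<kappa>\<^sup>2 / W) * (2 * I + ennreal (2 * C\<^sub>A) * e m) < ennreal (a\<^sup>2)"
    using a(2) unfolding I_def[symmetric] by (auto dest: order_tendstoD(2))
  define f where "f = (\<lambda>v x. ennreal ((if a\<^sup>2 * T < (v x)\<^sup>2 then (v x)\<^sup>2 else 0) * w x))"
  have each: "(\<integral>\<^sup>+x. f (V m) x \<partial>lebesgue_on D) \<le> ennreal (a\<^sup>2 * W / h)"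
    if m: "ennreal (\<kappa>\<^sup>2 / W) * (2 * I + ennreal (2 * C\<^sub>A) * e m) < ennreal (a\<^sup>2)" for m
  proof -
    have 1: "ennreal (\<kappa>\<^sup>2 / W) * Im m < ennreal (a\<^sup>2)"
      using mult_left_mono[OF Im[of m], of "ennreal (\<kappa>\<^sup>2 / W)"] m by (simp add: le_less_trans)
    have "Im m \<noteq> top"
    proof
      assume "Im m = top"
      moreover have "ennreal (\<kappa>\<^sup>2 / W) \<noteq> 0" using \<open>0 < \<kappa>\<close> W(2) by simp
      ultimately show False using 1 by (simp add: ennreal_mult_top)
    qed
    then obtain i where i: "i \<ge> 0" "Im m = ennreal i" by (metis ennreal_cases)
    have "ennreal (\<kappa>\<^sup>2 / W * i) < ennreal (a\<^sup>2)" using 1 i W(2) by (subst ennreal_mult) auto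
    then have i2: "\<kappa>\<^sup>2 / W * i < a\<^sup>2" using i W(2) by (subst (asm) ennreal_less_iff) auto
    have "\<kappa> / sqrt W * sqrt i < a"
    proof (rule power2_less_imp_less)
      show "(\<kappa> / sqrt W * sqrt i)\<^sup>2 < a\<^sup>2" using i2 W(2) i(1)
        by (simp add: power_mult_distrib power_divide)
    qed (use a in simp)
    moreover have "L2_norm_on D (\<lambda>y. \<B> y *v grad (V m) y) = ennreal (sqrt i)"
      using i by (simp add: L2_norm_on_def Im_def ennsqrt_ennreal)
    then have "ennreal \<kappa> / ennsqrt (wmeas w D) * L2_norm_on D (\<lambda>y. \<B> y *v grad (V m) y) =
      ennreal (\<kappa> / sqrt W * sqrt i)"
      using W i(1) \<open>0 < \<kappa>\<close> by (simp add: ennsqrt_ennreal divide_ennreal flip: ennreal_mult)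
    ultimately have
      "ennreal \<kappa> / ennsqrt (wmeas w D) * L2_norm_on D (\<lambda>y. \<B> y *v grad (V m) y) < ennreal a"
      using a(1) i \<open>0 < \<kappa>\<close> W(2) by (simp add: ennreal_less_iff)
    then have "orlicz_norm \<Psi> w D (V m) < ennreal a" using OS[OF V] by (rule le_less_trans[rotated])
    \<comment> \<open>The norm is an infimum, so some b < a is admissible in its definition. From
      V^2 > a^2 T it follows that (V/b)^2 > T, where \<open>\<Psi>\<close> is at least h V^2 /
      b^2.\<close>
    then obtain b where b: "0 < b" "ennreal b < ennreal a"
      "(\<integral>\<^sup>+ x. ennreal (\<Psi> (\<bar>V m x\<bar> / b)) \<partial>density (lebesgue_on D) (\<lambda>x. ennreal (w x) / wmeas w D))
        \<le> 1"
      unfolding orlicz_norm_def by (auto simp: INF_less_iff)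
    have ba: "b < a" using b by (simp add: ennreal_less_iff)
    define g where "g = (\<lambda>x. ennreal (h / b\<^sup>2 * (if a\<^sup>2 * T < (V m x)\<^sup>2 then (V m x)\<^sup>2 else 0)))"
    have "(\<integral>\<^sup>+ x. g x \<partial>density (lebesgue_on D) (\<lambda>x. ennreal (w x) / wmeas w D)) \<le>
      (\<integral>\<^sup>+ x. ennreal (\<Psi> (\<bar>V m x\<bar> / b)) \<partial>density (lebesgue_on D) (\<lambda>x. ennreal (w x) / wmeas w D))"
    proof (rule nn_integral_mono)
      fix x
      show "g x \<le> ennreal (\<Psi> (\<bar>V m x\<bar> / b))"
      proof (cases "a\<^sup>2 * T < (V m x)\<^sup>2")
        case True
        have "b\<^sup>2 * T \<le> a\<^sup>2 * T" using ba b(1) \<open>0 < T\<close> by (intro mult_right_mono power_mono) auto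
        then have "T < (\<bar>V m x\<bar> / b)\<^sup>2" using True b(1) by (simp add: power_divide field_simps)
        from \<Psi>[OF this] show ?thesis using True by (simp add: g_def power_divide ennreal_leI)
      qed (simp add: g_def)
    qed
    also note b(3)
    also have "(\<integral>\<^sup>+ x. g x \<partial>density (lebesgue_on D) (\<lambda>x. ennreal (w x) / wmeas w D)) =
      (\<integral>\<^sup>+ x. ennreal (w x) / wmeas w D * g x \<partial>lebesgue_on D)"
      unfolding g_def by (rule nn_integral_density) measurable
    also have "\<dots> = (\<integral>\<^sup>+ x. ennreal (h / (b\<^sup>2 * W)) * f (V m) x \<partial>lebesgue_on D)"
    proof (intro nn_integral_cong)
      fix x
      have "ennreal (w x) / wmeas w D = ennreal (w x / W)" if "w x \<ge> 0" using W that
        by (simp add: divide_ennreal)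
      moreover have "ennreal (w x) = 0" "f (V m) x = 0" if "w x \<le> 0"
        using that by (auto simp: f_def ennreal_neg mult_nonneg_nonpos)
      ultimately show "ennreal (w x) / wmeas w D * g x = ennreal (h / (b\<^sup>2 * W)) * f (V m) x"
        using W(2) b(1) \<open>0 < h\<close>
          by (cases "w x \<ge> 0") (auto simp: g_def f_def mult_ac simp flip: ennreal_mult)
    qed
    also have "\<dots> = ennreal (h / (b\<^sup>2 * W)) * (\<integral>\<^sup>+ x. f (V m) x \<partial>lebesgue_on D)"
      unfolding f_def by (rule nn_integral_cmult) measurable
    finally have 2: "ennreal (h / (b\<^sup>2 * W)) * (\<integral>\<^sup>+ x. f (V m) x \<partial>lebesgue_on D) \<le> 1" .
    have "(\<integral>\<^sup>+ x. f (V m) x \<partial>lebesgue_on D) = ennreal (b\<^sup>2 * W / h) *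
      (ennreal (h / (b\<^sup>2 * W)) * (\<integral>\<^sup>+ x. f (V m) x \<partial>lebesgue_on D))"
      using W(2) b(1) \<open>0 < h\<close> by (simp flip: mult.assoc ennreal_mult)
    also have "\<dots> \<le> ennreal (b\<^sup>2 * W / h) * 1" using 2 by (rule mult_left_mono) simp
    also have "\<dots> \<le> ennreal (a\<^sup>2 * W / h)"
      using ba b(1) W(2) \<open>0 < h\<close>
        by (auto intro!: ennreal_leI divide_right_mono mult_right_mono power_mono)
    finally show ?thesis .
  qed
  obtain r where r: "filterlim r at_top sequentially"
    "AE x in lebesgue_on D. (\<lambda>n. (v x - V (r n) x)\<^sup>2 + q x (G x - grad (V (r n)) x)) \<longlonglongrightarrow> 0"
  proof (rule
    AE_subsequence[where M="lebesgue_on D" and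
    g="\<lambda>n x. (v x - V n x)\<^sup>2 + q x (G x - grad (V n) x)"])
    show "(\<lambda>n. \<integral>\<^sup>+x. ennreal ((v x - V n x)\<^sup>2 + q x (G x - grad (V n) x)) \<partial>lebesgue_on D) \<longlonglongrightarrow> 0"
      using lim by (simp add: energy_def q_def)
    show "(\<lambda>x. (v x - V n x)\<^sup>2 + q x (G x - grad (V n) x)) \<in> borel_measurable (lebesgue_on D)"
      for n by measurable
  qed (auto intro: add_nonneg_nonneg q_nn)
  have "(\<integral>\<^sup>+x. f v x \<partial>lebesgue_on D) \<le> (\<integral>\<^sup>+x. liminf (\<lambda>n. f (V (r n)) x) \<partial>lebesgue_on D)"
  proof (rule nn_integral_mono_AE)
    have "AE x in lebesgue_on D. x \<in> D" using AE_space[of "lebesgue_on D"] by simp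
    then show "AE x in lebesgue_on D. f v x \<le> liminf (\<lambda>n. f (V (r n)) x)"
      using r(2)
    proof eventually_elim
      case (elim x)
      show ?case
      proof (cases "a\<^sup>2 * T < (v x)\<^sup>2")
        \<comment> \<open>The threshold is a strict inequality, so it holds eventually for the
          approximants too; this gives the lower semicontinuity required for Fatou.\<close>
        case True
        have "(\<lambda>n. V (r n) x) \<longlonglongrightarrow> v x"
          using elim(2) by (rule tendsto_of_square_sum) (rule q_nn[OF elim(1)])
        then have lim2: "(\<lambda>n. (V (r n) x)\<^sup>2) \<longlonglongrightarrow> (v x)\<^sup>2" by (intro tendsto_intros)
        then have "(\<lambda>n. ennreal ((V (r n) x)\<^sup>2 * w x)) \<longlonglongrightarrow> f v x"
          unfolding f_def using True by (auto intro!: tendsto_intros)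
        moreover have "\<forall>\<^sub>F n in sequentially. ennreal ((V (r n) x)\<^sup>2 * w x) = f (V (r n)) x"
          using order_tendstoD(1)[OF lim2 True] by eventually_elim (simp add: f_def)
        ultimately have "(\<lambda>n. f (V (r n)) x) \<longlonglongrightarrow> f v x" by (rule Lim_transform_eventually)
        then show ?thesis by (simp add: lim_imp_Liminf)
      qed (simp add: f_def)
    qed
  qed
  also have "\<dots> \<le> liminf (\<lambda>n. \<integral>\<^sup>+x. f (V (r n)) x \<partial>lebesgue_on D)"
    by (rule nn_integral_liminf) (simp add: f_def)
  also have "\<dots> \<le> liminf (\<lambda>n. ennreal (a\<^sup>2 * W / h))"
  proof (rule Liminf_mono)
    have "\<forall>\<^sub>F n in sequentially. ennreal (\<kappa>\<^sup>2 / W) * (2 * I + ennreal (2 * C\<^sub>A) * e (r n)) <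
      ennreal (a\<^sup>2)"
      using ev r(1) by (rule eventually_compose_filterlim)
    then show "\<forall>\<^sub>F n in sequentially. (\<integral>\<^sup>+x. f (V (r n)) x \<partial>lebesgue_on D) \<le> ennreal (a\<^sup>2 * W / h)"
      by eventually_elim (rule each)
  qed
  also have "\<dots> = ennreal (a\<^sup>2 * W / h)" by (simp add: Liminf_const)
  finally show ?thesis by (simp add: f_def)
qed

text \<open>The supremum in \<open>X_norm\<close> is unwound for one pair. Degenerate quotients are
  the only difficulty: with s = 0 or i = 0 a factor of the quotient is governed by the conventions
  of extended arithmetic.\<close>

lemma X_norm_estimate:
  assumes D: "open D" "D \<subseteq> \<Omega>" and W: "wmeas w D < top"
    and X: "X_norm w A \<B> D \<phi> \<le> ennreal X" "0 \<le> X"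
    and \<phi>: "\<phi> \<in> borel_measurable (lebesgue_on \<Omega>)"
    and gH: "W12A0 A D g H"
    and s: "wmeas w {y\<in>D. g y \<noteq> 0} = ennreal s" "0 \<le> s"
    and i: "(\<integral>\<^sup>+x. ennreal ((norm (\<B> x *v H x))\<^sup>2) \<partial>lebesgue_on D) = ennreal i" "0 \<le> i"
  shows "integrable (lebesgue_on D) (\<lambda>x. g x * \<phi> x)"
    and "\<bar>LINT x|lebesgue_on D. g x * \<phi> x\<bar> \<le> X * sqrt s * sqrt i"
proof -
  have D_leb[measurable]: "D \<in> sets lebesgue" using D(1) by auto
  have [measurable]: "g \<in> borel_measurable (lebesgue_on D)" "\<phi> \<in> borel_measurable (lebesgue_on D)"
    "w \<in> borel_measurable (lebesgue_on D)"
    using gH measurable_restrict_mono[OF \<phi> D(2)] w_measurable[OF D(2)]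
      by (auto simp: W12A0_def sobolev_closure_def)
  have L2: "L2_norm_on D (\<lambda>y. \<B> y *v H y) = ennreal (sqrt i)"
    using i by (simp add: L2_norm_on_def ennsqrt_ennreal)
  define t where "t = abs_integral D (\<lambda>y. g y * \<phi> y)"
  have le: "inverse (ennreal (sqrt s)) * (t / ennreal (sqrt i)) \<le> ennreal X"
  proof -
    have "inverse (ennsqrt (wmeas w {y \<in> D. g y \<noteq> 0})) *
        (abs_integral D (\<lambda>y. g y * \<phi> y) / L2_norm_on D (\<lambda>y. \<B> y *v H y)) \<le> X_norm w A \<B> D \<phi>"
      unfolding X_norm_def by (rule SUP_upper2[of "(g, H)"]) (use gH in auto)
    also note X(1)
    finally show ?thesis using s by (simp add: t_def L2 ennsqrt_ennreal)
  qed
  have "integrable (lebesgue_on D) (\<lambda>x. g x * \<phi> x) \<and> \<bar>LINT x|lebesgue_on D. g x * \<phi> x\<bar> \<le> X *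
    sqrt s * sqrt i"
  proof (cases "s = 0")
    \<comment> \<open>Positivity of \<open>w\<close> almost everywhere makes \<open>g\<close> vanish
      almost everywhere, which gives both claims directly.\<close>
    case True
    have S: "{y\<in>D. g y \<noteq> 0} \<in> sets lebesgue"
    proof -
      have "{y\<in>space (lebesgue_on D). g y \<noteq> 0} \<in> sets (lebesgue_on D)" by measurable
      then show ?thesis using D_leb by (simp add: sets_restrict_space_iff)
    qed
    have "(\<integral>\<^sup>+x. ennreal (w x) \<partial>lebesgue_on {y\<in>D. g y \<noteq> 0}) = 0" using s True
      by (simp add: wmeas_def)
    moreover have "w \<in> borel_measurable (lebesgue_on {y\<in>D. g y \<noteq> 0})" using D(2)
      by (intro w_measurable) auto
    ultimately have "AE x in lebesgue_on {y\<in>D. g y \<noteq> 0}. ennreal (w x) = 0"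
      by (simp add: nn_integral_0_iff_AE)
    moreover have "AE x in lebesgue_on {y\<in>D. g y \<noteq> 0}. 0 < w x"
      by (rule AE_lebesgue_on_mono_set[OF w_pos]) (use D(2) S in auto)
    ultimately have "AE x in lebesgue_on {y\<in>D. g y \<noteq> 0}. False"
      by eventually_elim auto
    then have ae: "AE x in lebesgue_on D. g x * \<phi> x = 0"
      using S D_leb by (auto simp: AE_restrict_space_iff elim!: eventually_mono)
    have "integrable (lebesgue_on D) (\<lambda>x. g x * \<phi> x) \<longleftrightarrow> integrable (lebesgue_on D) (\<lambda>x. 0::real)"
      "(LINT x|lebesgue_on D. g x * \<phi> x) = (LINT x|lebesgue_on D. 0)"
      by (rule integrable_cong_AE[OF _ _ ae] integral_cong_AE[OF _ _ ae]; measurable)+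
    then show ?thesis using True by simp
  next
    case False
    then have s0: "s > 0" using s(2) by simp
    have inv: "inverse (ennreal (sqrt s)) = ennreal (1 / sqrt s)" using s0
      by (simp add: inverse_ennreal divide_inverse)
    have "t \<noteq> top"
    proof
      assume "t = top"
      then have "t / ennreal (sqrt i) = top" by (simp add: divide_ennreal_def ennreal_top_mult)
      then show False using le s0 by (simp add: inv ennreal_mult_top top_unique)
    qed
    then have int: "integrable (lebesgue_on D) (\<lambda>x. g x * \<phi> x)"
      and t: "t = ennreal \<bar>LINT x|lebesgue_on D. g x * \<phi> x\<bar>"
      by (auto simp: t_def abs_integral_def split: if_splits)
    show ?thesis
    proof (cases "i = 0")
      case True
      \<comment> \<open>A positive number divided by 0 is \<open>top\<close>, which the finite bound
        \<open>X\<close> excludes.\<close>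
      have "t = 0"
      proof (rule ccontr)
        assume "t \<noteq> 0"
        then have "t / ennreal (sqrt i) = top" using True
          by (simp add: divide_ennreal_def ennreal_mult_top)
        then show False using le s0 by (simp add: inv ennreal_mult_top top_unique)
      qed
      then show ?thesis using int t True by simp
    next
      case False
      then have i0: "sqrt i > 0" using i(2) by simp
      have "ennreal (1 / sqrt s * (\<bar>LINT x|lebesgue_on D. g x * \<phi> x\<bar> / sqrt i)) \<le> ennreal X"
        using le i0 s0 unfolding inv t by (simp add: divide_ennreal flip: ennreal_mult)
      then have "1 / sqrt s * (\<bar>LINT x|lebesgue_on D. g x * \<phi> x\<bar> / sqrt i) \<le> X"
        using X(2) by (simp only: ennreal_le_iff)
      then show ?thesis using int i0 s0 by (simp add: field_simps)
    qed
  qed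
  then show "integrable (lebesgue_on D) (\<lambda>x. g x * \<phi> x)"
    "\<bar>LINT x|lebesgue_on D. g x * \<phi> x\<bar> \<le> X * sqrt s * sqrt i" by auto
qed

end

section \<open>The Caccioppoli inequality\<close>

context degenerate
begin

lemma form_sym: "x \<in> \<Omega> \<Longrightarrow> a \<bullet> (A x *v b) = b \<bullet> (A x *v a)"
  using A_sym[of x] by (metis dot_lmul_matrix inner_commute vector_transpose_matrix)

text \<open>The test function is \<open>\<psi>\<^sup>2 v\<close> with \<open>v = (u - P)\<^sub>+\<close>. With \<open>F = \<nabla>(\<psi> v)\<close> one has
  \<open>\<nabla>(\<psi>\<^sup>2 v) \<bullet> A \<nabla>u = F \<bullet> A F - v\<^sup>2 \<nabla>\<psi> \<bullet> A \<nabla>\<psi>\<close>.\<close>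

lemma Caccioppoli:
  assumes D: "open D" "D \<subseteq> \<Omega>" and W: "wmeas w D < top"
    and X: "X_norm w A \<B> D \<phi> \<le> ennreal X" "0 \<le> X"
    and \<phi>: "\<phi> \<in> borel_measurable (lebesgue_on \<Omega>)"
    and uG: "W12A A \<Omega> u G"
    and sub: "\<And>g H. W12A0 A \<Omega> g H \<Longrightarrow> AE x in lebesgue_on \<Omega>. 0 \<le> g x \<Longrightarrow>
       integrable (lebesgue_on \<Omega>) (\<lambda>x. \<phi> x * g x) \<Longrightarrow>
       (LINT x|lebesgue_on \<Omega>. \<phi> x * g x) \<le> - (LINT x|lebesgue_on \<Omega>. H x \<bullet> (A x *v G x))"
    and P: "AE x in lebesgue_on \<Omega>. u x \<noteq> P"
    and \<psi>: "\<psi> \<in> Lip_c D" "\<And>x. 0 \<le> \<psi> x" "\<And>x. \<psi> x \<le> 1"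
    and s: "wmeas w {y\<in>D. \<psi> y * max (u y - P) 0 \<noteq> 0} = ennreal s" "0 \<le> s"
    and j: "(\<integral>\<^sup>+x. ennreal ((max (u x - P) 0)\<^sup>2 * (norm (\<B> x *v grad \<psi> x))\<^sup>2) \<partial>lebesgue_on \<Omega>) =
      ennreal j" "0 \<le> j"
  defines "F \<equiv> \<lambda>x. max (u x - P) 0 *\<^sub>R grad \<psi> x + (if P < u x then \<psi> x else 0) *\<^sub>R G x"
  shows "(\<integral>\<^sup>+x. ennreal ((norm (\<B> x *v F x))\<^sup>2) \<partial>lebesgue_on \<Omega>) \<le>
     ennreal ((1 + 2 * C\<^sub>A\<^sup>2 + 2 * C\<^sub>A / c\<^sub>A) * (X\<^sup>2 * s + j))"
proof -
  let ?M = "lebesgue_on \<Omega>"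
  define v where "v = (\<lambda>x. max (u x - P) 0)"
  define pos where "pos = (\<lambda>x. if P < u x then 1 else 0 :: real)"
  have vpos: "v x * pos x = v x" "pos x * pos x = pos x" for x by (auto simp: v_def pos_def)
  have F_eq: "F x = v x *\<^sub>R grad \<psi> x + (\<psi> x * pos x) *\<^sub>R G x" for x
    by (simp add: F_def v_def pos_def)
  define q where "q = (\<lambda>x \<xi>. \<xi> \<bullet> (A x *v \<xi>))"
  have q_nn: "x \<in> \<Omega> \<Longrightarrow> 0 \<le> q x \<xi>" for x \<xi> using A_psd by (simp add: q_def)
  have D_leb[measurable]: "D \<in> sets lebesgue" using D(1) by auto
  have u_meas[measurable]: "u \<in> borel_measurable ?M"
    and G_meas[measurable]: "G \<in> borel_measurable ?M"
    using uG by (auto simp: W12A_def sobolev_closure_def)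
  obtain L where L: "L-lipschitz_on UNIV \<psi>" using \<psi>(1) by (rule Lip_c_lipschitz)
  have [measurable]: "\<psi> \<in> borel_measurable ?M" by (rule measurable_lipschitz_lebesgue[OF L])
  have g\<psi>_meas[measurable]: "grad \<psi> \<in> borel_measurable ?M"
    by (rule borel_measurable_grad_Lip_loc[OF open_\<Omega> lipschitz_imp_Lip_loc[OF L]])
  have [measurable]: "v \<in> borel_measurable ?M" "pos \<in> borel_measurable ?M"
    unfolding v_def pos_def by measurable
  have F_meas[measurable]: "F \<in> borel_measurable ?M" unfolding F_eq[abs_def] by measurable
  have [measurable]: "(\<lambda>x. q x (F x)) \<in> borel_measurable ?M"
    "(\<lambda>x. q x (grad \<psi> x)) \<in> borel_measurable ?M"
    "(\<lambda>x. \<B> x *v F x) \<in> borel_measurable ?M" "(\<lambda>x. \<B> x *v grad \<psi> x) \<in> borel_measurable ?M"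
    unfolding q_def by (auto intro!: measurable_form \<B>_mult_measurable)
  define g where "g = (\<lambda>x. (\<psi> x)\<^sup>2 * max (u x - P) 0)"
  define H where
    "H = (\<lambda>x. max (u x - P) 0 *\<^sub>R grad (\<lambda>y. (\<psi> y)\<^sup>2) x + (if P < u x then (\<psi> x)\<^sup>2 else 0) *\<^sub>R G x)"
  have gH: "W12A0 A D g H" "W12A0 A \<Omega> g H"
    unfolding g_def H_def
    by (intro W12A0_cutoff_truncation[OF uG] D P open_\<Omega> subset_refl Lip_c_square \<psi>(1)
      Lip_c_mono[OF Lip_c_square[OF \<psi>(1)]])+
  have vF: "W12A0 A \<Omega> (\<lambda>x. \<psi> x * max (u x - P) 0) F"
    unfolding F_def
      by (intro W12A0_cutoff_truncation[OF uG] P open_\<Omega> subset_refl Lip_c_mono[OF \<psi>(1)] D)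
  \<comment> \<open>The gradient of \<psi>^2 is 2 \<psi> grad \<psi>: one copy completes \<psi> F,
    the other remains. This form serves both for bounding \<B> H and for computing H . A G.\<close>
  have H_eq: "AE x in ?M. H x = \<psi> x *\<^sub>R F x + (\<psi> x * v x) *\<^sub>R grad \<psi> x"
    using AE_differentiable_Lip_loc[OF open_\<Omega> lipschitz_imp_Lip_loc[OF L]]
  proof eventually_elim
    case (elim x)
    have "grad (\<lambda>y. (\<psi> y)\<^sup>2) x = (2 * \<psi> x) *\<^sub>R grad \<psi> x"
      using grad_mult[OF elim elim] by (simp add: power2_eq_square scaleR_2 flip: scaleR_scaleR)
    then show ?case
      by (simp add: H_def F_eq v_def pos_def vec_eq_iff) (simp add: power2_eq_square algebra_simps)
  qed
  have H_meas[measurable]: "H \<in> borel_measurable ?M" using gH(2)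
    by (auto simp: W12A0_def sobolev_closure_def)
  have out: "\<psi> x = 0" "grad \<psi> x = 0" if "x \<notin> D" for x
    using that Lip_c_eq_0[OF \<psi>(1)] grad_Lip_c_eq_0[OF \<psi>(1)] by auto
  have int_qF: "integrable ?M (\<lambda>x. q x (F x))"
  proof (rule integrableI_nonneg)
    show "AE x in ?M. 0 \<le> q x (F x)" using AE_space[of ?M] by eventually_elim (auto intro: q_nn)
    have "(\<integral>\<^sup>+x. ennreal (q x (F x)) \<partial>?M) \<le> energy A \<Omega> (\<lambda>x. \<psi> x * max (u x - P) 0) F"
      unfolding energy_def q_def by (intro nn_integral_mono ennreal_leI) auto
    also have "\<dots> < \<infinity>" using vF by (simp add: W12A0_def sobolev_closure_def)
    finally show "(\<integral>\<^sup>+x. ennreal (q x (F x)) \<partial>?M) < \<infinity>" .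
  qed measurable
  have int_j: "integrable ?M (\<lambda>x. (v x)\<^sup>2 * (norm (\<B> x *v grad \<psi> x))\<^sup>2)"
    and j_eq: "(LINT x|?M. (v x)\<^sup>2 * (norm (\<B> x *v grad \<psi> x))\<^sup>2) = j"
  proof -
    show "integrable ?M (\<lambda>x. (v x)\<^sup>2 * (norm (\<B> x *v grad \<psi> x))\<^sup>2)"
      by (rule integrableI_nonneg) (use j in \<open>auto simp: v_def\<close>)
    show "(LINT x|?M. (v x)\<^sup>2 * (norm (\<B> x *v grad \<psi> x))\<^sup>2) = j"
      using j by (subst integral_eq_nn_integral) (auto simp: v_def)
  qed
  have int_q\<psi>: "integrable ?M (\<lambda>x. (v x)\<^sup>2 * q x (grad \<psi> x))"
    and q\<psi>_le: "c\<^sub>A * (LINT x|?M. (v x)\<^sup>2 * q x (grad \<psi> x)) \<le> j"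
  proof -
    have le: "c\<^sub>A * ((v x)\<^sup>2 * q x (grad \<psi> x)) \<le> (v x)\<^sup>2 * (norm (\<B> x *v grad \<psi> x))\<^sup>2" if "x \<in> \<Omega>"
      for x
      using mult_left_mono[OF lower[OF that, of "grad \<psi> x"], of "(v x)\<^sup>2"]
        by (simp add: q_def algebra_simps)
    have int: "integrable ?M (\<lambda>x. c\<^sub>A * ((v x)\<^sup>2 * q x (grad \<psi> x)))"
    proof (rule Bochner_Integration.integrable_bound[OF int_j])
      show "AE x in ?M. norm (c\<^sub>A * ((v x)\<^sup>2 * q x (grad \<psi> x))) \<le>
        norm ((v x)\<^sup>2 * (norm (\<B> x *v grad \<psi> x))\<^sup>2)"
        using AE_space[of ?M]
      proof eventually_elim
        case (elim x)
        then show ?case using le[of x] q_nn[of x "grad \<psi> x"] c\<^sub>A by (simp add: abs_mult)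
      qed
    qed measurable
    then show "integrable ?M (\<lambda>x. (v x)\<^sup>2 * q x (grad \<psi> x))" using c\<^sub>A by simp
    have "c\<^sub>A * (LINT x|?M. (v x)\<^sup>2 * q x (grad \<psi> x)) =
      (LINT x|?M. c\<^sub>A * ((v x)\<^sup>2 * q x (grad \<psi> x)))" by simp
    also have "\<dots> \<le> j" unfolding j_eq[symmetric] using le by (intro integral_mono int int_j) auto
    finally show "c\<^sub>A * (LINT x|?M. (v x)\<^sup>2 * q x (grad \<psi> x)) \<le> j" .
  qed
  have int_BF: "integrable ?M (\<lambda>x. (norm (\<B> x *v F x))\<^sup>2)"
    and BF_le: "(LINT x|?M. (norm (\<B> x *v F x))\<^sup>2) \<le> C\<^sub>A * (LINT x|?M. q x (F x))"
  proof -
    have le: "(norm (\<B> x *v F x))\<^sup>2 \<le> C\<^sub>A * q x (F x)" if "x \<in> \<Omega>" for x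
      using upper[OF that] by (simp add: q_def)
    have int: "integrable ?M (\<lambda>x. C\<^sub>A * q x (F x))" using int_qF by simp
    show *: "integrable ?M (\<lambda>x. (norm (\<B> x *v F x))\<^sup>2)"
    proof (rule Bochner_Integration.integrable_bound[OF int])
      show "AE x in ?M. norm ((norm (\<B> x *v F x))\<^sup>2) \<le> norm (C\<^sub>A * q x (F x))"
        using AE_space[of ?M]
      proof eventually_elim
        case (elim x)
        then show ?case using le[of x] by simp
      qed
    qed measurable
    have "(LINT x|?M. (norm (\<B> x *v F x))\<^sup>2) \<le> (LINT x|?M. C\<^sub>A * q x (F x))"
      using le by (intro integral_mono * int) auto
    then show "(LINT x|?M. (norm (\<B> x *v F x))\<^sup>2) \<le> C\<^sub>A * (LINT x|?M. q x (F x))" by simp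
  qed
  define I where "I = (LINT x|?M. (norm (\<B> x *v F x))\<^sup>2)"
  have I0: "0 \<le> I" unfolding I_def by (rule Bochner_Integration.integral_nonneg) simp
  define i where "i = enn2real (\<integral>\<^sup>+x. ennreal ((norm (\<B> x *v H x))\<^sup>2) \<partial>lebesgue_on D)"
  have i: "(\<integral>\<^sup>+x. ennreal ((norm (\<B> x *v H x))\<^sup>2) \<partial>lebesgue_on D) = ennreal i" "0 \<le> i"
    using W12A0_\<B>_finite[OF gH(1) D(2)] by (simp_all add: i_def)
  have i_le: "i \<le> 2 * I + 2 * j"
  proof -
    have "ennreal i \<le> (\<integral>\<^sup>+x. ennreal ((norm (\<B> x *v H x))\<^sup>2) \<partial>?M)"
      unfolding i(1)[symmetric] by (rule nn_integral_lebesgue_on_mono_set[OF D(2)]) auto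
    also have "\<dots> \<le>
      (\<integral>\<^sup>+x. ennreal (2 * (norm (\<B> x *v F x))\<^sup>2 + 2 * ((v x)\<^sup>2 * (norm (\<B> x *v grad \<psi> x))\<^sup>2)) \<partial>?M)"
    proof (rule nn_integral_mono_AE)
      show "AE x in ?M. ennreal ((norm (\<B> x *v H x))\<^sup>2) \<le>
        ennreal (2 * (norm (\<B> x *v F x))\<^sup>2 + 2 * ((v x)\<^sup>2 * (norm (\<B> x *v grad \<psi> x))\<^sup>2))"
        using H_eq
      proof eventually_elim
        case (elim x)
        have \<psi>1: "(\<psi> x)\<^sup>2 \<le> 1" using \<psi>(2,3)[of x] by (simp add: power_le_one)
        have "\<B> x *v H x = \<psi> x *\<^sub>R (\<B> x *v F x) + (\<psi> x * v x) *\<^sub>R (\<B> x *v grad \<psi> x)"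
          unfolding elim by (simp add: matrix_vector_right_distrib matrix_vector_mult_scaleR)
        then have "(norm (\<B> x *v H x))\<^sup>2 \<le> 2 * (norm (\<psi> x *\<^sub>R (\<B> x *v F x)))\<^sup>2 + 2 *
          (norm ((\<psi> x * v x) *\<^sub>R (\<B> x *v grad \<psi> x)))\<^sup>2"
          using norm_diff_square_le[of "\<psi> x *\<^sub>R (\<B> x *v F x)"
            "- ((\<psi> x * v x) *\<^sub>R (\<B> x *v grad \<psi> x))"]
          by (simp only: diff_minus_eq_add norm_minus_cancel)
        also have "\<dots> = 2 * ((\<psi> x)\<^sup>2 * (norm (\<B> x *v F x))\<^sup>2) + 2 *
          ((\<psi> x)\<^sup>2 * ((v x)\<^sup>2 * (norm (\<B> x *v grad \<psi> x))\<^sup>2))"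
          by (simp add: power_mult_distrib)
        also have "\<dots> \<le> 2 * (1 * (norm (\<B> x *v F x))\<^sup>2) + 2 *
          (1 * ((v x)\<^sup>2 * (norm (\<B> x *v grad \<psi> x))\<^sup>2))"
          by (intro add_mono mult_left_mono mult_right_mono \<psi>1) auto
        finally show ?case by (intro ennreal_leI) simp
      qed
    qed
    also have "\<dots> =
      ennreal (LINT x|?M. 2 * (norm (\<B> x *v F x))\<^sup>2 + 2 * ((v x)\<^sup>2 * (norm (\<B> x *v grad \<psi> x))\<^sup>2))"
      by (intro nn_integral_eq_integral Bochner_Integration.integrable_add)
        (use int_BF int_j in auto)
    also have "(LINT x|?M. 2 * (norm (\<B> x *v F x))\<^sup>2 + 2 * ((v x)\<^sup>2 * (norm (\<B> x *v grad \<psi> x))\<^sup>2))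
      = 2 * I + 2 * j"
      unfolding I_def j_eq[symmetric]
        by (subst Bochner_Integration.integral_add) (use int_BF int_j in auto)
    finally show ?thesis using I0 j(2) by (subst (asm) ennreal_le_iff) auto
  qed
  have g_set: "{y\<in>D. g y \<noteq> 0} = {y\<in>D. \<psi> y * max (u y - P) 0 \<noteq> 0}" by (auto simp: g_def)
  note est = X_norm_estimate[OF D W X \<phi> gH(1) s(1)[folded g_set] s(2) i]
  have g0: "g x = 0" if "x \<notin> D" for x using out[OF that] by (simp add: g_def)
  have ind: "(\<lambda>x. indicat_real D x * (g x * \<phi> x)) = (\<lambda>x. indicat_real \<Omega> x * (\<phi> x * g x))"
    using g0 D(2) by (auto simp: indicator_def fun_eq_iff)
  have "integrable lebesgue (\<lambda>x. indicat_real D x * (g x * \<phi> x))"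
    using est(1) by (simp add: integrable_restrict_space)
  \<comment> \<open>\<open>weak_relation\<close> admits only tests with \<phi> g integrable over
    \<Omega>. Admissibility on \<open>D\<close> supplies this, since \<open>g\<close> vanishes
    outside \<open>D\<close>.\<close>
  then have int_g: "integrable ?M (\<lambda>x. \<phi> x * g x)"
    unfolding ind by (simp add: integrable_restrict_space)
  have "(LINT x|lebesgue_on D. g x * \<phi> x) = (LINT x|lebesgue. indicat_real D x * (g x * \<phi> x))"
    by (simp add: integral_restrict_space)
  then have LINT_g: "(LINT x|?M. \<phi> x * g x) = (LINT x|lebesgue_on D. g x * \<phi> x)"
    unfolding ind by (simp add: integral_restrict_space)
  have "(LINT x|?M. \<phi> x * g x) \<le> - (LINT x|?M. H x \<bullet> (A x *v G x))"
    by (rule sub[OF gH(2) _ int_g]) (simp add: g_def)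
  then have HG: "(LINT x|?M. H x \<bullet> (A x *v G x)) \<le> X * sqrt s * sqrt i"
    using est(2) unfolding LINT_g by linarith
  have "(LINT x|?M. H x \<bullet> (A x *v G x)) = (LINT x|?M. q x (F x) - (v x)\<^sup>2 * q x (grad \<psi> x))"
  proof (rule integral_cong_AE)
    have [measurable]: "(\<lambda>x. A x *v G x) \<in> borel_measurable ?M"
      by (rule borel_measurable_matrix_vector_mult[OF A_meas G_meas])
    show "(\<lambda>x. H x \<bullet> (A x *v G x)) \<in> borel_measurable ?M" by measurable
    show "AE x in ?M. H x \<bullet> (A x *v G x) = q x (F x) - (v x)\<^sup>2 * q x (grad \<psi> x)"
      using H_eq AE_space[of ?M]
    proof eventually_elim
      case (elim x)
      then have x: "x \<in> \<Omega>" by simp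
      let ?a = "grad \<psi> x" and ?b = "G x" and ?p = "\<psi> x" and ?v = "v x" and ?c = "pos x"
      define aa ab bb where "aa = ?a \<bullet> (A x *v ?a)" and "ab = ?a \<bullet> (A x *v ?b)"
        and "bb = ?b \<bullet> (A x *v ?b)"
      have ba: "?b \<bullet> (A x *v ?a) = ab" unfolding ab_def by (rule form_sym[OF x])
      have "H x = (2 * ?p * ?v) *\<^sub>R ?a + (?p\<^sup>2 * ?c) *\<^sub>R ?b"
        unfolding elim(1) F_eq by (simp add: vec_eq_iff) (simp add: algebra_simps power2_eq_square)
      then have 1: "H x \<bullet> (A x *v G x) = 2 * ?p * ?v * ab + ?p\<^sup>2 * ?c * bb"
        by (simp add: inner_add_left ab_def bb_def)
      have "q x (F x) = ?v\<^sup>2 * aa + 2 * ?p * (?v * ?c) * ab + ?p\<^sup>2 * (?c * ?c) * bb"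
        unfolding q_def F_eq
        by (simp add: matrix_vector_right_distrib matrix_vector_mult_scaleR inner_add_left
          inner_add_right
            ba aa_def[symmetric] ab_def[symmetric] bb_def[symmetric] power2_eq_square algebra_simps)
      then have 2: "q x (F x) = ?v\<^sup>2 * aa + 2 * ?p * ?v * ab + ?p\<^sup>2 * ?c * bb" by (simp only: vpos)
      show ?case unfolding 1 2 by (simp add: q_def aa_def)
    qed
  qed measurable
  also have "\<dots> = (LINT x|?M. q x (F x)) - (LINT x|?M. (v x)\<^sup>2 * q x (grad \<psi> x))"
    by (rule Bochner_Integration.integral_diff[OF int_qF int_q\<psi>])
  finally have "(LINT x|?M. H x \<bullet> (A x *v G x)) = \<dots>" .
  moreover have "(LINT x|?M. (v x)\<^sup>2 * q x (grad \<psi> x)) \<le> j / c\<^sub>A"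
    using q\<psi>_le c\<^sub>A by (simp add: pos_le_divide_eq mult.commute)
  ultimately have "(LINT x|?M. q x (F x)) \<le> X * sqrt s * sqrt i + j / c\<^sub>A"
    using HG by linarith
  then have "C\<^sub>A * (LINT x|?M. q x (F x)) \<le> C\<^sub>A * (X * sqrt s * sqrt i + j / c\<^sub>A)"
    using C\<^sub>A by (intro mult_left_mono) auto
  then have 1: "I \<le> C\<^sub>A * X * sqrt s * sqrt i + C\<^sub>A / c\<^sub>A * j"
    using BF_le unfolding I_def[symmetric] by (simp add: algebra_simps)
  \<comment> \<open>Young's inequality with weight 1/4 on \<open>i\<close>. Because i <= 2 I + 2 j,
    half of \<open>I\<close> appears on the right and is absorbed on the left; this is legitimate as
    \<open>I\<close> is a finite integral.\<close>
  have "0 \<le> (C\<^sub>A * X * sqrt s - sqrt i / 2)\<^sup>2" by simp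
  then have "C\<^sub>A * X * sqrt s * sqrt i \<le> (C\<^sub>A * X * sqrt s)\<^sup>2 + (sqrt i / 2)\<^sup>2"
    by (simp add: power2_diff)
  also have "\<dots> = C\<^sub>A\<^sup>2 * X\<^sup>2 * s + i / 4"
    using s(2) i(2) by (simp add: power_mult_distrib power_divide)
  finally have "I \<le> C\<^sub>A\<^sup>2 * X\<^sup>2 * s + i / 4 + C\<^sub>A / c\<^sub>A * j" using 1 by linarith
  then have 2: "I \<le> 2 * C\<^sub>A\<^sup>2 * X\<^sup>2 * s + j + 2 * (C\<^sub>A / c\<^sub>A) * j" using i_le by linarith
  have 3: "0 \<le> X\<^sup>2 * s" "0 \<le> C\<^sub>A\<^sup>2 * j" "0 \<le> C\<^sub>A / c\<^sub>A * (X\<^sup>2 * s)" using s j c\<^sub>A C\<^sub>A by auto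
  have "(1 + 2 * C\<^sub>A\<^sup>2 + 2 * C\<^sub>A / c\<^sub>A) * (X\<^sup>2 * s + j) =
    X\<^sup>2 * s + j + 2 * C\<^sub>A\<^sup>2 * X\<^sup>2 * s + 2 * (C\<^sub>A\<^sup>2 * j) + 2 * (C\<^sub>A / c\<^sub>A * (X\<^sup>2 * s)) + 2 *
      (C\<^sub>A / c\<^sub>A) * j"
    by (simp add: algebra_simps)
  then have "I \<le> (1 + 2 * C\<^sub>A\<^sup>2 + 2 * C\<^sub>A / c\<^sub>A) * (X\<^sup>2 * s + j)" using 2 3 by linarith
  moreover have "(\<integral>\<^sup>+x. ennreal ((norm (\<B> x *v F x))\<^sup>2) \<partial>?M) = ennreal I"
    unfolding I_def by (rule nn_integral_eq_integral[OF int_BF]) simp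
  ultimately show ?thesis by (simp add: ennreal_leI)
qed

end

section \<open>One step of the De Giorgi iteration\<close>

context degenerate
begin

lemma wmeas_eq_nn_integral:
  assumes "S \<in> sets lebesgue" "S \<subseteq> D" "D \<in> sets lebesgue"
  shows "wmeas w S = (\<integral>\<^sup>+x. ennreal (w x) * indicator S x \<partial>lebesgue_on D)"
proof -
  have "(\<integral>\<^sup>+x. ennreal (w x) * indicator S x \<partial>lebesgue_on D) =
    (\<integral>\<^sup>+x. ennreal (w x) * indicator S x * indicator D x \<partial>lebesgue)"
    using assms by (subst nn_integral_restrict_space) auto
  also have "\<dots> = (\<integral>\<^sup>+x. ennreal (w x) * indicator S x \<partial>lebesgue)"
    using assms(2) by (intro nn_integral_cong) (auto simp: indicator_def)
  also have "\<dots> = wmeas w S" using assms by (simp add: wmeas_def nn_integral_restrict_space)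
  finally show ?thesis by simp
qed

lemma wmeas_mono:
  assumes "S \<subseteq> D" "S \<in> sets lebesgue" "D \<in> sets lebesgue"
  shows "wmeas w S \<le> wmeas w D"
  unfolding wmeas_def by (rule nn_integral_lebesgue_on_mono_set[OF assms])

lemma level_set_lebesgue:
  assumes "f \<in> borel_measurable (lebesgue_on D)" "D \<in> sets lebesgue"
  shows "{y\<in>D. f y \<noteq> (0::real)} \<in> sets lebesgue"
proof -
  have "{y\<in>space (lebesgue_on D). f y \<noteq> 0} \<in> sets (lebesgue_on D)" using assms(1) by measurable
  then show ?thesis using assms(2) by (simp add: sets_restrict_space_iff)
qed

text \<open>The integral is split at v^2 = a^2 T. Small values are bounded by a^2 T times the
  measure of {v \<noteq> 0}; large values by the Orlicz gain 1/h.\<close>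

lemma W12A0_weighted_L2:
  assumes D: "open D" "D \<subseteq> \<Omega>" and W: "wmeas w D = ennreal W" "0 < W"
    and OS: "\<And>v. v \<in> Lip_c D \<Longrightarrow> orlicz_norm \<Psi> w D v \<le>
       ennreal \<kappa> / ennsqrt (wmeas w D) * L2_norm_on D (\<lambda>y. \<B> y *v grad v y)" and "0 < \<kappa>"
    and \<Psi>: "\<And>t. T < t\<^sup>2 \<Longrightarrow> h * t\<^sup>2 \<le> \<Psi> t" and T: "0 < T" and h: "0 < h"
    and vG: "W12A0 A D v G"
    and a: "0 < a"
      "ennreal (2 * \<kappa>\<^sup>2 / W) * (\<integral>\<^sup>+x. ennreal ((norm (\<B> x *v G x))\<^sup>2) \<partial>lebesgue_on D) <
      ennreal (a\<^sup>2)"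
  shows "(\<integral>\<^sup>+x. ennreal ((v x)\<^sup>2 * w x) \<partial>lebesgue_on D) \<le>
     ennreal (a\<^sup>2 * T) * wmeas w {y\<in>D. v y \<noteq> 0} + ennreal (a\<^sup>2 * W / h)"
proof -
  have D_leb[measurable]: "D \<in> sets lebesgue" using D(1) by auto
  have [measurable]: "v \<in> borel_measurable (lebesgue_on D)" "w \<in> borel_measurable (lebesgue_on D)"
    using vG w_measurable[OF D(2)] by (auto simp: W12A0_def sobolev_closure_def)
  let ?S = "{y\<in>D. v y \<noteq> 0}"
  have S: "?S \<in> sets lebesgue" by (rule level_set_lebesgue) measurable
  then have [measurable]: "?S \<in> sets (lebesgue_on D)" by (subst sets_restrict_space_iff) auto
  have "(\<integral>\<^sup>+x. ennreal ((v x)\<^sup>2 * w x) \<partial>lebesgue_on D) \<le>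
    (\<integral>\<^sup>+x. ennreal (a\<^sup>2 * T) * (ennreal (w x) * indicator ?S x) +
       ennreal ((if a\<^sup>2 * T < (v x)\<^sup>2 then (v x)\<^sup>2 else 0) * w x) \<partial>lebesgue_on D)"
  proof (rule nn_integral_mono)
    fix x assume "x \<in> space (lebesgue_on D)"
    then have x: "x \<in> D" by simp
    consider "w x \<le> 0" | "0 < w x" "a\<^sup>2 * T < (v x)\<^sup>2" | "0 < w x" "v x = 0" | "0 < w x" "v x \<noteq> 0"
      "(v x)\<^sup>2 \<le> a\<^sup>2 * T"
      by linarith
    then show "ennreal ((v x)\<^sup>2 * w x) \<le> ennreal (a\<^sup>2 * T) * (ennreal (w x) * indicator ?S x) +
       ennreal ((if a\<^sup>2 * T < (v x)\<^sup>2 then (v x)\<^sup>2 else 0) * w x)"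
    proof cases
      case 1
      then show ?thesis by (simp add: ennreal_neg mult_nonneg_nonpos)
    next
      case 4
      then have "(v x)\<^sup>2 * w x \<le> a\<^sup>2 * T * w x" by (intro mult_right_mono) auto
      then have "ennreal ((v x)\<^sup>2 * w x) \<le> ennreal (a\<^sup>2 * T) * ennreal (w x)"
        using 4 T by (subst ennreal_mult[symmetric]) (auto intro: ennreal_leI)
      then show ?thesis using x 4 by simp
    qed auto
  qed
  also have "\<dots> = ennreal (a\<^sup>2 * T) * wmeas w ?S +
     (\<integral>\<^sup>+x. ennreal ((if a\<^sup>2 * T < (v x)\<^sup>2 then (v x)\<^sup>2 else 0) * w x) \<partial>lebesgue_on D)"
    unfolding wmeas_eq_nn_integral[OF S _ D_leb, simplified]
    by (subst nn_integral_add) (auto simp: nn_integral_cmult)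
  also have "\<dots> \<le> ennreal (a\<^sup>2 * T) * wmeas w ?S + ennreal (a\<^sup>2 * W / h)"
    by (intro add_left_mono W12A0_orlicz_gain[OF D W OS \<open>0 < \<kappa>\<close> \<Psi> T h vG a])
  finally show ?thesis .
qed

text \<open>\<open>D\<close> is the fixed full ball, on which the Orlicz-Sobolev and admissibility
  inequalities are used; \<open>D1\<close> carries the cutoff function and the old truncation, and
  on \<open>D2\<close> the cutoff is 1. The bound for \<B> F from Caccioppoli, with both of its
  terms expressed through \<open>Y\<close>, yields \<open>asq\<close> as the admissible square of
  the Luxemburg parameter.\<close>

lemma De_Giorgi_step:
  assumes D: "open D" "D \<subseteq> \<Omega>" and W: "wmeas w D = ennreal W" "0 < W"
    and OS: "\<And>v. v \<in> Lip_c D \<Longrightarrow> orlicz_norm \<Psi> w D v \<le>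
       ennreal \<kappa> / ennsqrt (wmeas w D) * L2_norm_on D (\<lambda>y. \<B> y *v grad v y)" and \<kappa>: "0 < \<kappa>"
    and \<Psi>: "\<And>t. T < t\<^sup>2 \<Longrightarrow> h * t\<^sup>2 \<le> \<Psi> t" and T: "0 < T" and h: "0 < h"
    and X: "X_norm w A \<B> D \<phi> \<le> ennreal X" "0 \<le> X"
    and \<phi>: "\<phi> \<in> borel_measurable (lebesgue_on \<Omega>)"
    and uG: "W12A A \<Omega> u G"
    and sub: "\<And>g H. W12A0 A \<Omega> g H \<Longrightarrow> AE x in lebesgue_on \<Omega>. 0 \<le> g x \<Longrightarrow>
       integrable (lebesgue_on \<Omega>) (\<lambda>x. \<phi> x * g x) \<Longrightarrow>
       (LINT x|lebesgue_on \<Omega>. \<phi> x * g x) \<le> - (LINT x|lebesgue_on \<Omega>. H x \<bullet> (A x *v G x))"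
    and P: "AE x in lebesgue_on \<Omega>. u x \<noteq> P" and p: "p < P"
    and \<psi>: "\<psi> \<in> Lip_c D" "\<And>x. 0 \<le> \<psi> x" "\<And>x. \<psi> x \<le> 1"
    and D1: "open D1" "D1 \<subseteq> D" "\<And>x. x \<notin> D1 \<Longrightarrow> \<psi> x = 0" "\<And>x. x \<notin> D1 \<Longrightarrow> grad \<psi> x = 0"
    and D2: "open D2" "D2 \<subseteq> D" "\<And>x. x \<in> D2 \<Longrightarrow> \<psi> x = 1"
    and \<Lambda>: "AE x in lebesgue_on \<Omega>. (norm (\<B> x *v grad \<psi> x))\<^sup>2 \<le> \<Lambda>\<^sup>2 * w x" "0 < \<Lambda>"
    and Y: "(\<integral>\<^sup>+x. ennreal ((max (u x - p) 0)\<^sup>2 * w x) \<partial>lebesgue_on D1) \<le> ennreal Y" "0 < Y"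
  defines "asq \<equiv> 4 * \<kappa>\<^sup>2 / W * (1 + 2 * C\<^sub>A\<^sup>2 + 2 * C\<^sub>A / c\<^sub>A) * (X\<^sup>2 / (P - p)\<^sup>2 + \<Lambda>\<^sup>2) * Y"
  shows "(\<integral>\<^sup>+x. ennreal ((max (u x - P) 0)\<^sup>2 * w x) \<partial>lebesgue_on D2) \<le>
    ennreal (asq * T * (Y / (P - p)\<^sup>2) + asq * W / h)"
proof -
  define K where "K = 1 + 2 * C\<^sub>A\<^sup>2 + 2 * C\<^sub>A / c\<^sub>A"
  have K: "K > 0" using C\<^sub>A c\<^sub>A by (simp add: K_def add_pos_pos)
  have D_leb[measurable]: "D \<in> sets lebesgue" "D1 \<in> sets lebesgue" "D2 \<in> sets lebesgue"
    using D(1) D1(1) D2(1) by auto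
  have u_meas[measurable]: "u \<in> borel_measurable (lebesgue_on \<Omega>)" using uG
    by (auto simp: W12A_def sobolev_closure_def)
  have u_meas'[measurable]: "u \<in> borel_measurable (lebesgue_on D)"
    "u \<in> borel_measurable (lebesgue_on D1)"
    "w \<in> borel_measurable (lebesgue_on D)" "w \<in> borel_measurable (lebesgue_on D1)"
      "w \<in> borel_measurable (lebesgue_on \<Omega>)"
    using D(2) D1(2) by (auto intro!: measurable_restrict_mono[OF u_meas] w_measurable)
  obtain L where L: "L-lipschitz_on UNIV \<psi>" using \<psi>(1) by (rule Lip_c_lipschitz)
  have [measurable]: "\<psi> \<in> borel_measurable (lebesgue_on D)"
    by (rule measurable_lipschitz_lebesgue[OF L])
  define v where "v = (\<lambda>x. \<psi> x * max (u x - P) 0)"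
  define F where "F = (\<lambda>x. max (u x - P) 0 *\<^sub>R grad \<psi> x + (if P < u x then \<psi> x else 0) *\<^sub>R G x)"
  have vF: "W12A0 A D v F"
    unfolding v_def F_def by (rule W12A0_cutoff_truncation[OF uG D \<psi>(1) P])
  let ?S = "{y\<in>D. v y \<noteq> 0}"
  have S: "?S \<in> sets lebesgue" by (rule level_set_lebesgue) (auto simp: v_def)
  have S_D1: "?S \<subseteq> D1" using D1(3) by (auto simp: v_def)
  \<comment> \<open>Chebyshev: on this set u > P, so the truncation at the lower level p is at least
    P - p there.\<close>
  have S_le: "wmeas w ?S \<le> ennreal (Y / (P - p)\<^sup>2)"
  proof -
    have "wmeas w ?S = (\<integral>\<^sup>+x. ennreal (w x) * indicator ?S x \<partial>lebesgue_on D1)"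
      by (rule wmeas_eq_nn_integral[OF S S_D1]) measurable
    also have "\<dots> \<le>
      (\<integral>\<^sup>+x. ennreal (1 / (P - p)\<^sup>2) * ennreal ((max (u x - p) 0)\<^sup>2 * w x) \<partial>lebesgue_on D1)"
    proof (rule nn_integral_mono)
      fix x
      show "ennreal (w x) * indicator ?S x \<le> ennreal (1 / (P - p)\<^sup>2) *
        ennreal ((max (u x - p) 0)\<^sup>2 * w x)"
      proof (cases "x \<in> ?S \<and> 0 < w x")
        case True
        then have "P < u x" by (auto simp: v_def max_def split: if_splits)
        then have "(P - p)\<^sup>2 \<le> (max (u x - p) 0)\<^sup>2" using p by (intro power_mono) auto
        then have "1 \<le> 1 / (P - p)\<^sup>2 * (max (u x - p) 0)\<^sup>2" using p by (simp add: field_simps)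
        then have "1 * w x \<le> 1 / (P - p)\<^sup>2 * (max (u x - p) 0)\<^sup>2 * w x" using True
          by (intro mult_right_mono) auto
        then have "ennreal (w x) \<le> ennreal (1 / (P - p)\<^sup>2 * ((max (u x - p) 0)\<^sup>2 * w x))"
          by (intro ennreal_leI) (simp add: mult.assoc)
        also have "\<dots> = ennreal (1 / (P - p)\<^sup>2) * ennreal ((max (u x - p) 0)\<^sup>2 * w x)"
          using True by (intro ennreal_mult) auto
        finally show ?thesis using True by simp
      qed (auto simp: ennreal_neg indicator_def not_less)
    qed
    also have "\<dots> = ennreal (1 / (P - p)\<^sup>2) *
      (\<integral>\<^sup>+x. ennreal ((max (u x - p) 0)\<^sup>2 * w x) \<partial>lebesgue_on D1)"
      by (rule nn_integral_cmult) measurable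
    also have "\<dots> \<le> ennreal (1 / (P - p)\<^sup>2) * ennreal Y" by (rule mult_left_mono[OF Y(1)]) simp
    also have "\<dots> = ennreal (Y / (P - p)\<^sup>2)" using Y(2) by (subst ennreal_mult[symmetric]) auto
    finally show ?thesis .
  qed
  define s where "s = enn2real (wmeas w ?S)"
  have "wmeas w ?S < top" using S_le by (rule le_less_trans) simp
  then have s: "wmeas w ?S = ennreal s" "0 \<le> s" by (simp_all add: s_def)
  have s_le: "s \<le> Y / (P - p)\<^sup>2" using S_le Y(2) unfolding s(1) by (subst (asm) ennreal_le_iff) auto
  let ?J = "\<integral>\<^sup>+x. ennreal ((max (u x - P) 0)\<^sup>2 * (norm (\<B> x *v grad \<psi> x))\<^sup>2) \<partial>lebesgue_on \<Omega>"
  \<comment> \<open>The gradient of \<psi> lives on \<open>D1\<close> and its square is at most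
    \<Lambda>^2 w; raising the level from p to P only decreases the truncation.\<close>
  have J_le: "?J \<le> ennreal (\<Lambda>\<^sup>2 * Y)"
  proof -
    have "?J \<le> (\<integral>\<^sup>+x. ennreal (\<Lambda>\<^sup>2) *
      (ennreal ((max (u x - p) 0)\<^sup>2 * w x) * indicator D1 x) \<partial>lebesgue_on \<Omega>)"
    proof (rule nn_integral_mono_AE)
      show "AE x in lebesgue_on \<Omega>. ennreal ((max (u x - P) 0)\<^sup>2 * (norm (\<B> x *v grad \<psi> x))\<^sup>2) \<le>
         ennreal (\<Lambda>\<^sup>2) * (ennreal ((max (u x - p) 0)\<^sup>2 * w x) * indicator D1 x)"
        using \<Lambda>(1) w_pos
      proof eventually_elim
        case (elim x)
        show ?case
        proof (cases "x \<in> D1")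
          case True
          have "(max (u x - P) 0)\<^sup>2 * (norm (\<B> x *v grad \<psi> x))\<^sup>2 \<le> (max (u x - p) 0)\<^sup>2 *
            (\<Lambda>\<^sup>2 * w x)"
            using p by (intro mult_mono power_mono elim(1)) auto
          then have "ennreal ((max (u x - P) 0)\<^sup>2 * (norm (\<B> x *v grad \<psi> x))\<^sup>2) \<le>
            ennreal (\<Lambda>\<^sup>2 * ((max (u x - p) 0)\<^sup>2 * w x))"
            by (intro ennreal_leI) (simp add: mult.left_commute)
          also have "\<dots> = ennreal (\<Lambda>\<^sup>2) * ennreal ((max (u x - p) 0)\<^sup>2 * w x)" using elim(2)
            by (intro ennreal_mult) auto
          finally show ?thesis using True by simp
        qed (simp add: D1(4))
      qed
    qed
    also have "\<dots> = ennreal (\<Lambda>\<^sup>2) *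
      (\<integral>\<^sup>+x. ennreal ((max (u x - p) 0)\<^sup>2 * w x) * indicator D1 x \<partial>lebesgue_on \<Omega>)"
    proof (rule nn_integral_cmult)
      have [measurable]: "D1 \<in> sets (lebesgue_on \<Omega>)" using D1(2) D(2)
        by (subst sets_restrict_space_iff) auto
      show "(\<lambda>x. ennreal ((max (u x - p) 0)\<^sup>2 * w x) *
        indicator D1 x) \<in> borel_measurable (lebesgue_on \<Omega>)" by measurable
    qed
    also have "(\<integral>\<^sup>+x. ennreal ((max (u x - p) 0)\<^sup>2 * w x) * indicator D1 x \<partial>lebesgue_on \<Omega>) =
      (\<integral>\<^sup>+x. ennreal ((max (u x - p) 0)\<^sup>2 * w x) \<partial>lebesgue_on D1)"
      using subset_trans[OF D1(2) D(2)]
        by (subst (1 2) nn_integral_restrict_space)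
        (auto intro!: nn_integral_cong simp: indicator_def)
    also have "ennreal (\<Lambda>\<^sup>2) * \<dots> \<le> ennreal (\<Lambda>\<^sup>2) * ennreal Y" by (rule mult_left_mono[OF Y(1)]) simp
    also have "\<dots> = ennreal (\<Lambda>\<^sup>2 * Y)" using Y(2) by (subst ennreal_mult[symmetric]) auto
    finally show ?thesis .
  qed
  define j where "j = enn2real ?J"
  have "?J < top" using J_le by (rule le_less_trans) simp
  then have j: "?J = ennreal j" "0 \<le> j" by (simp_all add: j_def)
  have j_le: "j \<le> \<Lambda>\<^sup>2 * Y" using J_le Y(2) unfolding j(1) by (subst (asm) ennreal_le_iff) auto
  have W_fin: "wmeas w D < top" using W(1) by simp
  have "(\<integral>\<^sup>+x. ennreal ((norm (\<B> x *v F x))\<^sup>2) \<partial>lebesgue_on D) \<le>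
    (\<integral>\<^sup>+x. ennreal ((norm (\<B> x *v F x))\<^sup>2) \<partial>lebesgue_on \<Omega>)"
    by (rule nn_integral_lebesgue_on_mono_set[OF D(2)]) auto
  also have "\<dots> \<le> ennreal (K * (X\<^sup>2 * s + j))"
    unfolding F_def K_def by (rule Caccioppoli[OF D W_fin X \<phi> uG sub P \<psi> s[unfolded v_def] j])
  also have "\<dots> \<le> ennreal (K * ((X\<^sup>2 / (P - p)\<^sup>2 + \<Lambda>\<^sup>2) * Y))"
  proof (intro ennreal_leI mult_left_mono)
    have "X\<^sup>2 * s \<le> X\<^sup>2 * (Y / (P - p)\<^sup>2)" by (intro mult_left_mono s_le) auto
    then show "X\<^sup>2 * s + j \<le> (X\<^sup>2 / (P - p)\<^sup>2 + \<Lambda>\<^sup>2) * Y" using j_le by (simp add: distrib_right)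
  qed (use K in auto)
  finally have I_le:
    "(\<integral>\<^sup>+x. ennreal ((norm (\<B> x *v F x))\<^sup>2) \<partial>lebesgue_on D) \<le>
    ennreal (K * ((X\<^sup>2 / (P - p)\<^sup>2 + \<Lambda>\<^sup>2) * Y))" .
  have pos: "0 < (X\<^sup>2 / (P - p)\<^sup>2 + \<Lambda>\<^sup>2) * Y" using \<Lambda>(2) Y(2) p
    by (intro mult_pos_pos add_nonneg_pos) auto
  \<comment> \<open>An upper bound for the scaled energy; \<open>asq\<close> is twice this, to
    obtain the strict inequality that the Orlicz gain demands.\<close>
  define z where "z = 2 * \<kappa>\<^sup>2 / W * (K * ((X\<^sup>2 / (P - p)\<^sup>2 + \<Lambda>\<^sup>2) * Y))"
  have asq: "asq = 2 * z"
    unfolding asq_def K_def z_def by simp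
  have half: "0 < z" using \<kappa> W(2) K pos by (simp add: z_def)
  then have asq0: "0 < asq" unfolding asq by simp
  define a where "a = sqrt asq"
  have a: "0 < a" "a\<^sup>2 = asq" using asq0 by (auto simp: a_def)
  have "ennreal (2 * \<kappa>\<^sup>2 / W) * (\<integral>\<^sup>+x. ennreal ((norm (\<B> x *v F x))\<^sup>2) \<partial>lebesgue_on D) \<le>
    ennreal (2 * \<kappa>\<^sup>2 / W) * ennreal (K * ((X\<^sup>2 / (P - p)\<^sup>2 + \<Lambda>\<^sup>2) * Y))"
    by (rule mult_left_mono[OF I_le]) simp
  also have "\<dots> = ennreal z"
    using W(2) K pos unfolding z_def by (intro ennreal_mult[symmetric]) auto
  also have "\<dots> < ennreal (a\<^sup>2)"
    using half unfolding a(2) asq by (simp add: ennreal_less_iff)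
  finally have a3:
    "ennreal (2 * \<kappa>\<^sup>2 / W) * (\<integral>\<^sup>+x. ennreal ((norm (\<B> x *v F x))\<^sup>2) \<partial>lebesgue_on D) <
    ennreal (a\<^sup>2)" .
  have "(\<integral>\<^sup>+x. ennreal ((max (u x - P) 0)\<^sup>2 * w x) \<partial>lebesgue_on D2) =
    (\<integral>\<^sup>+x. ennreal ((v x)\<^sup>2 * w x) \<partial>lebesgue_on D2)"
    by (intro nn_integral_cong) (simp add: v_def D2(3))
  also have "\<dots> \<le> (\<integral>\<^sup>+x. ennreal ((v x)\<^sup>2 * w x) \<partial>lebesgue_on D)"
    by (rule nn_integral_lebesgue_on_mono_set[OF D2(2)]) auto
  also have "\<dots> \<le> ennreal (a\<^sup>2 * T) * wmeas w ?S + ennreal (a\<^sup>2 * W / h)"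
    by (rule W12A0_weighted_L2[OF D W OS \<kappa> \<Psi> T h vF a(1) a3])
  also have "\<dots> \<le> ennreal (a\<^sup>2 * T) * ennreal (Y / (P - p)\<^sup>2) + ennreal (a\<^sup>2 * W / h)"
    by (intro add_right_mono mult_left_mono S_le) auto
  also have "\<dots> = ennreal (asq * T * (Y / (P - p)\<^sup>2) + asq * W / h)"
    using asq0 T Y(2) W(2) h unfolding a(2) by (simp flip: ennreal_mult ennreal_plus)
  finally show ?thesis .
qed

text \<open>Membership in the Sobolev space bounds u only in unweighted L2. The Orlicz-Sobolev
  inequality applied to a cut-off truncation supplies the weighted square integrability; the part of
  u below \<open>P\<close> contributes at most a multiple of w(D2).\<close>

lemma weighted_L2_locally_finite:
  assumes D: "open D" "D \<subseteq> \<Omega>" and W: "wmeas w D = ennreal W" "0 < W"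
    and OS: "\<And>v. v \<in> Lip_c D \<Longrightarrow> orlicz_norm \<Psi> w D v \<le>
       ennreal \<kappa> / ennsqrt (wmeas w D) * L2_norm_on D (\<lambda>y. \<B> y *v grad v y)" and \<kappa>: "0 < \<kappa>"
    and \<Psi>: "\<And>t. T < t\<^sup>2 \<Longrightarrow> h * t\<^sup>2 \<le> \<Psi> t" and T: "0 < T" and h: "0 < h"
    and uG: "W12A A \<Omega> u G"
    and P: "AE x in lebesgue_on \<Omega>. u x \<noteq> P" "0 < P"
    and \<psi>: "\<psi> \<in> Lip_c D"
    and D2: "open D2" "D2 \<subseteq> D" "\<And>x. x \<in> D2 \<Longrightarrow> \<psi> x = 1"
  shows "(\<integral>\<^sup>+x. ennreal ((max (u x) 0)\<^sup>2 * w x) \<partial>lebesgue_on D2) < top"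
proof -
  have D_leb[measurable]: "D \<in> sets lebesgue" "D2 \<in> sets lebesgue" using D(1) D2(1) by auto
  have u_meas: "u \<in> borel_measurable (lebesgue_on \<Omega>)" using uG
    by (auto simp: W12A_def sobolev_closure_def)
  have [measurable]: "u \<in> borel_measurable (lebesgue_on D2)" "w \<in> borel_measurable (lebesgue_on D2)"
    "u \<in> borel_measurable (lebesgue_on D)"
    using D(2) D2(2) by (auto intro!: measurable_restrict_mono[OF u_meas] w_measurable)
  obtain L where L: "L-lipschitz_on UNIV \<psi>" using \<psi> by (rule Lip_c_lipschitz)
  have [measurable]: "\<psi> \<in> borel_measurable (lebesgue_on D)"
    by (rule measurable_lipschitz_lebesgue[OF L])
  define v where "v = (\<lambda>x. \<psi> x * max (u x - P) 0)"
  define F where "F = (\<lambda>x. max (u x - P) 0 *\<^sub>R grad \<psi> x + (if P < u x then \<psi> x else 0) *\<^sub>R G x)"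
  have vF: "W12A0 A D v F"
    unfolding v_def F_def by (rule W12A0_cutoff_truncation[OF uG D \<psi> P(1)])
  let ?I = "ennreal (2 * \<kappa>\<^sup>2 / W) * (\<integral>\<^sup>+x. ennreal ((norm (\<B> x *v F x))\<^sup>2) \<partial>lebesgue_on D)"
  define i where "i = enn2real ?I"
  have "?I < top" using W12A0_\<B>_finite[OF vF D(2)] by (simp add: ennreal_mult_less_top)
  then have i: "?I = ennreal i" "0 \<le> i" by (simp_all add: i_def)
  \<comment> \<open>Any finite \<open>a\<close> with a^2 > i will do, since only finiteness is
    claimed.\<close>
  define a where "a = sqrt (i + 1)"
  have a: "0 < a" "?I < ennreal (a\<^sup>2)" using i(2) unfolding i(1)
    by (auto simp: a_def ennreal_less_iff)
  have S: "{y\<in>D. v y \<noteq> 0} \<in> sets lebesgue" by (rule level_set_lebesgue) (auto simp: v_def)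
  have "(\<integral>\<^sup>+x. ennreal ((v x)\<^sup>2 * w x) \<partial>lebesgue_on D) \<le> ennreal (a\<^sup>2 * T) *
    wmeas w {y\<in>D. v y \<noteq> 0} + ennreal (a\<^sup>2 * W / h)"
    by (rule W12A0_weighted_L2[OF D W OS \<kappa> \<Psi> T h vF a])
  also have "\<dots> \<le> ennreal (a\<^sup>2 * T) * ennreal W + ennreal (a\<^sup>2 * W / h)"
    unfolding W(1)[symmetric] by (intro add_right_mono mult_left_mono wmeas_mono S) auto
  also have "\<dots> < top" by (simp add: ennreal_mult_less_top)
  finally have fin: "(\<integral>\<^sup>+x. ennreal ((v x)\<^sup>2 * w x) \<partial>lebesgue_on D) < top" .
  have "(\<integral>\<^sup>+x. ennreal ((max (u x) 0)\<^sup>2 * w x) \<partial>lebesgue_on D2) \<le>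
    (\<integral>\<^sup>+x. 2 * ennreal ((v x)\<^sup>2 * w x) + ennreal (2 * P\<^sup>2) * ennreal (w x) \<partial>lebesgue_on D2)"
  proof (rule nn_integral_mono)
    fix x assume "x \<in> space (lebesgue_on D2)"
    then have x: "\<psi> x = 1" using D2(3) by simp
    show "ennreal ((max (u x) 0)\<^sup>2 * w x) \<le> 2 * ennreal ((v x)\<^sup>2 * w x) + ennreal (2 * P\<^sup>2) *
      ennreal (w x)"
    proof (cases "0 \<le> w x")
      case True
      let ?m = "max (u x - P) 0"
      have "(max (u x) 0)\<^sup>2 \<le> (?m + P)\<^sup>2" using P(2) by (intro power_mono) auto
      also have "\<dots> \<le> 2 * ?m\<^sup>2 + 2 * P\<^sup>2"
        using zero_le_power2[of "?m - P"] unfolding power2_diff power2_sum by linarith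
      finally have "(max (u x) 0)\<^sup>2 * w x \<le> (2 * ?m\<^sup>2 + 2 * P\<^sup>2) * w x" using True
        by (rule mult_right_mono)
      then have "ennreal ((max (u x) 0)\<^sup>2 * w x) \<le> ennreal (2 * ((v x)\<^sup>2 * w x) + 2 * P\<^sup>2 * w x)"
        using x by (intro ennreal_leI) (simp add: v_def algebra_simps)
      also have "\<dots> = 2 * ennreal ((v x)\<^sup>2 * w x) + ennreal (2 * P\<^sup>2) * ennreal (w x)"
        using True by (simp add: ennreal_plus ennreal_mult)
      finally show ?thesis .
    qed (simp add: ennreal_neg mult_nonneg_nonpos)
  qed
  also have "\<dots> = 2 * (\<integral>\<^sup>+x. ennreal ((v x)\<^sup>2 * w x) \<partial>lebesgue_on D2) + ennreal (2 * P\<^sup>2) *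
    wmeas w D2"
  proof -
    have [measurable]: "v \<in> borel_measurable (lebesgue_on D2)"
      unfolding v_def using measurable_lipschitz_lebesgue[OF L, of D2] by measurable
    show ?thesis unfolding wmeas_def by (subst nn_integral_add) (auto simp: nn_integral_cmult)
  qed
  also have "\<dots> < top"
  proof -
    have "(\<integral>\<^sup>+x. ennreal ((v x)\<^sup>2 * w x) \<partial>lebesgue_on D2) \<le>
      (\<integral>\<^sup>+x. ennreal ((v x)\<^sup>2 * w x) \<partial>lebesgue_on D)"
      by (rule nn_integral_lebesgue_on_mono_set[OF D2(2)]) auto
    then have 1: "(\<integral>\<^sup>+x. ennreal ((v x)\<^sup>2 * w x) \<partial>lebesgue_on D2) < top" using fin
      by (rule le_less_trans)
    have "wmeas w D2 \<le> wmeas w D" by (rule wmeas_mono[OF D2(2)]) auto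
    then have "wmeas w D2 < top" using W(1) by (simp add: le_less_trans)
    with 1 show ?thesis by (simp add: ennreal_mult_less_top)
  qed
  finally show ?thesis .
qed

end

section \<open>Iterated logarithms and the choice of constants\<close>

lemma funpow_exp_ge: "x \<le> (exp ^^ n) (x::real)"
proof (induction n)
  case (Suc n)
  have "(exp ^^ n) x \<le> exp ((exp ^^ n) x)" using exp_ge_add_one_self[of "(exp ^^ n) x"] by linarith
  with Suc show ?case by simp
qed simp

lemma funpow_exp_mono: "x \<le> y \<Longrightarrow> (exp ^^ n) x \<le> (exp ^^ n) (y::real)"
  by (induction n) auto

text \<open>Moves the factor 4 of e^(4b) inside the iterated exponential, which is where the 4 in
  the second constant originates. It rests on 4 e^t <= e^(4t) for t >= 1.\<close>

lemma four_funpow_exp_le: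
  fixes x :: real
  assumes "1 \<le> x"
  shows "4 * (exp ^^ n) x \<le> (exp ^^ n) (4 * x)"
proof (induction n)
  case (Suc n)
  define t where "t = (exp ^^ n) x"
  have t: "1 \<le> t" using assms funpow_exp_ge[of x n] by (simp add: t_def)
  have "4 * exp t \<le> exp (3 * t) * exp t"
  proof (rule mult_right_mono)
    show "4 \<le> exp (3 * t)" using exp_ge_add_one_self[of "3 * t"] t by linarith
  qed simp
  also have "\<dots> = exp (4 * t)" by (simp flip: exp_add)
  also have "\<dots> \<le> exp ((exp ^^ n) (4 * x))" using Suc by (simp add: t_def)
  finally show ?case by (simp add: t_def)
qed simp

lemma funpow_ln_ge:
  fixes z :: real
  shows "(exp ^^ i) z \<le> x \<Longrightarrow> z \<le> (ln ^^ i) x"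
proof (induction i arbitrary: z)
  case (Suc i)
  have "(exp ^^ i) (exp z) \<le> x" using Suc.prems by (simp add: funpow_swap1)
  then have "exp z \<le> (ln ^^ i) x" by (rule Suc.IH)
  then show ?case by (simp add: ln_ge_iff less_le_trans[OF exp_gt_zero])
qed simp

text \<open>The lower bound by an iterated exponential keeps the inner logarithms positive, where
  \<open>ln\<close> is monotone.\<close>

lemma funpow_ln_mono:
  fixes z :: real
  shows "(exp ^^ i) z \<le> x \<Longrightarrow> x \<le> y \<Longrightarrow> (ln ^^ i) x \<le> (ln ^^ i) y"
proof (induction i arbitrary: z)
  case (Suc i)
  have *: "(exp ^^ i) (exp z) \<le> x" using Suc.prems by (simp add: funpow_swap1)
  then have "(ln ^^ i) x \<le> (ln ^^ i) y" using Suc by blast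
  moreover have "exp z \<le> (ln ^^ i) x" using * by (rule funpow_ln_ge)
  then have "0 < (ln ^^ i) x" using less_le_trans[OF exp_gt_zero] by blast
  ultimately show ?case by simp
qed simp

lemma funpow_exp_split: "i \<le> n \<Longrightarrow> (exp ^^ n) x = (exp ^^ i) ((exp ^^ (n - i)) (x::real))"
  by (metis comp_apply funpow_add le_add_diff_inverse)

lemma funpow_ln_ge_of_exp:
  fixes x :: real
  assumes "(exp ^^ n) z \<le> x" "i \<le> n"
  shows "z \<le> (ln ^^ i) x"
proof -
  have "(exp ^^ (n - i)) z \<le> (ln ^^ i) x"
    using assms by (intro funpow_ln_ge) (simp add: funpow_exp_split[symmetric])
  then show ?thesis using funpow_exp_ge[of z "n - i"] by linarith
qed

lemma funpow_ln_mono_of_exp: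
  fixes x :: real
  assumes "(exp ^^ n) z \<le> x" "x \<le> y" "i \<le> n"
  shows "(ln ^^ i) x \<le> (ln ^^ i) y"
  using assms
    by (intro funpow_ln_mono[of i "(exp ^^ (n - i)) z"]) (simp_all add: funpow_exp_split[symmetric])

lemma funpow_ln_le_self:
  fixes y :: real
  assumes "(exp ^^ n) 1 \<le> y" "i \<le> n"
  shows "(ln ^^ i) y \<le> y"
  using assms(2)
proof (induction i)
  case (Suc i)
  have "1 \<le> (ln ^^ i) y" using Suc.prems by (intro funpow_ln_ge_of_exp[OF assms(1)]) simp
  then have "ln ((ln ^^ i) y) \<le> (ln ^^ i) y - 1" by (intro ln_le_minus_one) simp
  with Suc show ?case by simp
qed simp

section \<open>The Orlicz gain and the cutoff loss in terms of iterated logarithms\<close>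

lemma E_const_ge: "2 * N \<le> E_const k N"
  by (simp add: E_const_def funpow_exp_ge)

text \<open>The quotient \<Phi>(t)/t^2 as a function of T = t^2, for T at least
  \<open>E_const\<close>; the function h of the overview.\<close>

definition Phi_gain :: "nat \<Rightarrow> real \<Rightarrow> real \<Rightarrow> real" where
  "Phi_gain k N T = (\<Prod>i\<in>{1..<k}. ((ln ^^ i) T)\<^sup>2) * ((ln ^^ k) T) powr (2 * N)"

lemma Phi_gain_pos:
  assumes "N > 1" "E_const k N \<le> T"
  shows "0 < Phi_gain k N T"
proof -
  have "0 < (ln ^^ i) T" if "i \<le> k" for i
    using funpow_ln_ge_of_exp[OF assms(2)[unfolded E_const_def] that] assms(1) by linarith
  then have "(ln ^^ i) T \<noteq> 0" if "i \<le> k" for i using that by fastforce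
  then show ?thesis unfolding Phi_gain_def
    by (auto intro!: mult_pos_pos prod_pos)
qed

lemma Phi_gain_le:
  assumes "N > 1" "E_const k N \<le> T" "T < t\<^sup>2"
  shows "Phi_gain k N T * t\<^sup>2 \<le> Phi k N t"
proof -
  have pos: "0 < (ln ^^ i) T" if "i \<le> k" for i
    using funpow_ln_ge_of_exp[OF assms(2)[unfolded E_const_def] that] assms(1) by linarith
  have mono: "(ln ^^ i) T \<le> (ln ^^ i) (t\<^sup>2)" if "i \<le> k" for i
    using funpow_ln_mono_of_exp[OF assms(2)[unfolded E_const_def] _ that] assms(3) by simp
  have "(\<Prod>i\<in>{1..<k}. ((ln ^^ i) T)\<^sup>2) \<le> (\<Prod>i\<in>{1..<k}. ((ln ^^ i) (t\<^sup>2))\<^sup>2)"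
    using mono pos by (intro prod_mono conjI power_mono) (auto intro: less_imp_le)
  moreover have "((ln ^^ k) T) powr (2 * N) \<le> ((ln ^^ k) (t\<^sup>2)) powr (2 * N)"
    using mono[of k] pos[of k] assms(1) by (intro powr_mono2) auto
  ultimately have
    "Phi_gain k N T \<le> (\<Prod>i\<in>{1..<k}. ((ln ^^ i) (t\<^sup>2))\<^sup>2) * ((ln ^^ k) (t\<^sup>2)) powr (2 * N)"
    unfolding Phi_gain_def by (intro mult_mono prod_nonneg) auto
  then have "Phi_gain k N T * t\<^sup>2 \<le> (\<Prod>i\<in>{1..<k}. ((ln ^^ i) (t\<^sup>2))\<^sup>2) *
    ((ln ^^ k) (t\<^sup>2)) powr (2 * N) * t\<^sup>2"
    by (intro mult_right_mono) auto
  also have "\<dots> = Phi k N t"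
    using assms(2,3) by (simp add: Phi_def Let_def max_absorb1)
  finally show ?thesis .
qed

lemma kappa_pos:
  assumes "N > 1" "j \<ge> 1"
  shows "0 < kappa k N j"
proof (cases "real j \<le> E_const k N")
  case False
  then have j: "(exp ^^ k) (2 * N) \<le> real j" by (simp add: E_const_def)
  have "0 < (ln ^^ i) (real j)" if "i \<le> k" for i
    using funpow_ln_ge_of_exp[OF j that] assms(1) by linarith
  note pos = this
  have "(ln ^^ (k - 1)) (real j) \<noteq> 0" using pos[of "k - 1"] by simp
  then show ?thesis using False pos unfolding kappa_def by (auto intro!: mult_pos_pos prod_pos)
qed (use assms in \<open>simp add: kappa_def\<close>)

text \<open>The two factors of \<open>kappa\<close> on its logarithmic branch are separated here and
  made functions of a real argument: this one also occurs, squared, in the gain at exp y and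
  cancels; the last logarithm \<open>iter_log\<close> decides the balance.\<close>

definition iter_log_prod :: "nat \<Rightarrow> real \<Rightarrow> real" where
  "iter_log_prod k y = (\<Prod>i<k-1. (ln ^^ i) y)"

definition iter_log :: "nat \<Rightarrow> real \<Rightarrow> real" where
  "iter_log k y = (ln ^^ (k-1)) y"

context
  fixes k :: nat and N y :: real
  assumes k: "k \<ge> 1" and N: "N > 1" and y: "(exp ^^ (k - 1)) 1 \<le> y"
begin

lemma iter_log_ge_1: "1 \<le> iter_log k y" "1 \<le> iter_log_prod k y"
  unfolding iter_log_def iter_log_prod_def
  by (auto intro!: funpow_ln_ge_of_exp[OF y] prod_ge_1)

lemma iter_log_le: "iter_log k y \<le> y" "iter_log_prod k y \<le> y ^ (k - 1)"
proof -
  show "iter_log k y \<le> y" unfolding iter_log_def by (rule funpow_ln_le_self[OF y]) simp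
  have "iter_log_prod k y \<le> (\<Prod>i<k-1. y)"
    unfolding iter_log_prod_def
    by (intro prod_mono conjI funpow_ln_le_self[OF y]
      order_trans[OF zero_le_one funpow_ln_ge_of_exp[OF y]]) auto
  then show "iter_log_prod k y \<le> y ^ (k - 1)" by simp
qed

text \<open>The product of all iterated logarithms of order 0 to k-1 contains y as its first factor,
  and the others are at least 1. For k = 1 the role of y is played by \<open>iter_log\<close>
  itself.\<close>

lemma le_iter_log_prod: "y \<le> iter_log_prod k y * iter_log k y powr ((N + 1) / 2)"
proof -
  have "y * 1 \<le> y * (\<Prod>i<k-1. (ln ^^ Suc i) y)"
  proof (rule mult_left_mono)
    show "1 \<le> (\<Prod>i<k-1. (ln ^^ Suc i) y)" by (intro prod_ge_1 funpow_ln_ge_of_exp[OF y]) auto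
    show "0 \<le> y" using y funpow_exp_ge[of 1 "k - 1"] by linarith
  qed
  also have "\<dots> = (\<Prod>i<Suc (k-1). (ln ^^ i) y)" by (subst prod.lessThan_Suc_shift) simp
  also have "\<dots> = iter_log_prod k y * iter_log k y powr 1"
    using iter_log_ge_1 by (simp add: iter_log_prod_def iter_log_def)
  also have "\<dots> \<le> iter_log_prod k y * iter_log k y powr ((N + 1) / 2)"
    using iter_log_ge_1 N by (intro mult_left_mono powr_mono) auto
  finally show ?thesis by simp
qed

text \<open>On the quadratic branch j^2 is at most the square of \<open>E_const\<close>, hence at
  most y; on the logarithmic branch every factor is monotone.\<close>

lemma kappa_le:
  assumes "real j \<le> y" "(E_const k N)\<^sup>2 \<le> y"
  shows "kappa k N j \<le> iter_log_prod k y * iter_log k y powr ((N + 1) / 2)"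
proof (cases "real j \<le> E_const k N")
  case True
  then have "kappa k N j = (real j)\<^sup>2" by (simp add: kappa_def)
  also have "\<dots> \<le> (E_const k N)\<^sup>2" using True by (intro power_mono) auto
  also have "\<dots> \<le> y" by fact
  finally show ?thesis using le_iter_log_prod by linarith
next
  case False
  then have j: "(exp ^^ k) (2 * N) \<le> real j" by (simp add: E_const_def)
  have pos: "0 < (ln ^^ i) (real j)" if "i \<le> k" for i
    using funpow_ln_ge_of_exp[OF j that] N by linarith
  have mono: "(ln ^^ i) (real j) \<le> (ln ^^ i) y" if "i \<le> k" for i
    using funpow_ln_mono_of_exp[OF j assms(1) that] .
  have "(\<Prod>i<k-1. (ln ^^ i) (real j)) \<le> iter_log_prod k y"
    unfolding iter_log_prod_def using pos mono by (intro prod_mono) (auto intro: less_imp_le)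
  moreover have "((ln ^^ (k-1)) (real j)) powr ((N + 1) / 2) \<le> iter_log k y powr ((N + 1) / 2)"
    unfolding iter_log_def using pos[of "k-1"] mono[of "k-1"] N by (intro powr_mono2) auto
  ultimately show ?thesis using False iter_log_ge_1 unfolding kappa_def by (auto intro!: mult_mono)
qed

lemma Phi_gain_exp: "Phi_gain k N (exp y) = (iter_log_prod k y)\<^sup>2 * iter_log k y powr (2 * N)"
proof -
  obtain k' where k': "k = Suc k'" using k by (cases k) auto
  have ln_exp: "(ln ^^ Suc i) (exp y) = (ln ^^ i) y" for i by (simp add: funpow_swap1)
  have "(\<Prod>i\<in>{1..<k}. ((ln ^^ i) (exp y))\<^sup>2) = (\<Prod>i\<in>{0..<k'}. ((ln ^^ Suc i) (exp y))\<^sup>2)"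
    unfolding k' One_nat_def by (rule prod.shift_bounds_Suc_ivl)
  also have "\<dots> = (iter_log_prod k y)\<^sup>2"
  proof -
    have "iter_log_prod k y = (\<Prod>i\<in>{0..<k'}. (ln ^^ i) y)"
      unfolding iter_log_prod_def by (simp add: k' lessThan_atLeast0)
    then show ?thesis unfolding ln_exp by (simp add: prod_power_distrib)
  qed
  finally have "(\<Prod>i\<in>{1..<k}. ((ln ^^ i) (exp y))\<^sup>2) = (iter_log_prod k y)\<^sup>2" .
  moreover have "(ln ^^ k) (exp y) = iter_log k y"
    unfolding iter_log_def by (simp only: k' ln_exp diff_Suc_1)
  ultimately show ?thesis unfolding Phi_gain_def by simp
qed

text \<open>The squared products cancel, and the exponents leave (N + 1) - 2 N = 1 - N.\<close>

lemma kappa_square_le_gain: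
  assumes "0 \<le> \<kappa>" "\<kappa> \<le> iter_log_prod k y * iter_log k y powr ((N + 1) / 2)"
  shows "\<kappa>\<^sup>2 / Phi_gain k N (exp y) \<le> iter_log k y powr (1 - N)"
proof -
  have "\<kappa>\<^sup>2 \<le> (iter_log_prod k y * iter_log k y powr ((N + 1) / 2))\<^sup>2" using assms
    by (intro power_mono)
  also have "\<dots> = (iter_log_prod k y)\<^sup>2 * iter_log k y powr (N + 1)"
    by (simp add: power_mult_distrib) (simp add: power2_eq_square flip: powr_add)
  also have "\<dots> = (iter_log_prod k y)\<^sup>2 * (iter_log k y powr (2 * N) * iter_log k y powr (1 - N))"
    by (simp flip: powr_add)
  finally show ?thesis
    unfolding Phi_gain_exp using iter_log_ge_1 by (simp add: pos_divide_le_eq mult_ac)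
qed

end

lemma powr_le_exp:
  fixes m :: real
  shows "\<exists>C>0. \<forall>y\<ge>1. y powr m \<le> C * exp y"
proof -
  obtain n :: nat where n: "m \<le> real n" "n > 0" using real_arch_simple[of "max m 1"]
    by (metis max.bounded_iff of_nat_0_less_iff less_le_trans zero_less_one)
  have "y powr m \<le> real n ^ n * exp y" if "y \<ge> 1" for y
  proof -
    have "y powr m \<le> y powr real n" using that n by (intro powr_mono) auto
    also have "\<dots> = y ^ n" using that by (simp add: powr_realpow)
    also have "\<dots> = real n ^ n * (y / n) ^ n" using n by (simp add: power_divide)
    also have "\<dots> \<le> real n ^ n * exp (y / n) ^ n"
    proof (intro mult_left_mono power_mono)
      show "y / n \<le> exp (y / n)" using exp_ge_add_one_self[of "y / n"] by linarith
    qed (use that in auto)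
    also have "exp (y / n) ^ n = exp y" using n by (simp flip: exp_of_nat_mult)
    finally show ?thesis .
  qed
  then show ?thesis using n by (intro exI[of _ "real n ^ n"]) auto
qed

text \<open>Here s stands for \<sigma>(r)/r. Both terms of the bracket, after multiplication by the
  square of \<open>kappa\<close>, are bounded by a constant times L^(1-N) with L =
  \<open>iter_log k y\<close>: the second by cancellation, the first because e^(-3y) beats powers.
  As L is at least K s^(2/(N-1)) with K the constant to be found, s^2 L^(1-N) becomes small
  uniformly in s and j.\<close>

lemma iteration_constant:
  assumes k: "k \<ge> 1" and N: "N > 1" and K: "0 < K" and c: "0 < c"
  shows "\<exists>K\<^sub>3\<ge>1. \<forall>s\<ge>1. \<forall>j\<ge>1. \<forall>y. y = (exp ^^ (k-1)) (K\<^sub>3 * s powr (2 / (N - 1))) + real j \<longrightarrow>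
    E_const k N \<le> exp y \<and>
    K * s\<^sup>2 * (kappa k N j)\<^sup>2 *
      (exp (- 3 * y) * (kappa k N j)\<^sup>2 / (4 * c\<^sup>2) + 1 / Phi_gain k N (exp y)) \<le> exp (- 4)"
proof -
  \<comment> \<open>The power of y left once L^(1-N) is split off the fourth power of
    \<open>kappa\<close>: the lower logarithms give 4(k-1), and 2(N+1) = (3N+1) + (1-N).\<close>
  define m where "m = real (4 * (k - 1)) + (3 * N + 1)"
  obtain C where C: "C > 0" "\<And>y. y \<ge> 1 \<Longrightarrow> y powr m \<le> C * exp y" using powr_le_exp[of m] by blast
  define D where "D = exp 4 * K * (C / (4 * c\<^sup>2) + 1)"
  have D: "D > 0" using K C c by (simp add: D_def add_pos_pos)
  define E where "E = E_const k N"
  have E: "E \<ge> 2" using E_const_ge[of N k] N by (simp add: E_def)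
  \<comment> \<open>The first entry puts y above the square of \<open>E_const\<close>, as the
    quadratic branch of \<open>kappa\<close> requires; the second is the root of \<open>D\<close>
    that makes D s^2 L^(1-N) at most 1.\<close>
  define K\<^sub>3 where "K\<^sub>3 = max (E\<^sup>2) (D powr (1 / (N - 1)))"
  have "E \<le> E\<^sup>2" using E by (simp add: power2_eq_square)
  then have K3: "K\<^sub>3 \<ge> E\<^sup>2" "K\<^sub>3 \<ge> E" "K\<^sub>3 \<ge> D powr (1 / (N - 1))" "K\<^sub>3 \<ge> 1" using E
    by (auto simp: K\<^sub>3_def)
  have "E_const k N \<le> exp y \<and>
    K * s\<^sup>2 * (kappa k N j)\<^sup>2 *
      (exp (- 3 * y) * (kappa k N j)\<^sup>2 / (4 * c\<^sup>2) + 1 / Phi_gain k N (exp y)) \<le> exp (- 4)"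
    if s: "s \<ge> 1" and j: "j \<ge> 1"
      and y_eq: "y = (exp ^^ (k-1)) (K\<^sub>3 * s powr (2 / (N - 1))) + real j" for s y :: real
      and j :: nat
  proof
    define z where "z = K\<^sub>3 * s powr (2 / (N - 1))"
    have "s powr (2 / (N - 1)) \<ge> 1" using s N by (intro ge_one_powr_ge_zero) auto
    then have "K\<^sub>3 * 1 \<le> z" unfolding z_def using K3 by (intro mult_left_mono) auto
    then have z: "K\<^sub>3 \<le> z" by simp
    have yz: "(exp ^^ (k-1)) z \<le> y" using y_eq by (simp add: z_def)
    then have zy: "z \<le> y" using funpow_exp_ge[of z "k-1"] by linarith
    have y1: "(exp ^^ (k-1)) 1 \<le> y" using funpow_exp_mono[of 1 z "k-1"] z K3 yz by linarith
    have jy: "real j \<le> y" using y_eq funpow_exp_ge[of z "k-1"] z K3 unfolding z_def by linarith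
    have y_ge1: "1 \<le> y" using zy z K3 by linarith
    show "E_const k N \<le> exp y"
      using zy z K3 exp_ge_add_one_self[of y] unfolding E_def by linarith
    note kappa_le = kappa_le[OF k N y1 jy] and p = iter_log_ge_1[OF k N y1] iter_log_le[OF k N y1]
    define pr q \<kappa> where "pr = iter_log_prod k y" and "q = iter_log k y" and "\<kappa> = kappa k N j"
    have pq: "1 \<le> q" "1 \<le> pr" "q \<le> y" "pr \<le> y ^ (k - 1)" using p by (auto simp: pr_def q_def)
    have \<kappa>: "0 \<le> \<kappa>" "\<kappa> \<le> pr * q powr ((N + 1) / 2)"
      using kappa_pos[OF N j, of k] kappa_le z zy K3 by (auto simp: \<kappa>_def pr_def q_def E_def)
    have 1: "\<kappa>\<^sup>2 / Phi_gain k N (exp y) \<le> q powr (1 - N)"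
      unfolding q_def by (rule kappa_square_le_gain[OF k N y1 \<kappa>[unfolded pr_def q_def]])
    \<comment> \<open>The first term carries the fourth power of \<open>kappa\<close>, for which
      there is no cancellation with the gain. The logarithms are replaced by y, except for the
      factor L^(1-N) that is to be kept.\<close>
    have "\<kappa>\<^sup>2 * \<kappa>\<^sup>2 = \<kappa> ^ 4" by (simp flip: power_add)
    also have "\<dots> \<le> (pr * q powr ((N + 1) / 2)) ^ 4" using \<kappa> by (intro power_mono) auto
    also have "\<dots> = pr ^ 4 * q powr (2 * (N + 1))" using pq
      by (simp add: power_mult_distrib powr_power add_divide_distrib add.commute)
    also have "\<dots> = pr ^ 4 * q powr (3 * N + 1) * q powr (1 - N)"
      by (simp add: mult.assoc add.commute flip: powr_add)
    also have "pr ^ 4 * q powr (3 * N + 1) \<le> (y ^ (k - 1)) ^ 4 * y powr (3 * N + 1)"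
      using pq N by (intro mult_mono power_mono powr_mono2) auto
    also have "(y ^ (k - 1)) ^ 4 * y powr (3 * N + 1) = y powr m"
    proof -
      have "(y ^ (k - 1)) ^ 4 = y powr real (4 * (k - 1))"
        using y_ge1 by (subst powr_realpow) (simp_all flip: power_mult add: mult.commute)
      then show ?thesis by (simp only: m_def powr_add)
    qed
    also have "y powr m \<le> C * exp y" using C(2)[OF y_ge1] .
    finally have "\<kappa>\<^sup>2 * \<kappa>\<^sup>2 \<le> C * exp y * q powr (1 - N)" by (simp add: mult_right_mono)
    then have "exp (- 3 * y) * (\<kappa>\<^sup>2 * \<kappa>\<^sup>2) \<le> exp (- 3 * y) * (C * exp y * q powr (1 - N))"
      by (rule mult_left_mono) simp
    also have "\<dots> = exp (- 2 * y) * (C * q powr (1 - N))" by (simp add: mult_ac flip: exp_add)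
    also have "\<dots> \<le> 1 * (C * q powr (1 - N))" using C(1) y_ge1 by (intro mult_right_mono) auto
    finally have "exp (- 3 * y) * (\<kappa>\<^sup>2 * \<kappa>\<^sup>2) / (4 * c\<^sup>2) \<le> C * q powr (1 - N) / (4 * c\<^sup>2)"
      using c by (intro divide_right_mono) auto
    then have "exp (- 3 * y) * (\<kappa>\<^sup>2 * \<kappa>\<^sup>2) / (4 * c\<^sup>2) + \<kappa>\<^sup>2 / Phi_gain k N (exp y) \<le>
      (C / (4 * c\<^sup>2) + 1) * q powr (1 - N)"
      using 1 by (simp add: distrib_right)
    then have "K * s\<^sup>2 * (exp (- 3 * y) * (\<kappa>\<^sup>2 * \<kappa>\<^sup>2) / (4 * c\<^sup>2) + \<kappa>\<^sup>2 / Phi_gain k N (exp y)) \<le>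
      K * s\<^sup>2 * ((C / (4 * c\<^sup>2) + 1) * q powr (1 - N))" using K by (intro mult_left_mono) auto
    also have "\<dots> = exp (- 4) * (D * s\<^sup>2 * q powr (1 - N))"
      by (simp add: D_def exp_minus mult_ac)
    also have "D * s\<^sup>2 * q powr (1 - N) \<le> 1"
    proof -
      have "z \<le> q" unfolding q_def iter_log_def by (rule funpow_ln_ge_of_exp[OF yz]) simp
      then have "z powr (N - 1) \<le> q powr (N - 1)" using z K3 N by (intro powr_mono2) auto
      moreover have "D * s\<^sup>2 \<le> z powr (N - 1)"
      proof -
        have "2 / (N - 1) * (N - 1) = 2" using N by (simp add: field_simps)
        then have "(s powr (2 / (N - 1))) powr (N - 1) = s powr 2" by (simp only: powr_powr)
        then have "z powr (N - 1) = K\<^sub>3 powr (N - 1) * s powr 2"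
          unfolding z_def using K3 s by (subst powr_mult) auto
        moreover have "D = (D powr (1 / (N - 1))) powr (N - 1)" using D N by (simp add: powr_powr)
        moreover have "(D powr (1 / (N - 1))) powr (N - 1) \<le> K\<^sub>3 powr (N - 1)" using K3 N
          by (intro powr_mono2) auto
        ultimately show ?thesis using s by (simp add: mult_right_mono)
      qed
      ultimately have "D * s\<^sup>2 \<le> q powr (N - 1)" by linarith
      then have "D * s\<^sup>2 * q powr (1 - N) \<le> q powr (N - 1) * q powr (1 - N)"
        by (rule mult_right_mono) simp
      also have "\<dots> = 1" using pq by (simp flip: powr_add)
      finally show ?thesis .
    qed
    finally have
      "K * s\<^sup>2 * (exp (- 3 * y) * (\<kappa>\<^sup>2 * \<kappa>\<^sup>2) / (4 * c\<^sup>2) + \<kappa>\<^sup>2 / Phi_gain k N (exp y)) \<le>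
      exp (- 4)" by simp
    moreover have "K * s\<^sup>2 * \<kappa>\<^sup>2 * (exp (- 3 * y) * \<kappa>\<^sup>2 / (4 * c\<^sup>2) + 1 / Phi_gain k N (exp y)) =
      K * s\<^sup>2 * (exp (- 3 * y) * (\<kappa>\<^sup>2 * \<kappa>\<^sup>2) / (4 * c\<^sup>2) + \<kappa>\<^sup>2 / Phi_gain k N (exp y))"
      by (simp add: algebra_simps)
    ultimately show
      "K * s\<^sup>2 * (kappa k N j)\<^sup>2 *
      (exp (- 3 * y) * (kappa k N j)\<^sup>2 / (4 * c\<^sup>2) + 1 / Phi_gain k N (exp y)) \<le> exp (- 4)"
      by (simp only: \<kappa>_def)
  qed
  then show ?thesis using K3(4) by blast
qed

section \<open>The De Giorgi iteration\<close>

text \<open>Brings an adapted cutoff function into the form used in a De Giorgi step: values in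
  [0,1], compact support (closed and inside the bounded set \<Omega>), and the essential bound
  restated as a pointwise inequality for squares, using w > 0.\<close>

lemma (in degenerate) clamped_cutoff:
  assumes L: "L-lipschitz_on UNIV \<psi>" and S1: "closure {y. \<psi> y \<noteq> 0} \<subseteq> S1" "S1 \<subseteq> D" "D \<subseteq> \<Omega>"
    and S2: "\<And>y. y \<in> S2 \<Longrightarrow> \<psi> y = 1"
    and \<Lambda>: "Linf_norm \<Omega> (\<lambda>y. norm (\<B> y *v grad \<psi> y) / sqrt (w y)) \<le> ennreal \<Lambda>" "0 \<le> \<Lambda>"
  obtains \<eta> where "\<eta> \<in> Lip_c D" "\<And>x. 0 \<le> \<eta> x" "\<And>x. \<eta> x \<le> 1"
    "\<And>x. x \<notin> S1 \<Longrightarrow> \<eta> x = 0" "\<And>x. x \<notin> S1 \<Longrightarrow> grad \<eta> x = 0" "\<And>x. x \<in> S2 \<Longrightarrow> \<eta> x = 1"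
    "AE x in lebesgue_on \<Omega>. (norm (\<B> x *v grad \<eta> x))\<^sup>2 \<le> \<Lambda>\<^sup>2 * w x"
proof -
  define \<eta> where "\<eta> = (\<lambda>x. max 0 (min 1 (\<psi> x)))"
  have supp: "closure {x. \<eta> x \<noteq> 0} \<subseteq> closure {y. \<psi> y \<noteq> 0}"
    by (intro closure_mono) (auto simp: \<eta>_def)
  have "L-lipschitz_on UNIV \<eta>"
  proof (rule lipschitz_onI)
    show "0 \<le> L" using L lipschitz_on_nonneg by blast
    fix x y
    have "dist (\<psi> x) (\<psi> y) \<le> L * dist x y" using L by (rule lipschitz_onD) auto
    then show "dist (\<eta> x) (\<eta> y) \<le> L * dist x y"
      by (auto simp: dist_real_def \<eta>_def max_def min_def)
  qed
  moreover have "compact (closure {x. \<eta> x \<noteq> 0})"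
  proof -
    have "bounded (closure {x. \<eta> x \<noteq> 0})"
      using supp S1 by (intro bounded_subset[OF bounded_\<Omega>]) auto
    then show ?thesis by (simp add: compact_eq_bounded_closed)
  qed
  ultimately have 1: "\<eta> \<in> Lip_c D" using supp S1 by (auto simp: Lip_c_def)
  have out: "x \<notin> closure {x. \<eta> x \<noteq> 0}" if "x \<notin> S1" for x using that supp S1 by auto
  have cont: "isCont \<psi> x" for x
    using lipschitz_on_continuous_on[OF L] continuous_on_eq_continuous_at[OF open_UNIV] by blast
  have grad_le: "norm (\<B> x *v grad \<eta> x) \<le> norm (\<B> x *v grad \<psi> x)" for x
    using grad_clamp[OF cont, of x] unfolding \<eta>_def by auto
  have "AE x in lebesgue_on \<Omega>. ennreal \<bar>norm (\<B> x *v grad \<psi> x) / sqrt (w x)\<bar> \<le> ennreal \<Lambda>"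
    using esssup_AE[of "\<lambda>x. ennreal \<bar>norm (\<B> x *v grad \<psi> x) / sqrt (w x)\<bar>" "lebesgue_on \<Omega>"] \<Lambda>(1)
    unfolding Linf_norm_def by (auto elim!: eventually_mono intro: order_trans)
  then have AE: "AE x in lebesgue_on \<Omega>. (norm (\<B> x *v grad \<eta> x))\<^sup>2 \<le> \<Lambda>\<^sup>2 * w x"
    using w_pos
  proof eventually_elim
    case (elim x)
    have "norm (\<B> x *v grad \<psi> x) / sqrt (w x) \<le> \<Lambda>"
      using elim \<Lambda>(2) by (simp add: ennreal_le_iff)
    then have "norm (\<B> x *v grad \<psi> x) \<le> \<Lambda> * sqrt (w x)" using elim by (simp add: pos_divide_le_eq)
    then have "norm (\<B> x *v grad \<eta> x) \<le> \<Lambda> * sqrt (w x)" using grad_le[of x] by linarith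
    then have "(norm (\<B> x *v grad \<eta> x))\<^sup>2 \<le> (\<Lambda> * sqrt (w x))\<^sup>2" by (intro power_mono) auto
    then show ?case using elim by (simp add: power_mult_distrib)
  qed
  show thesis
  proof (rule that[OF 1 _ _ _ _ _ AE])
    show "\<eta> x = 0" if "x \<notin> S1" for x using out[OF that] closure_subset[of "{x. \<eta> x \<noteq> 0}"] by auto
    show "grad \<eta> x = 0" if "x \<notin> S1" for x by (rule grad_eq_0_outside_support[OF out[OF that]])
    show "\<eta> x = 1" if "x \<in> S2" for x using S2[OF that] by (simp add: \<eta>_def)
  qed (auto simp: \<eta>_def)
qed

text \<open>The metric enters only through the nested open sets \<open>S j\<close>, whose common
  part contains \<open>H\<close>; \<open>t j\<close> is the relative height of the levels, 0 at the
  start and at most 1. All inequalities are used on the full set \<open>D\<close>, so W and X stay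
  the same from step to step.\<close>

lemma (in degenerate) De_Giorgi_iteration:
  fixes S :: "nat \<Rightarrow> (real ^ 'n) set" and t :: "nat \<Rightarrow> real" and k :: nat
  assumes S: "\<And>j. j \<ge> 1 \<Longrightarrow> open (S j)" "\<And>j. j \<ge> 1 \<Longrightarrow> S j \<subseteq> D" "S 1 = D" "D \<subseteq> \<Omega>"
    and H: "open H" "\<And>j. j \<ge> 1 \<Longrightarrow> H \<subseteq> S j"
    and W: "wmeas w D = ennreal W" "0 < W"
    and OS: "\<And>v. v \<in> Lip_c D \<Longrightarrow> orlicz_norm (Phi k N) w D v \<le>
       ennreal (C\<^sub>S * \<sigma>) / ennsqrt (wmeas w D) * L2_norm_on D (\<lambda>y. \<B> y *v grad v y)"
    and pos: "0 < C\<^sub>S" "0 < \<sigma>" "0 < C\<^sub>\<psi>" "0 < r" "r \<le> R" "0 < c" "1 < N"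
    and X: "X_norm w A \<B> D \<phi> \<le> ennreal X" "0 \<le> X" "X \<le> M" "0 < M"
    and \<phi>: "\<phi> \<in> borel_measurable (lebesgue_on \<Omega>)"
    and uG: "W12A A \<Omega> u G"
    and sub: "\<And>g H. W12A0 A \<Omega> g H \<Longrightarrow> AE x in lebesgue_on \<Omega>. 0 \<le> g x \<Longrightarrow>
       integrable (lebesgue_on \<Omega>) (\<lambda>x. \<phi> x * g x) \<Longrightarrow>
       (LINT x|lebesgue_on \<Omega>. \<phi> x * g x) \<le> - (LINT x|lebesgue_on \<Omega>. H x \<bullet> (A x *v G x))"
    and t: "t 1 = 0" "\<And>j. j \<ge> 1 \<Longrightarrow> t (Suc j) - t j = 2 * c / kappa k N j" "\<And>j. j \<ge> 1 \<Longrightarrow> t j \<le> 1"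
    and generic: "\<And>j. j \<ge> 2 \<Longrightarrow> AE x in lebesgue_on \<Omega>. u x \<noteq> M * t j"
    and \<psi>: "\<And>j. j \<ge> 1 \<Longrightarrow> \<exists>L. L-lipschitz_on UNIV (\<psi> j)" "\<And>j. j \<ge> 1 \<Longrightarrow> closure {y. \<psi> j y \<noteq> 0} \<subseteq> S j"
      "\<And>j y. j \<ge> 1 \<Longrightarrow> y \<in> S (Suc j) \<Longrightarrow> \<psi> j y = 1"
      "\<And>j. j \<ge> 1 \<Longrightarrow> Linf_norm \<Omega> (\<lambda>y. norm (\<B> y *v grad (\<psi> j) y) / sqrt (w y)) \<le>
        ennreal (C\<^sub>\<psi> * kappa k N j / r)"
    and U1: "(\<integral>\<^sup>+x. ennreal ((max (u x) 0)\<^sup>2 * w x) \<partial>lebesgue_on D) \<le>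
      ennreal (W * M\<^sup>2 * exp (- 4 * (b + 1)))"
    and numeric: "\<And>j y. j \<ge> 1 \<Longrightarrow> y = b + real j \<Longrightarrow> E_const k N \<le> exp y \<and>
      (4 * C\<^sub>S\<^sup>2 * (1 + 2 * C\<^sub>A\<^sup>2 + 2 * C\<^sub>A / c\<^sub>A) * (R\<^sup>2 / (4 * c\<^sup>2) + C\<^sub>\<psi>\<^sup>2)) * (\<sigma> / r)\<^sup>2 *
        (kappa k N j)\<^sup>2 *
       (exp (- 3 * y) * (kappa k N j)\<^sup>2 / (4 * c\<^sup>2) + 1 / Phi_gain k N (exp y)) \<le> exp (- 4)"
  shows "AE x in lebesgue_on H. u x \<le> M"
proof -
  define K where "K = 1 + 2 * C\<^sub>A\<^sup>2 + 2 * C\<^sub>A / c\<^sub>A"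
  have K: "0 < K" using C\<^sub>A c\<^sub>A by (simp add: K_def add_pos_pos)
  have D_open: "open D" using S(1)[of 1] S(3) by simp
  define \<delta> where "\<delta> = (\<lambda>j. W * M\<^sup>2 * exp (- 4 * (b + real j)))"
  have \<delta>_pos: "0 < \<delta> j" for j using W(2) X(4) by (simp add: \<delta>_def)
  have main: "(\<integral>\<^sup>+x. ennreal ((max (u x - M * t j) 0)\<^sup>2 * w x) \<partial>lebesgue_on (S j)) \<le> ennreal (\<delta> j)"
    if "j \<ge> 1" for j
    using that
  proof (induction j rule: nat_induct_at_least)
    case base
    then show ?case using U1 t(1) S(3) by (simp add: \<delta>_def)
  next
    case (Suc j)
    define \<kappa> where "\<kappa> = kappa k N j"
    have \<kappa>: "0 < \<kappa>" unfolding \<kappa>_def using Suc.hyps pos by (intro kappa_pos)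
    define y where "y = b + real j"
    note num = numeric[OF Suc.hyps y_def, folded \<kappa>_def K_def]
    define \<Lambda> where "\<Lambda> = C\<^sub>\<psi> * \<kappa> / r"
    have \<Lambda>: "0 < \<Lambda>" using pos \<kappa> by (simp add: \<Lambda>_def)
    obtain L where L: "L-lipschitz_on UNIV (\<psi> j)" using \<psi>(1) Suc.hyps by blast
    obtain \<eta> where \<eta>: "\<eta> \<in> Lip_c D" "\<And>x. 0 \<le> \<eta> x" "\<And>x. \<eta> x \<le> 1"
      "\<And>x. x \<notin> S j \<Longrightarrow> \<eta> x = 0" "\<And>x. x \<notin> S j \<Longrightarrow> grad \<eta> x = 0" "\<And>x. x \<in> S (Suc j) \<Longrightarrow> \<eta> x = 1"
      "AE x in lebesgue_on \<Omega>. (norm (\<B> x *v grad \<eta> x))\<^sup>2 \<le> \<Lambda>\<^sup>2 * w x"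
      by (rule clamped_cutoff[OF L \<psi>(2)[OF Suc.hyps] S(2)[OF Suc.hyps] S(4), of "S (Suc j)" \<Lambda>])
         (use \<psi>(3,4)[OF Suc.hyps] \<Lambda> in \<open>auto simp: \<Lambda>_def \<kappa>_def\<close>)
    define T where "T = exp y"
    define h where "h = Phi_gain k N T"
    have T: "0 < T" "E_const k N \<le> T" using num by (auto simp: T_def)
    have h: "0 < h" unfolding h_def by (rule Phi_gain_pos[OF pos(7) T(2)])
    have dt: "M * t (Suc j) - M * t j = M * (2 * c / \<kappa>)"
      using t(2)[OF Suc.hyps] by (simp add: \<kappa>_def flip: right_diff_distrib)
    have dt_pos: "0 < M * (2 * c / \<kappa>)" using X(4) pos \<kappa> by simp
    have lt: "M * t j < M * t (Suc j)" using dt dt_pos by linarith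
    have P: "AE x in lebesgue_on \<Omega>. u x \<noteq> M * t (Suc j)" using Suc.hyps by (intro generic) simp
    define asq where "asq = 4 * (C\<^sub>S * \<sigma>)\<^sup>2 / W * K * (X\<^sup>2 / (M * (2 * c / \<kappa>))\<^sup>2 + \<Lambda>\<^sup>2) * \<delta> j"
    have "(\<integral>\<^sup>+x. ennreal ((max (u x - M * t (Suc j)) 0)\<^sup>2 * w x) \<partial>lebesgue_on (S (Suc j))) \<le>
      ennreal (asq * T * (\<delta> j / (M * (2 * c / \<kappa>))\<^sup>2) + asq * W / h)"
      unfolding asq_def dt[symmetric] K_def
    proof (rule
      De_Giorgi_step[OF D_open S(4) W OS _ _ T(1) h X(1,2) \<phi> uG sub P lt \<eta>(1-3) _ _ \<eta>(4,5) _ _ \<eta>(6)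
      \<eta>(7) \<Lambda> Suc.IH \<delta>_pos])
      show "h * s\<^sup>2 \<le> Phi k N s" if "T < s\<^sup>2" for s
        unfolding h_def by (rule Phi_gain_le[OF pos(7) T(2) that])
    qed (use pos S(1)[of j] S(1)[of "Suc j"] S(2)[of j] S(2)[of "Suc j"] Suc.hyps in auto)
    also have "asq * T * (\<delta> j / (M * (2 * c / \<kappa>))\<^sup>2) + asq * W / h \<le> \<delta> (Suc j)"
    proof -
      \<comment> \<open>Multiplication by T = e^y spends one of the four powers of e^(-y); the
        remaining e^(-3y) is what \<open>numeric\<close> expects.\<close>
      have "\<delta> j = W * M\<^sup>2 * exp (- 4 * y)" by (simp add: \<delta>_def y_def)
      moreover have "T * exp (- 4 * y) = exp (- 3 * y)" by (simp add: T_def flip: exp_add)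
      ultimately have "T * \<delta> j = W * M\<^sup>2 * exp (- 3 * y)" by (simp add: mult_ac)
      then have 1: "T * (\<delta> j / (M * (2 * c / \<kappa>))\<^sup>2) = W * (exp (- 3 * y) * \<kappa>\<^sup>2 / (4 * c\<^sup>2))"
        using X(4) \<kappa> pos by (simp add: power_mult_distrib power_divide field_simps)
      have "asq * T * (\<delta> j / (M * (2 * c / \<kappa>))\<^sup>2) + asq * W / h =
        asq * (T * (\<delta> j / (M * (2 * c / \<kappa>))\<^sup>2)) + asq * W / h" by (simp only: mult.assoc)
      also have "\<dots> = asq * W * (exp (- 3 * y) * \<kappa>\<^sup>2 / (4 * c\<^sup>2) + 1 / h)"
        unfolding 1 by (simp add: algebra_simps)
      also have "\<dots> \<le> (4 * C\<^sub>S\<^sup>2 * K * (R\<^sup>2 / (4 * c\<^sup>2) + C\<^sub>\<psi>\<^sup>2) * (\<sigma> / r)\<^sup>2 * \<kappa>\<^sup>2 * \<delta> j) *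
        (exp (- 3 * y) * \<kappa>\<^sup>2 / (4 * c\<^sup>2) + 1 / h)"
      proof (rule mult_right_mono)
        have "X\<^sup>2 / (M * (2 * c / \<kappa>))\<^sup>2 \<le> M\<^sup>2 / (M * (2 * c / \<kappa>))\<^sup>2"
          using X by (intro divide_right_mono power_mono) auto
        also have "\<dots> = \<kappa>\<^sup>2 / (4 * c\<^sup>2)" using X(4) \<kappa> pos
          by (simp add: power_mult_distrib power_divide field_simps)
        \<comment> \<open>The term from \<phi> lacks the factor 1/r^2 that the cutoff term has.
          Since r <= R, it can be inserted at the cost of R^2, and both terms then scale
          alike.\<close>
        also have "\<dots> \<le> \<kappa>\<^sup>2 / r\<^sup>2 * (R\<^sup>2 / (4 * c\<^sup>2))"
        proof -
          have "r\<^sup>2 \<le> R\<^sup>2" using pos by (intro power_mono) auto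
          then have "1 \<le> R\<^sup>2 / r\<^sup>2" using pos by (simp add: field_simps)
          then have "\<kappa>\<^sup>2 / (4 * c\<^sup>2) * 1 \<le> \<kappa>\<^sup>2 / (4 * c\<^sup>2) * (R\<^sup>2 / r\<^sup>2)"
            by (intro mult_left_mono) auto
          then show ?thesis by (simp add: mult_ac)
        qed
        finally have "X\<^sup>2 / (M * (2 * c / \<kappa>))\<^sup>2 + \<Lambda>\<^sup>2 \<le> \<kappa>\<^sup>2 / r\<^sup>2 * (R\<^sup>2 / (4 * c\<^sup>2) + C\<^sub>\<psi>\<^sup>2)"
          by (simp add: \<Lambda>_def power_mult_distrib power_divide distrib_left mult_ac)
        then have "(4 * (C\<^sub>S * \<sigma>)\<^sup>2 * K * \<delta> j) * (X\<^sup>2 / (M * (2 * c / \<kappa>))\<^sup>2 + \<Lambda>\<^sup>2) \<le>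
          (4 * (C\<^sub>S * \<sigma>)\<^sup>2 * K * \<delta> j) * (\<kappa>\<^sup>2 / r\<^sup>2 * (R\<^sup>2 / (4 * c\<^sup>2) + C\<^sub>\<psi>\<^sup>2))"
          using K \<delta>_pos[of j] by (intro mult_left_mono) auto
        moreover have "asq * W = (4 * (C\<^sub>S * \<sigma>)\<^sup>2 * K * \<delta> j) * (X\<^sup>2 / (M * (2 * c / \<kappa>))\<^sup>2 + \<Lambda>\<^sup>2)"
          using W(2) by (simp add: asq_def)
        moreover have "(4 * (C\<^sub>S * \<sigma>)\<^sup>2 * K * \<delta> j) * (\<kappa>\<^sup>2 / r\<^sup>2 * (R\<^sup>2 / (4 * c\<^sup>2) + C\<^sub>\<psi>\<^sup>2)) =
          4 * C\<^sub>S\<^sup>2 * K * (R\<^sup>2 / (4 * c\<^sup>2) + C\<^sub>\<psi>\<^sup>2) * (\<sigma> / r)\<^sup>2 * \<kappa>\<^sup>2 * \<delta> j"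
          by (simp add: power_mult_distrib power_divide mult_ac)
        ultimately show
          "asq * W \<le> 4 * C\<^sub>S\<^sup>2 * K * (R\<^sup>2 / (4 * c\<^sup>2) + C\<^sub>\<psi>\<^sup>2) * (\<sigma> / r)\<^sup>2 * \<kappa>\<^sup>2 * \<delta> j" by simp
        show "0 \<le> exp (- 3 * y) * \<kappa>\<^sup>2 / (4 * c\<^sup>2) + 1 / h" using h by simp
      qed
      also have "\<dots> = \<delta> j *
        (4 * C\<^sub>S\<^sup>2 * K * (R\<^sup>2 / (4 * c\<^sup>2) + C\<^sub>\<psi>\<^sup>2) * (\<sigma> / r)\<^sup>2 * \<kappa>\<^sup>2 *
        (exp (- 3 * y) * \<kappa>\<^sup>2 / (4 * c\<^sup>2) + 1 / h))"
        by (simp only: mult_ac)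
      also have "\<dots> \<le> \<delta> j * exp (- 4)"
        using num \<delta>_pos[of j] unfolding h_def T_def by (intro mult_left_mono) auto
      also have "\<dots> = \<delta> (Suc j)" by (simp add: \<delta>_def algebra_simps flip: exp_add)
      finally show ?thesis .
    qed
    finally show ?case by (simp add: ennreal_leI)
  qed
  have H_leb[measurable]: "H \<in> sets lebesgue" using H(1) by auto
  have "H \<subseteq> D" using H(2)[of 1] S(3) by simp
  then have H\<Omega>: "H \<subseteq> \<Omega>" using S(4) by simp
  have u_meas: "u \<in> borel_measurable (lebesgue_on \<Omega>)" using uG
    by (auto simp: W12A_def sobolev_closure_def)
  have [measurable]: "u \<in> borel_measurable (lebesgue_on H)" "w \<in> borel_measurable (lebesgue_on H)"
    using H\<Omega> by (auto intro!: measurable_restrict_mono[OF u_meas] w_measurable)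
  have le: "(\<integral>\<^sup>+x. ennreal ((max (u x - M) 0)\<^sup>2 * w x) \<partial>lebesgue_on H) \<le> ennreal (\<delta> (Suc j))" for j
  proof -
    have "(\<integral>\<^sup>+x. ennreal ((max (u x - M) 0)\<^sup>2 * w x) \<partial>lebesgue_on H) \<le>
      (\<integral>\<^sup>+x. ennreal ((max (u x - M * t (Suc j)) 0)\<^sup>2 * w x) \<partial>lebesgue_on H)"
    proof (rule nn_integral_mono_AE)
      have "AE x in lebesgue_on H. 0 < w x" by (rule AE_lebesgue_on_mono_set[OF w_pos H\<Omega>]) auto
      then show "AE x in lebesgue_on H. ennreal ((max (u x - M) 0)\<^sup>2 * w x) \<le>
        ennreal ((max (u x - M * t (Suc j)) 0)\<^sup>2 * w x)"
      proof eventually_elim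
        case (elim x)
        have "M * t (Suc j) \<le> M * 1" using t(3)[of "Suc j"] X(4) by (intro mult_left_mono) auto
        then show ?case using elim by (intro ennreal_leI mult_right_mono power_mono) auto
      qed
    qed
    also have "\<dots> \<le> (\<integral>\<^sup>+x. ennreal ((max (u x - M * t (Suc j)) 0)\<^sup>2 * w x) \<partial>lebesgue_on (S (Suc j)))"
      by (rule nn_integral_lebesgue_on_mono_set[OF H(2)]) (use S(1)[of "Suc j"] in auto)
    also have "\<dots> \<le> ennreal (\<delta> (Suc j))" by (rule main) simp
    finally show ?thesis .
  qed
  have "(\<lambda>j. \<delta> (Suc j)) \<longlonglongrightarrow> 0"
  proof -
    have "\<delta> (Suc j) = W * M\<^sup>2 * exp (- 4 * (b + 1)) * exp (- 4) ^ j" for j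
      by (simp add: \<delta>_def algebra_simps flip: exp_add exp_of_nat_mult)
    moreover have "(\<lambda>j. exp (- 4 :: real) ^ j) \<longlonglongrightarrow> 0" by (intro LIMSEQ_realpow_zero) auto
    ultimately show ?thesis by (simp add: tendsto_mult_right_zero)
  qed
  then have "(\<lambda>j. ennreal (\<delta> (Suc j))) \<longlonglongrightarrow> ennreal 0" by (rule tendsto_ennrealI)
  then have "(\<integral>\<^sup>+x. ennreal ((max (u x - M) 0)\<^sup>2 * w x) \<partial>lebesgue_on H) \<le> ennreal 0"
    by (rule LIMSEQ_le_const) (use le in blast)
  then have "(\<integral>\<^sup>+x. ennreal ((max (u x - M) 0)\<^sup>2 * w x) \<partial>lebesgue_on H) = 0" by simp
  then have "AE x in lebesgue_on H. ennreal ((max (u x - M) 0)\<^sup>2 * w x) = 0"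
    by (simp add: nn_integral_0_iff_AE)
  moreover have "AE x in lebesgue_on H. 0 < w x" by (rule AE_lebesgue_on_mono_set[OF w_pos H\<Omega>]) auto
  ultimately show ?thesis
  proof eventually_elim
    case (elim x)
    then have "(max (u x - M) 0)\<^sup>2 * w x \<le> 0" by (simp add: ennreal_eq_0_iff)
    then have "(max (u x - M) 0)\<^sup>2 \<le> 0" using elim(2) by (simp add: mult_le_0_iff)
    then show ?case by (simp add: max_def split: if_splits)
  qed
qed

section \<open>Metric balls and the local estimate\<close>

text \<open>Summing \<open>r\<^sub>j - r\<^sub>j\<^sub>+\<^sub>1 = c r / \<kappa>(j)\<close> to \<open>r / 2\<close> determines \<open>c\<close>, independently of the ball.\<close>

definition radius_const :: "nat \<Rightarrow> real \<Rightarrow> real" where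
  "radius_const k N = 1 / (2 * (\<Sum>j. 1 / kappa k N (Suc j)))"

lemma adapted_radii_const:
  assumes "adapted_radii k N r rad" "0 < r"
  shows "0 < radius_const k N"
    and "\<And>j. j \<ge> 1 \<Longrightarrow> rad j - rad (Suc j) = radius_const k N * r / kappa k N j"
proof -
  obtain c where c: "c > 0" "\<And>j. j \<ge> 1 \<Longrightarrow> rad j - rad (Suc j) = c * r / kappa k N j"
    and rad: "rad 1 = r" "rad \<longlonglongrightarrow> r / 2" using assms(1) by (auto simp: adapted_radii_def)
  have "(\<lambda>n. rad (Suc n)) \<longlonglongrightarrow> r / 2" using rad(2) by (rule LIMSEQ_Suc)
  then have "(\<lambda>n. rad (Suc n) - rad (Suc (Suc n))) sums (rad (Suc 0) - r / 2)"
    by (rule telescope_sums')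
  then have "(\<lambda>n. c * r / kappa k N (Suc n)) sums (r / 2)" using c(2) rad(1) by simp
  then have "(\<lambda>n. c * r / kappa k N (Suc n) / (c * r)) sums (r / 2 / (c * r))" by (rule sums_divide)
  then have "(\<lambda>n. 1 / kappa k N (Suc n)) sums (1 / (2 * c))" using c(1) assms(2)
    by (simp add: field_simps)
  then have "(\<Sum>j. 1 / kappa k N (Suc j)) = 1 / (2 * c)" by (rule sums_unique[symmetric])
  then have "radius_const k N = c" by (simp add: radius_const_def)
  with c show "0 < radius_const k N"
    "\<And>j. j \<ge> 1 \<Longrightarrow> rad j - rad (Suc j) = radius_const k N * r / kappa k N j" by auto
qed

lemma adapted_radii_bounds:
  assumes "adapted_radii k N r rad" "0 < r" "1 < N" "j \<ge> 1"
  shows "r / 2 \<le> rad j" "rad j \<le> r" "rad (Suc j) < rad j"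
proof -
  have less: "rad (Suc j) < rad j" if "j \<ge> 1" for j
  proof -
    have "0 < radius_const k N * r / kappa k N j"
      using adapted_radii_const(1)[OF assms(1,2)] assms(2) kappa_pos[OF assms(3) that, of k] by simp
    then show ?thesis using adapted_radii_const(2)[OF assms(1,2) that] by linarith
  qed
  then show "rad (Suc j) < rad j" using assms(4) .
  have dec: "decseq (\<lambda>n. rad (Suc n))" using less by (intro decseq_SucI) (auto intro: less_imp_le)
  have "(\<lambda>n. rad (Suc n)) \<longlonglongrightarrow> r / 2" using assms(1)
    by (intro LIMSEQ_Suc) (simp add: adapted_radii_def)
  from decseq_ge[OF dec this, of "j - 1"] show "r / 2 \<le> rad j" using assms(4) by simp
  show "rad j \<le> r" using decseqD[OF dec, of 0 "j - 1"] assms(1,4) by (simp add: adapted_radii_def)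
qed

lemma mball_of_subset: "s \<le> r \<Longrightarrow> mball_of m x s \<subseteq> mball_of m x r"
  by auto

lemma mball_of_triangle:
  assumes "y \<in> mball_of m x r" "e \<le> r - mdist m x y"
  shows "mball_of m y e \<subseteq> mball_of m x r"
proof
  fix z assume "z \<in> mball_of m y e"
  then have z: "y \<in> mspace m" "z \<in> mspace m" "mdist m y z < e" by simp_all
  have x: "x \<in> mspace m" using assms(1) by simp
  have "mdist m x z \<le> mdist m x y + mdist m y z"
    by (rule Metric_space.triangle[OF Metric_space_mspace_mdist x z(1,2)])
  then have "mdist m x z < r" using z(3) assms(2) by linarith
  then show "z \<in> mball_of m x r" using x z(2) by simp
qed

lemma centre_in_mball_of: "x \<in> mspace m \<Longrightarrow> 0 < r \<Longrightarrow> x \<in> mball_of m x r"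
  by (simp add: Metric_space.mdist_zero[OF Metric_space_mspace_mdist])

locale adapted = degenerate \<Omega> w A \<B> Q\<^sub>A c\<^sub>A C\<^sub>A L\<^sub>B
  for \<Omega> :: "(real ^ 'n) set" and w and A \<B> :: "real ^ 'n \<Rightarrow> real ^ 'n ^ 'n" and Q\<^sub>A c\<^sub>A C\<^sub>A L\<^sub>B +
  fixes m :: "(real ^ 'n) metric" and k :: nat and N R C\<^sub>S C\<^sub>\<psi> :: real
  assumes \<Omega>_mspace: "\<Omega> \<subseteq> mspace m" and \<Omega>_openin: "openin (mtopology_of m) \<Omega>"
    and k: "k \<ge> 1" and N: "N > 1" and R: "R > 0" and C\<^sub>S: "C\<^sub>S > 0" and C\<^sub>\<psi>: "C\<^sub>\<psi> > 0"
    and cutoffs: "\<And>x r. ball_in m \<Omega> x r \<Longrightarrow> r \<le> R \<Longrightarrow> \<exists>\<psi>. adapted_cutoffs m \<Omega> w \<B> k N C\<^sub>\<psi> x r \<psi>"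
begin

lemma ball_in_mono: "ball_in m \<Omega> x r \<Longrightarrow> 0 < s \<Longrightarrow> s \<le> r \<Longrightarrow> ball_in m \<Omega> x s"
  using mball_of_subset[of s r m x] order_trans[of "mball_of m x s" "mball_of m x r" \<Omega>]
  by (simp add: ball_in_def del: in_mball_of)

text \<open>The second radius is still at least r/2, so the first function of an adapted sequence is
  already an ordinary cutoff between the half ball and the ball.\<close>

lemma first_cutoff:
  assumes "ball_in m \<Omega> x r" "r \<le> R"
  shows "\<exists>\<psi>. (\<exists>L. L-lipschitz_on UNIV \<psi>) \<and> closure {y. \<psi> y \<noteq> 0} \<subseteq> mball_of m x r \<and>
    (\<forall>y\<in>mball_of m x (r / 2). \<psi> y = 1) \<and>
    Linf_norm \<Omega> (\<lambda>y. norm (\<B> y *v grad \<psi> y) / sqrt (w y)) \<le> ennreal (C\<^sub>\<psi> * kappa k N 1 / r)"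
proof -
  have r: "0 < r" using assms(1) by (simp add: ball_in_def)
  obtain \<psi> where "adapted_cutoffs m \<Omega> w \<B> k N C\<^sub>\<psi> x r \<psi>" using cutoffs[OF assms] by blast
  then obtain rad where rad: "adapted_radii k N r rad"
    and \<psi>: "\<And>j. j \<ge> 1 \<Longrightarrow> (\<exists>L. L-lipschitz_on UNIV (\<psi> j)) \<and>
          closure {y. \<psi> j y \<noteq> 0} \<subseteq> mball_of m x (rad j) \<and>
          (\<forall>y \<in> mball_of m x (rad (Suc j)). \<psi> j y = 1) \<and>
          Linf_norm \<Omega> (\<lambda>y. norm (\<B> y *v grad (\<psi> j) y) / sqrt (w y)) \<le> ennreal
            (C\<^sub>\<psi> * kappa k N j / r)"
    unfolding adapted_cutoffs_def by blast
  have rad1: "rad 1 = r" using rad by (simp add: adapted_radii_def)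
  have sub: "mball_of m x (r / 2) \<subseteq> mball_of m x (rad (Suc 1))"
    by (rule mball_of_subset) (use adapted_radii_bounds(1)[OF rad r N, of "Suc 1"] in auto)
  note p = \<psi>[OF order_refl, unfolded rad1]
  show ?thesis
  proof (intro exI[of _ "\<psi> 1"] conjI ballI)
    show "\<psi> 1 y = 1" if "y \<in> mball_of m x (r / 2)" for y
      using p[THEN conjunct2, THEN conjunct2, THEN conjunct1] subsetD[OF sub that] by (rule bspec)
  qed (rule p[THEN conjunct1] p[THEN conjunct2, THEN conjunct1]
    p[THEN conjunct2, THEN conjunct2, THEN conjunct2])+
qed

text \<open>Although the topology of \<open>m\<close> is not assumed to be the Euclidean one, the cutoff functions are
  continuous, and their supports force the balls to be open.\<close>

lemma open_mball:
  assumes B: "ball_in m \<Omega> x r"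
  shows "open (mball_of m x r)"
proof (subst open_subopen, intro ballI)
  fix y assume y: "y \<in> mball_of m x r"
  \<comment> \<open>Cutoff functions are available only for radii up to \<open>R\<close>.\<close>
  define e where "e = min R (r - mdist m x y)"
  have e: "0 < e" "e \<le> R" "e \<le> r - mdist m x y" using y R by (auto simp: e_def)
  have sub: "mball_of m y e \<subseteq> mball_of m x r" by (rule mball_of_triangle[OF y e(3)])
  have "ball_in m \<Omega> y e" using B y e(1) sub by (auto simp: ball_in_def)
  from first_cutoff[OF this e(2)]
  obtain \<psi> :: "real ^ 'n \<Rightarrow> real" and L
    where \<psi>: "L-lipschitz_on UNIV \<psi>" "closure {z. \<psi> z \<noteq> 0} \<subseteq> mball_of m y e"
    "\<forall>z\<in>mball_of m y (e / 2). \<psi> z = 1" by (elim exE conjE) (rule that)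
  have "open {z. \<psi> z \<noteq> 0}"
    by (intro open_Collect_neq lipschitz_on_continuous_on[OF \<psi>(1)] continuous_on_const)
  moreover have "\<psi> y = 1"
    by (rule \<psi>(3)[rule_format, OF centre_in_mball_of]) (use y e(1) in auto)
  moreover have "{z. \<psi> z \<noteq> 0} \<subseteq> mball_of m x r"
    by (rule order_trans[OF closure_subset order_trans[OF \<psi>(2) sub]])
  ultimately show "\<exists>T. open T \<and> y \<in> T \<and> T \<subseteq> mball_of m x r" by (intro exI[of _ "{z. \<psi> z \<noteq> 0}"]) auto
qed

text \<open>The weight is integrable on compact subsets of \<Omega> only. A half ball lies in the
  support of a cutoff function, which is closed and bounded and contained in \<Omega>, hence of
  finite weight.\<close>

lemma small_ball:
  assumes "y \<in> \<Omega>"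
  obtains r where "ball_in m \<Omega> y r" "r \<le> R" "wmeas w (mball_of m y r) < top"
proof -
  have "\<exists>r>0. mball_of m y r \<subseteq> \<Omega>"
    using \<Omega>_openin assms unfolding mtopology_of_def mball_of_def
      Metric_space.openin_mtopology[OF Metric_space_mspace_mdist] by (elim conjE allE impE)
  then obtain r0 where "r0 > 0" "mball_of m y r0 \<subseteq> \<Omega>" by (elim exE conjE) (rule that)
  then have "ball_in m \<Omega> y r0" using assms by (simp add: ball_in_def)
  then have B: "ball_in m \<Omega> y (min r0 R)" by (rule ball_in_mono) (use R \<open>r0 > 0\<close> in auto)
  from first_cutoff[OF B min.cobounded2]
  obtain \<psi> :: "real ^ 'n \<Rightarrow> real" and L
    where \<psi>: "L-lipschitz_on UNIV \<psi>" "closure {z. \<psi> z \<noteq> 0} \<subseteq> mball_of m y (min r0 R)"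
    "\<forall>z\<in>mball_of m y (min r0 R / 2). \<psi> z = 1" by (elim exE conjE) (rule that)
  define r where "r = min r0 R / 2"
  have r: "0 < r" "r \<le> min r0 R" using R \<open>r0 > 0\<close> by (auto simp: r_def)
  have Br: "ball_in m \<Omega> y r" using B r by (rule ball_in_mono)
  let ?K = "closure {z. \<psi> z \<noteq> 0}"
  have K\<Omega>: "?K \<subseteq> \<Omega>" using \<psi>(2) B by (auto simp: ball_in_def)
  have K: "compact ?K" using bounded_subset[OF bounded_\<Omega> K\<Omega>]
    by (simp add: compact_eq_bounded_closed)
  have "mball_of m y r \<subseteq> ?K"
  proof
    fix z assume "z \<in> mball_of m y r"
    then have "\<psi> z = 1" using \<psi>(3) unfolding r_def by blast
    then show "z \<in> ?K" by (intro subsetD[OF closure_subset]) simp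
  qed
  then have "wmeas w (mball_of m y r) \<le> wmeas w ?K"
    using open_mball[OF Br] by (intro wmeas_mono) auto
  also have "\<dots> < top"
  proof -
    have "(\<integral>\<^sup>+x. ennreal (norm (w x)) \<partial>lebesgue_on ?K) < \<infinity>"
      using w_loc[OF K K\<Omega>] by (simp add: integrable_iff_bounded)
    moreover have "wmeas w ?K \<le> (\<integral>\<^sup>+x. ennreal (norm (w x)) \<partial>lebesgue_on ?K)"
      unfolding wmeas_def by (intro nn_integral_mono ennreal_leI) auto
    ultimately show ?thesis by (simp add: le_less_trans)
  qed
  finally show thesis using that[OF Br] r by simp
qed

lemma wmeas_open_pos:
  assumes "open D" "D \<subseteq> \<Omega>" "D \<noteq> {}"
  shows "0 < wmeas w D"
proof (rule ccontr)
  assume "\<not> 0 < wmeas w D"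
  then have "(\<integral>\<^sup>+x. ennreal (w x) \<partial>lebesgue_on D) = 0" by (simp add: wmeas_def)
  then have "AE x in lebesgue_on D. ennreal (w x) = 0"
    using w_measurable[OF assms(2)] by (simp add: nn_integral_0_iff_AE)
  moreover have "AE x in lebesgue_on D. 0 < w x"
    by (rule AE_lebesgue_on_mono_set[OF w_pos assms(2)]) (use assms(1) in auto)
  ultimately have "AE x in lebesgue_on D. False" by eventually_elim auto
  then have "AE x in lebesgue. x \<notin> D" using assms(1) by (auto simp: AE_restrict_space_iff)
  then have "D \<in> null_sets lebesgue" using assms(1) by (simp add: AE_iff_null_sets)
  then have "negligible D" by (simp add: negligible_iff_null_sets)
  then show False using assms open_not_negligible by blast
qed

text \<open>A level of positive measure is an atom of the distribution of u. Since \<Omega> has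
  finite measure, this distribution is finite and has countably many atoms.\<close>

lemma countable_nongeneric:
  assumes u: "u \<in> borel_measurable (lebesgue_on \<Omega>)"
  shows "countable {P::real. \<not> (AE x in lebesgue_on \<Omega>. u x \<noteq> P)}"
proof -
  interpret M: finite_measure "lebesgue_on \<Omega>"
    using bounded_set_imp_lmeasurable[OF bounded_\<Omega> \<Omega>_lebesgue] by (rule finite_measure_lebesgue_on)
  interpret D: finite_measure "distr (lebesgue_on \<Omega>) borel u" using u
    by (rule M.finite_measure_distr)
  have "AE x in lebesgue_on \<Omega>. u x \<noteq> P" if P: "measure (distr (lebesgue_on \<Omega>) borel u) {P} = 0"
    for P
  proof -
    have "emeasure (distr (lebesgue_on \<Omega>) borel u) {P} = 0" using P
      by (simp add: D.emeasure_eq_measure)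
    then have "emeasure (lebesgue_on \<Omega>) (u -` {P} \<inter> space (lebesgue_on \<Omega>)) = 0" using u
      by (simp add: emeasure_distr)
    moreover have "u -` {P} \<inter> space (lebesgue_on \<Omega>) \<in> sets (lebesgue_on \<Omega>)" using u
      by (rule measurable_sets) simp
    ultimately have "u -` {P} \<inter> space (lebesgue_on \<Omega>) \<in> null_sets (lebesgue_on \<Omega>)"
      by (simp add: null_sets_def)
    then have "AE x in lebesgue_on \<Omega>. x \<notin> u -` {P} \<inter> space (lebesgue_on \<Omega>)" by (rule AE_not_in)
    then show ?thesis using AE_space[of "lebesgue_on \<Omega>"] by eventually_elim auto
  qed
  then have "{P. \<not> (AE x in lebesgue_on \<Omega>. u x \<noteq> P)}
    \<subseteq> {P. measure (distr (lebesgue_on \<Omega>) borel u) {P} \<noteq> 0}" by auto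
  then show ?thesis using D.countable_support by (rule countable_subset)
qed

text \<open>Convergence of the series behind \<open>radius_const\<close> is read off from the
  existence of one adapted sequence of radii, on a small ball around any point of \<Omega>.\<close>

lemma radius_const_pos:
  assumes "\<Omega> \<noteq> {}"
  shows "0 < radius_const k N"
proof -
  obtain y where "y \<in> \<Omega>" using assms by blast
  then obtain r where r: "ball_in m \<Omega> y r" "r \<le> R" by (rule small_ball) blast
  then obtain \<psi> where "adapted_cutoffs m \<Omega> w \<B> k N C\<^sub>\<psi> y r \<psi>" using cutoffs by blast
  then obtain rad where "adapted_radii k N r rad" unfolding adapted_cutoffs_def by blast
  then show ?thesis using adapted_radii_const(1) r(1) by (auto simp: ball_in_def)
qed

text \<open>The iteration gives u <= M on the half ball for every M > M0 outside a countable set;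
  such M approach M0, which yields the bound at M0.\<close>

lemma local_boundedness_estimate:
  assumes K\<^sub>3: "1 \<le> K\<^sub>3" and numeric: "\<And>s j y. s \<ge> 1 \<Longrightarrow> j \<ge> 1 \<Longrightarrow>
      y = (exp ^^ (k-1)) (K\<^sub>3 * s powr (2 / (N - 1))) + real j \<Longrightarrow>
      E_const k N \<le> exp y \<and>
      (4 * C\<^sub>S\<^sup>2 * (1 + 2 * C\<^sub>A\<^sup>2 + 2 * C\<^sub>A / c\<^sub>A) * (R\<^sup>2 / (4 * (radius_const k N)\<^sup>2) + C\<^sub>\<psi>\<^sup>2)) *
        s\<^sup>2 * (kappa k N j)\<^sup>2 *
       (exp (- 3 * y) * (kappa k N j)\<^sup>2 / (4 * (radius_const k N)\<^sup>2) + 1 / Phi_gain k N (exp y)) \<le>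
         exp (- 4)"
    and \<sigma>: "superradius R \<sigma>" and OS: "orlicz_sobolev m \<Omega> w \<B> k N R \<sigma> C\<^sub>S"
    and adm: "A_admissible m \<Omega> w A \<B> \<phi>" and u: "weak_subsolution A \<Omega> \<phi> u"
    and B: "ball_in m \<Omega> x r" "r \<le> R" "wmeas w (mball_of m x r) < top"
  shows "Linf_norm (mball_of m x (r / 2)) (\<lambda>y. max (u y) 0) \<le>
           ennreal (exp 2 * sqrt ((exp ^^ k) (4 * K\<^sub>3 * (\<sigma> r / r) powr (2 / (N - 1))))) *
             ennsqrt ((\<integral>\<^sup>+ y. ennreal ((max (u y) 0)\<^sup>2 * w y) \<partial>lebesgue_on (mball_of m x r))
                      / wmeas w (mball_of m x r))
           + X_norm w A \<B> (mball_of m x r) \<phi>"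
proof -
  define D where "D = mball_of m x r"
  define H where "H = mball_of m x (r / 2)"
  have r: "0 < r" "x \<in> \<Omega>" using B(1) by (auto simp: ball_in_def)
  have "x \<in> mball_of m x r" using r \<Omega>_mspace by (intro centre_in_mball_of) auto
  then have D: "open D" "D \<subseteq> \<Omega>" "D \<noteq> {}" using open_mball[OF B(1)] B(1) unfolding D_def ball_in_def
    by blast+
  define W where "W = enn2real (wmeas w D)"
  have W: "wmeas w D = ennreal W" "0 < W"
    using B(3) wmeas_open_pos[OF D] by (auto simp: W_def D_def[symmetric] enn2real_positive_iff)
  define X where "X = enn2real (X_norm w A \<B> D \<phi>)"
  have "X_norm w A \<B> D \<phi> < top" using adm B(1) by (auto simp: A_admissible_def D_def)
  then have X: "X_norm w A \<B> D \<phi> = ennreal X" "0 \<le> X" by (auto simp: X_def)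
  have \<phi>: "\<phi> \<in> borel_measurable (lebesgue_on \<Omega>)" using adm by (simp add: A_admissible_def)
  obtain G where uG: "W12A A \<Omega> u G" and
    sub: "\<And>g H. W12A0 A \<Omega> g H \<Longrightarrow> AE x in lebesgue_on \<Omega>. 0 \<le> g x \<Longrightarrow>
       integrable (lebesgue_on \<Omega>) (\<lambda>x. \<phi> x * g x) \<Longrightarrow>
       (LINT x|lebesgue_on \<Omega>. \<phi> x * g x) \<le> - (LINT x|lebesgue_on \<Omega>. H x \<bullet> (A x *v G x))"
    using u unfolding weak_subsolution_def weak_relation_def by blast
  have u_meas: "u \<in> borel_measurable (lebesgue_on \<Omega>)" using uG
    by (auto simp: W12A_def sobolev_closure_def)
  define s where "s = \<sigma> r / r"
  have \<sigma>r: "r \<le> \<sigma> r" using \<sigma> r B(2) by (auto simp: superradius_def)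
  then have s: "1 \<le> s" using r by (simp add: s_def)
  define z where "z = s powr (2 / (N - 1))"
  have z: "1 \<le> z" unfolding z_def using s N by (intro ge_one_powr_ge_zero) auto
  define b where "b = (exp ^^ (k-1)) (K\<^sub>3 * z)"
  let ?C = "exp 2 * sqrt ((exp ^^ k) (4 * K\<^sub>3 * z))"
  \<comment> \<open>The identity e^(2(b+1)) = e^2 sqrt(e^(4b)) produces the square root; the factor
    4 then moves inside the iterated exponential.\<close>
  have C_ge: "exp (2 * (b + 1)) \<le> ?C"
  proof -
    have "1 * 1 \<le> K\<^sub>3 * z" using K\<^sub>3 z by (intro mult_mono) auto
    then have "4 * b \<le> (exp ^^ (k-1)) (4 * (K\<^sub>3 * z))" unfolding b_def
      by (intro four_funpow_exp_le) simp
    then have "exp (4 * b) \<le> exp ((exp ^^ (k-1)) (4 * (K\<^sub>3 * z)))" by simp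
    also have "\<dots> = (exp ^^ k) (4 * K\<^sub>3 * z)" using k by (cases k) (auto simp: mult.assoc)
    finally have "sqrt (exp (4 * b)) \<le> sqrt ((exp ^^ k) (4 * K\<^sub>3 * z))" by (rule real_sqrt_le_mono)
    moreover have "exp (4 * b) = (exp (2 * b))\<^sup>2" by (simp flip: exp_double)
    ultimately have "exp (2 * b) \<le> sqrt ((exp ^^ k) (4 * K\<^sub>3 * z))" by simp
    then have "exp 2 * exp (2 * b) \<le> ?C" by (intro mult_left_mono) auto
    then show ?thesis by (simp add: distrib_left exp_add mult.commute)
  qed
  then have C_pos: "0 < ?C" using less_le_trans[OF exp_gt_zero] by blast
  let ?U = "\<integral>\<^sup>+ y. ennreal ((max (u y) 0)\<^sup>2 * w y) \<partial>lebesgue_on D"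
  show ?thesis
  proof (cases "?U = top")
    \<comment> \<open>The weight of the ball is finite and the constant positive, so the right-hand
      side is infinite as well.\<close>
    case True
    then have "?U / wmeas w D = top" using W by (simp add: divide_ennreal_def ennreal_top_mult)
    moreover have "ennreal ?C \<noteq> 0" using C_pos by (simp only: ennreal_eq_0_iff not_le)
    ultimately have "ennreal ?C * ennsqrt (?U / wmeas w D) = top"
      by (simp only: ennsqrt_def ennreal_mult_top if_True if_False simp_thms)
    then show ?thesis by (simp add: D_def z_def s_def)
  next
    case False
    define U where "U = enn2real ?U"
    have U: "?U = ennreal U" "0 \<le> U" using False by (auto simp: U_def less_top)
    define \<mu> where "\<mu> = sqrt (U / W)"
    have \<mu>: "0 \<le> \<mu>" "W * \<mu>\<^sup>2 = U" using U W(2) by (auto simp: \<mu>_def)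
    \<comment> \<open>The sum of the two lower bounds for M. The exponent 2(b+1) is half of the
      4(b+j) at j = 1, where the induction starts.\<close>
    define M0 where "M0 = X + \<mu> * exp (2 * (b + 1))"
    have M0: "0 \<le> M0" "X \<le> M0" "\<mu> * exp (2 * (b + 1)) \<le> M0" using X(2) \<mu>(1) by (auto simp: M0_def)
    obtain \<psi> where "adapted_cutoffs m \<Omega> w \<B> k N C\<^sub>\<psi> x r \<psi>" using cutoffs[OF B(1,2)] by blast
    then obtain rad where rad: "adapted_radii k N r rad"
      and \<psi>: "\<And>j. j \<ge> 1 \<Longrightarrow> (\<exists>L. L-lipschitz_on UNIV (\<psi> j)) \<and>
          closure {y. \<psi> j y \<noteq> 0} \<subseteq> mball_of m x (rad j) \<and>
          (\<forall>y \<in> mball_of m x (rad (Suc j)). \<psi> j y = 1) \<and>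
          Linf_norm \<Omega> (\<lambda>y. norm (\<B> y *v grad (\<psi> j) y) / sqrt (w y)) \<le> ennreal
            (C\<^sub>\<psi> * kappa k N j / r)"
      unfolding adapted_cutoffs_def by blast
    note rad_bounds = adapted_radii_bounds[OF rad r(1) N]
    define c where "c = radius_const k N"
    have c: "0 < c" using adapted_radii_const(1)[OF rad r(1)] by (simp add: c_def)
    define t where "t = (\<lambda>j. 2 - 2 * rad j / r)"
    have t1: "t 1 = 0" using rad r(1) by (simp add: t_def adapted_radii_def)
    have tSuc: "t (Suc j) - t j = 2 * c / kappa k N j" if "j \<ge> 1" for j
    proof -
      have "t (Suc j) - t j = 2 * (rad j - rad (Suc j)) / r"
        by (simp add: t_def diff_divide_distrib)
      then show ?thesis using adapted_radii_const(2)[OF rad r(1) that] r(1) by (simp add: c_def)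
    qed
    have t_le: "t j \<le> 1" if "j \<ge> 1" for j
      using rad_bounds(1)[OF that] r(1) by (simp add: t_def field_simps)
    have t_pos: "0 < t j" if "j \<ge> 2" for j
    proof -
      have "rad (Suc (j - 1)) < rad (j - 1)" "rad (j - 1) \<le> r"
        using that rad_bounds(2,3)[of "j - 1"] by auto
      then have "rad j < r" using that by simp
      then show ?thesis using r(1) by (simp add: t_def field_simps)
    qed
    \<comment> \<open>M is bad if some level M t_j is an atom of u. The index starts at 2 because
      t_1 = 0: a new level is truncated first at j = 2, and division by t_j is possible from there
      on.\<close>
    define Bad where "Bad = (\<Union>j\<in>{2..}. (\<lambda>P. P / t j) ` {P. \<not> (AE x in lebesgue_on \<Omega>. u x \<noteq> P)})"
    have Bad: "countable Bad" unfolding Bad_def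
      by (intro countable_UN countable_image countable_nongeneric[OF u_meas]) auto
    have AE_M: "AE y in lebesgue_on H. u y \<le> M" if M: "M0 < M" "M \<notin> Bad" for M
    proof (rule
      De_Giorgi_iteration[where S="\<lambda>j. mball_of m x (rad j)" and \<psi>=\<psi> and t=t and b=b and D=D and
      c=c and r=r and R=R and \<sigma>="\<sigma> r" and k=k and N=N and C\<^sub>S=C\<^sub>S and C\<^sub>\<psi>=C\<^sub>\<psi> and X=X
      and \<phi>=\<phi>, OF _ _ _ D(2) _ _ W])
      show "open (mball_of m x (rad j))" "mball_of m x (rad j) \<subseteq> D" if "j \<ge> 1" for j
      proof -
        have "ball_in m \<Omega> x (rad j)" using rad_bounds(1,2)[OF that] r(1)
          by (intro ball_in_mono[OF B(1)]) auto
        then show "open (mball_of m x (rad j))" by (rule open_mball)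
        show "mball_of m x (rad j) \<subseteq> D" unfolding D_def
          by (rule mball_of_subset[OF rad_bounds(2)[OF that]])
      qed
      show "mball_of m x (rad 1) = D" using rad by (simp add: D_def adapted_radii_def)
      show "open H" unfolding H_def using r(1) by (intro open_mball ball_in_mono[OF B(1)]) auto
      show "H \<subseteq> mball_of m x (rad j)" if "j \<ge> 1" for j unfolding H_def
        by (rule mball_of_subset[OF rad_bounds(1)[OF that]])
      show "orlicz_norm (Phi k N) w D v \<le> ennreal (C\<^sub>S * \<sigma> r) / ennsqrt (wmeas w D) *
        L2_norm_on D (\<lambda>y. \<B> y *v grad v y)"
        if "v \<in> Lip_c D" for v
        using OS B that unfolding orlicz_sobolev_def D_def by blast
      show "0 < C\<^sub>S" "0 < \<sigma> r" "0 < C\<^sub>\<psi>" "0 < r" "r \<le> R" "0 < c" "1 < N"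
        using C\<^sub>S C\<^sub>\<psi> r(1) \<sigma>r B(2) c N by auto
      show "X_norm w A \<B> D \<phi> \<le> ennreal X" "0 \<le> X" "X \<le> M" "0 < M" using X M0 M(1) by auto
      show "AE y in lebesgue_on \<Omega>. u y \<noteq> M * t j" if j: "j \<ge> 2" for j
      proof (rule ccontr)
        assume "\<not> (AE y in lebesgue_on \<Omega>. u y \<noteq> M * t j)"
        then have "M * t j / t j \<in> Bad" using j unfolding Bad_def by blast
        then show False using M(2) t_pos[OF j] by simp
      qed
      \<comment> \<open>This is the base case of the iteration, in terms of the root mean square
        \<mu>.\<close>
      have "\<mu> \<le> M * exp (- 2 * (b + 1))"
      proof -
        have "\<mu> = (\<mu> * exp (2 * (b + 1))) * exp (- 2 * (b + 1))"
          by (simp add: mult.assoc flip: exp_add)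
        also have "\<dots> \<le> M * exp (- 2 * (b + 1))" using M0(3) M(1) by (intro mult_right_mono) auto
        finally show ?thesis .
      qed
      then have "\<mu>\<^sup>2 \<le> (M * exp (- 2 * (b + 1)))\<^sup>2" using \<mu>(1) by (rule power_mono)
      also have "\<dots> = M\<^sup>2 * exp (- 4 * (b + 1))" by (simp add: power_mult_distrib flip: exp_double)
      finally have "W * \<mu>\<^sup>2 \<le> W * (M\<^sup>2 * exp (- 4 * (b + 1)))" using W(2)
        by (intro mult_left_mono) auto
      then have "U \<le> W * M\<^sup>2 * exp (- 4 * (b + 1))" using \<mu>(2) by (simp add: mult.assoc)
      then show "?U \<le> ennreal (W * M\<^sup>2 * exp (- 4 * (b + 1)))" unfolding U(1) by (rule ennreal_leI)
      show "E_const k N \<le> exp y \<and>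
        (4 * C\<^sub>S\<^sup>2 * (1 + 2 * C\<^sub>A\<^sup>2 + 2 * C\<^sub>A / c\<^sub>A) * (R\<^sup>2 / (4 * c\<^sup>2) + C\<^sub>\<psi>\<^sup>2)) * (\<sigma> r / r)\<^sup>2 *
          (kappa k N j)\<^sup>2 *
         (exp (- 3 * y) * (kappa k N j)\<^sup>2 / (4 * c\<^sup>2) + 1 / Phi_gain k N (exp y)) \<le> exp (- 4)"
        if "j \<ge> 1" "y = b + real j" for j y
        unfolding c_def s_def[symmetric]
          by (rule numeric[OF s that(1)]) (simp add: that(2) b_def z_def)
    qed (use \<phi> uG sub t1 tSuc t_le \<psi> in auto)
    \<comment> \<open>Every interval above M0 is uncountable and so contains good values; countably
      many of them, decreasing to M0, keep the exceptional sets null.\<close>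
    have AE_M0: "AE y in lebesgue_on H. u y \<le> M0"
    proof -
      have "\<exists>M. M0 < M \<and> M < M0 + 1 / Suc n \<and> M \<notin> Bad" for n
      proof (rule ccontr)
        assume "\<not> (\<exists>M. M0 < M \<and> M < M0 + 1 / Suc n \<and> M \<notin> Bad)"
        then have "{M0<..<M0 + 1 / Suc n} \<subseteq> Bad" by auto
        then have "countable {M0<..<M0 + 1 / Suc n}" using Bad by (rule countable_subset)
        then show False using uncountable_open_interval[of M0 "M0 + 1 / Suc n"] by simp
      qed
      then obtain M where M: "\<And>n. M0 < M n" "\<And>n. M n < M0 + 1 / Suc n" "\<And>n. M n \<notin> Bad" by metis
      have "AE y in lebesgue_on H. \<forall>n. u y \<le> M n" using AE_M M by (simp add: AE_all_countable)
      then show ?thesis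
      proof eventually_elim
        case (elim y)
        show ?case
        proof (rule field_le_epsilon)
          fix e :: real assume "0 < e"
          then obtain n where "1 / Suc n < e" using nat_approx_posE by blast
          then show "u y \<le> M0 + e" using elim[rule_format, of n] M(2)[of n] by linarith
        qed
      qed
    qed
    have H\<Omega>: "H \<subseteq> \<Omega>" using mball_of_subset[of "r / 2" r m x] r(1) D(2) by (auto simp: H_def D_def)
    have "Linf_norm H (\<lambda>y. max (u y) 0) \<le> ennreal M0"
      unfolding Linf_norm_def
    proof (rule esssup_I)
      have [measurable]: "u \<in> borel_measurable (lebesgue_on H)"
        by (rule measurable_restrict_mono[OF u_meas H\<Omega>])
      show "(\<lambda>y. ennreal \<bar>max (u y) 0\<bar>) \<in> borel_measurable (lebesgue_on H)" by measurable
      show "AE y in lebesgue_on H. ennreal \<bar>max (u y) 0\<bar> \<le> ennreal M0"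
        using AE_M0 by eventually_elim (use M0(1) in \<open>auto intro!: ennreal_leI\<close>)
    qed
    also have "\<dots> = ennreal (exp (2 * (b + 1)) * \<mu>) + ennreal X"
      using X(2) \<mu>(1) by (simp add: M0_def add.commute mult.commute)
    also have "\<dots> \<le> ennreal (?C * \<mu>) + ennreal X"
      using C_ge \<mu>(1) by (intro add_right_mono ennreal_leI mult_right_mono)
    also have "ennreal (?C * \<mu>) = ennreal ?C * ennsqrt (?U / wmeas w D)"
      unfolding U(1) W(1) using C_pos \<mu>(1) U(2) W(2)
      by (simp add: divide_ennreal ennsqrt_ennreal \<mu>_def ennreal_mult)
    finally show ?thesis unfolding H_def D_def z_def s_def X(1)[symmetric, unfolded D_def] .
  qed
qed

end

section \<open>Local boundedness\<close>

lemma grad_uminus: "grad (\<lambda>x. - f x) x = - grad f x"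
proof (cases "f differentiable (at x)")
  case True
  then show ?thesis by (intro grad_eqI GDERIV_minus GDERIV_grad)
next
  case False
  have "(\<lambda>x. - f x) differentiable (at x) \<Longrightarrow> f differentiable (at x)"
    using differentiable_minus[of "\<lambda>x. - f x" "at x"] by simp
  with False have "\<not> (\<lambda>x. - f x) differentiable (at x)" by blast
  with False show ?thesis using GDERIV_imp_differentiable by (fastforce simp: grad_def)
qed

lemma Lip_loc_uminus: "f \<in> Lip_loc E \<Longrightarrow> (\<lambda>x. - f x) \<in> Lip_loc E"
  by (simp add: Lip_loc_def)

lemma W12A_uminus:
  assumes "W12A A E v G"
  shows "W12A A E (\<lambda>x. - v x) (\<lambda>x. - G x)"
proof -
  have form: "(- \<xi>) \<bullet> (A x *v (- \<xi>)) = \<xi> \<bullet> (A x *v \<xi>)" for x \<xi>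
    using matrix_form_scaleR[of "-1" \<xi> "A x"] by simp
  have en: "energy A E (\<lambda>x. - f x) (\<lambda>x. - F x) = energy A E f F" for f F
    unfolding energy_def form by simp
  obtain V where V: "\<And>m::nat. V m \<in> Lip_loc E"
    and lim: "(\<lambda>m. energy A E (\<lambda>x. v x - V m x) (\<lambda>x. G x - grad (V m) x)) \<longlonglongrightarrow> 0"
    using assms by (auto simp: W12A_def sobolev_closure_def)
  have "energy A E (\<lambda>x. - v x - - V m x) (\<lambda>x. - G x - grad (\<lambda>y. - V m y) x) =
    energy A E (\<lambda>x. v x - V m x) (\<lambda>x. G x - grad (V m) x)" for m
    using en[of "\<lambda>x. v x - V m x" "\<lambda>x. G x - grad (V m) x"] by (simp add: grad_uminus)
  then have "(\<lambda>m. energy A E (\<lambda>x. - v x - - V m x) (\<lambda>x. - G x - grad (\<lambda>y. - V m y) x)) \<longlonglongrightarrow> 0"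
    using lim by simp
  then have "\<exists>V. (\<forall>m::nat. V m \<in> Lip_loc E) \<and>
        (\<lambda>m. energy A E (\<lambda>x. - v x - V m x) (\<lambda>x. - G x - grad (V m) x)) \<longlonglongrightarrow> 0"
    using Lip_loc_uminus[OF V] by (intro exI[of _ "\<lambda>m x. - V m x"]) simp
  then show ?thesis using assms by (auto simp: W12A_def sobolev_closure_def en)
qed

lemma weak_solutionE:
  assumes "weak_solution A \<Omega> \<phi> u"
  obtains G where "W12A A \<Omega> u G"
    "\<And>g H. W12A0 A \<Omega> g H \<and> (AE x in lebesgue_on \<Omega>. 0 \<le> g x) \<and>
      integrable (lebesgue_on \<Omega>) (\<lambda>x. \<phi> x * g x) \<Longrightarrow>
       - (LINT x|lebesgue_on \<Omega>. H x \<bullet> (A x *v G x)) = (LINT x|lebesgue_on \<Omega>. \<phi> x * g x)"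
  using assms unfolding weak_solution_def weak_relation_def by blast

lemma weak_solution_imp_weak_subsolution:
  assumes "weak_solution A \<Omega> \<phi> u"
  shows "weak_subsolution A \<Omega> \<phi> u"
proof -
  from assms obtain G where G: "W12A A \<Omega> u G" and
    eq: "\<And>g H. W12A0 A \<Omega> g H \<and> (AE x in lebesgue_on \<Omega>. 0 \<le> g x) \<and>
      integrable (lebesgue_on \<Omega>) (\<lambda>x. \<phi> x * g x) \<Longrightarrow>
       - (LINT x|lebesgue_on \<Omega>. H x \<bullet> (A x *v G x)) = (LINT x|lebesgue_on \<Omega>. \<phi> x * g x)"
    by (rule weak_solutionE) (rule that)
  show ?thesis
    unfolding weak_subsolution_def weak_relation_def
    by (intro exI[of _ G] conjI allI impI G) (simp only: eq order_refl)
qed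

text \<open>The estimate bounds u only from above. The bound from below comes from -u, which solves
  the equation for -\<phi>, and \<open>X_norm\<close> is the same for \<phi> and -\<phi>.\<close>

lemma weak_solution_uminus:
  assumes "weak_solution A \<Omega> \<phi> u"
  shows "weak_solution A \<Omega> (\<lambda>x. - \<phi> x) (\<lambda>x. - u x)"
proof -
  from assms obtain G where G: "W12A A \<Omega> u G" and
    eq: "\<And>g H. W12A0 A \<Omega> g H \<and> (AE x in lebesgue_on \<Omega>. 0 \<le> g x) \<and>
      integrable (lebesgue_on \<Omega>) (\<lambda>x. \<phi> x * g x) \<Longrightarrow>
       - (LINT x|lebesgue_on \<Omega>. H x \<bullet> (A x *v G x)) = (LINT x|lebesgue_on \<Omega>. \<phi> x * g x)"
    by (rule weak_solutionE) (rule that)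
  have neg: "A x *v (- G x) = - (A x *v G x)" for x
    using matrix_vector_mult_scaleR[of "A x" "-1" "G x"] by simp
  show ?thesis
    unfolding weak_solution_def weak_relation_def
  proof (intro exI[of _ "\<lambda>x. - G x"] conjI allI impI W12A_uminus[OF G])
    fix g H
    assume "W12A0 A \<Omega> g H \<and> (AE x in lebesgue_on \<Omega>. 0 \<le> g x) \<and>
      integrable (lebesgue_on \<Omega>) (\<lambda>x. - \<phi> x * g x)"
    then show "- (LINT x|lebesgue_on \<Omega>. H x \<bullet> (A x *v - G x)) = (LINT x|lebesgue_on \<Omega>. - \<phi> x * g x)"
      using eq[of g H] by (simp add: neg)
  qed
qed

lemma A_admissible_uminus:
  assumes "A_admissible m \<Omega> w A \<B> \<phi>"
  shows "A_admissible m \<Omega> w A \<B> (\<lambda>x. - \<phi> x)"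
proof -
  have "abs_integral B (\<lambda>y. v y * - \<phi> y) = abs_integral B (\<lambda>y. v y * \<phi> y)" for B v
    by (simp add: abs_integral_def)
  then have "X_norm w A \<B> B (\<lambda>x. - \<phi> x) = X_norm w A \<B> B \<phi>" for B
    by (simp only: X_norm_def)
  then show ?thesis using assms by (simp add: A_admissible_def)
qed

text \<open>On the given ball the right-hand side of \<open>est\<close> may be infinite. On the half
  ball the weighted square integral is finite by the Orlicz-Sobolev inequality, so
  \<open>est\<close> is applied there and bounds u on the quarter ball.\<close>

lemma (in adapted) u_positive_part_locally_bounded:
  assumes est: "\<And>x r. ball_in m \<Omega> x r \<Longrightarrow> r \<le> R \<Longrightarrow> wmeas w (mball_of m x r) < top \<Longrightarrow>
      Linf_norm (mball_of m x (r / 2)) (\<lambda>y. max (u y) 0) \<le>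
        ennreal (Cst r) * ennsqrt
          ((\<integral>\<^sup>+ y. ennreal ((max (u y) 0)\<^sup>2 * w y) \<partial>lebesgue_on (mball_of m x r)) / wmeas w
          (mball_of m x r))
        + X_norm w A \<B> (mball_of m x r) \<phi>"
    and \<sigma>: "superradius R \<sigma>" and OS: "orlicz_sobolev m \<Omega> w \<B> k N R \<sigma> C\<^sub>S"
    and adm: "A_admissible m \<Omega> w A \<B> \<phi>" and uG: "W12A A \<Omega> u G"
    and B: "ball_in m \<Omega> y r" "r \<le> R" "wmeas w (mball_of m y r) < top"
  shows "\<exists>c. AE x in lebesgue_on (mball_of m y (r / 4)). u x \<le> c"
proof -
  define D where "D = mball_of m y r"
  define D2 where "D2 = mball_of m y (r / 2)"
  have r: "0 < r" "y \<in> \<Omega>" using B(1) by (auto simp: ball_in_def)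
  have B2: "ball_in m \<Omega> y (r / 2)" using B(1) by (rule ball_in_mono) (use r in auto)
  have y: "y \<in> D" "y \<in> D2" unfolding D_def D2_def using r \<Omega>_mspace
    by (intro centre_in_mball_of; auto)+
  have D: "open D" "D \<subseteq> \<Omega>" "D \<noteq> {}" using y open_mball[OF B(1)] B(1) unfolding D_def ball_in_def
    by blast+
  have D2: "open D2" "D2 \<subseteq> D" unfolding D_def D2_def
    using open_mball[OF B2] mball_of_subset[of "r / 2" r m y] r by auto
  define W where "W = enn2real (wmeas w D)"
  have W: "wmeas w D = ennreal W" "0 < W"
    using B(3) wmeas_open_pos[OF D] by (auto simp: W_def D_def[symmetric] enn2real_positive_iff)
  have "uncountable {0<..<1::real}" by (simp add: uncountable_open_interval)
  moreover have "countable {P. \<not> (AE x in lebesgue_on \<Omega>. u x \<noteq> P)}"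
    using uG by (intro countable_nongeneric) (auto simp: W12A_def sobolev_closure_def)
  ultimately have "\<not> {0<..<1} \<subseteq> {P. \<not> (AE x in lebesgue_on \<Omega>. u x \<noteq> P)}" using countable_subset
    by blast
  then obtain P where P: "0 < P" "AE x in lebesgue_on \<Omega>. u x \<noteq> P" by auto
  from first_cutoff[OF B(1,2), folded D_def D2_def]
  obtain \<psi> :: "real ^ 'n \<Rightarrow> real" and L where \<psi>: "L-lipschitz_on UNIV \<psi>" "closure {z. \<psi> z \<noteq> 0} \<subseteq> D"
    "\<forall>z\<in>D2. \<psi> z = 1"
      "Linf_norm \<Omega> (\<lambda>y. norm (\<B> y *v grad \<psi> y) / sqrt (w y)) \<le> ennreal (C\<^sub>\<psi> * kappa k N 1 / r)"
    by (elim exE conjE) (rule that)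
  have "compact (closure {z. \<psi> z \<noteq> 0})"
    using bounded_subset[OF bounded_\<Omega> order_trans[OF \<psi>(2) D(2)]]
      by (simp add: compact_eq_bounded_closed)
  then have \<psi>_c: "\<psi> \<in> Lip_c D" using \<psi>(1,2) by (auto simp: Lip_c_def)
  have "r \<le> \<sigma> r" using \<sigma> r B(2) by (simp add: superradius_def)
  then have \<sigma>r: "0 < \<sigma> r" using r(1) by linarith
  have E: "0 < E_const k N" using E_const_ge[of N k] N by linarith
  have fin: "(\<integral>\<^sup>+ x. ennreal ((max (u x) 0)\<^sup>2 * w x) \<partial>lebesgue_on D2) < top"
  proof (rule weighted_L2_locally_finite[OF D(1,2) W _ _ _ E _ uG P(2,1) \<psi>_c D2])
    show "orlicz_norm (Phi k N) w D v \<le> ennreal (C\<^sub>S * \<sigma> r) / ennsqrt (wmeas w D) *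
      L2_norm_on D (\<lambda>y. \<B> y *v grad v y)"
      if "v \<in> Lip_c D" for v
      using OS B that unfolding orlicz_sobolev_def D_def by blast
    show "0 < C\<^sub>S * \<sigma> r" using C\<^sub>S \<sigma>r by simp
    show "Phi_gain k N (E_const k N) * t\<^sup>2 \<le> Phi k N t" if "E_const k N < t\<^sup>2" for t
      by (rule Phi_gain_le[OF N order_refl that])
    show "0 < Phi_gain k N (E_const k N)" by (rule Phi_gain_pos[OF N order_refl])
    show "\<psi> x = 1" if "x \<in> D2" for x using \<psi>(3) that by blast
  qed
  have W2: "wmeas w D2 < top" "0 < wmeas w D2"
  proof -
    have "wmeas w D2 \<le> wmeas w D" using D D2 by (intro wmeas_mono) auto
    then show "wmeas w D2 < top" using B(3) unfolding D_def by (rule le_less_trans)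
    show "0 < wmeas w D2" using D2 D(2) y(2) by (intro wmeas_open_pos) auto
  qed
  have "(\<integral>\<^sup>+ x. ennreal ((max (u x) 0)\<^sup>2 * w x) \<partial>lebesgue_on D2) / wmeas w D2 < top"
  proof -
    obtain a where "0 \<le> a" "(\<integral>\<^sup>+ x. ennreal ((max (u x) 0)\<^sup>2 * w x) \<partial>lebesgue_on D2) = ennreal a"
      using fin by (cases "\<integral>\<^sup>+ x. ennreal ((max (u x) 0)\<^sup>2 * w x) \<partial>lebesgue_on D2") auto
    moreover obtain b where "0 \<le> b" "wmeas w D2 = ennreal b" using W2(1)
      by (cases "wmeas w D2") auto
    ultimately show ?thesis using W2(2) by (simp add: divide_ennreal)
  qed
  then have "ennsqrt ((\<integral>\<^sup>+ x. ennreal ((max (u x) 0)\<^sup>2 * w x) \<partial>lebesgue_on D2) / wmeas w D2) < top"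
    by (simp add: ennsqrt_def)
  moreover have "X_norm w A \<B> D2 \<phi> < top" using adm B2 by (auto simp: A_admissible_def D2_def)
  \<comment> \<open>The half of the half ball: this is why the conclusion speaks of radius
    r/4.\<close>
  moreover have "Linf_norm (mball_of m y (r / 2 / 2)) (\<lambda>y. max (u y) 0) \<le>
        ennreal (Cst (r / 2)) * ennsqrt
          ((\<integral>\<^sup>+ y. ennreal ((max (u y) 0)\<^sup>2 * w y) \<partial>lebesgue_on D2) / wmeas w D2)
        + X_norm w A \<B> D2 \<phi>"
    unfolding D2_def by (rule est[OF B2]) (use r B(2) W2(1) in \<open>auto simp: D2_def\<close>)
  ultimately have "Linf_norm (mball_of m y (r / 4)) (\<lambda>y. max (u y) 0) < top"
    by (auto simp: ennreal_mult_less_top elim!: le_less_trans)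
  then obtain c where c: "c \<ge> 0" "Linf_norm (mball_of m y (r / 4)) (\<lambda>y. max (u y) 0) = ennreal c"
    by (cases "Linf_norm (mball_of m y (r / 4)) (\<lambda>y. max (u y) 0)") auto
  have "AE x in lebesgue_on (mball_of m y (r / 4)). ennreal \<bar>max (u x) 0\<bar> \<le> ennreal c"
    using esssup_AE[of "\<lambda>x. ennreal \<bar>max (u x) 0\<bar>" "lebesgue_on (mball_of m y (r / 4))"]
    unfolding c(2)[unfolded Linf_norm_def] .
  then have "AE x in lebesgue_on (mball_of m y (r / 4)). u x \<le> c"
    by eventually_elim (use c(1) in auto)
  then show ?thesis by blast
qed

text \<open>The small metric balls are open in the Euclidean sense, so finitely many of them cover a
  compact set. \<open>est\<close> is assumed for all \<phi> and u because it is applied both to the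
  given pair and to its negative.\<close>

lemma (in adapted) weak_solution_locally_bounded:
  assumes est: "\<And>\<phi> u x r. A_admissible m \<Omega> w A \<B> \<phi> \<Longrightarrow> weak_subsolution A \<Omega> \<phi> u \<Longrightarrow>
      ball_in m \<Omega> x r \<Longrightarrow> r \<le> R \<Longrightarrow> wmeas w (mball_of m x r) < top \<Longrightarrow>
      Linf_norm (mball_of m x (r / 2)) (\<lambda>y. max (u y) 0) \<le>
        ennreal (Cst r) * ennsqrt
          ((\<integral>\<^sup>+ y. ennreal ((max (u y) 0)\<^sup>2 * w y) \<partial>lebesgue_on (mball_of m x r)) / wmeas w
          (mball_of m x r))
        + X_norm w A \<B> (mball_of m x r) \<phi>"
    and \<sigma>: "superradius R \<sigma>" and OS: "orlicz_sobolev m \<Omega> w \<B> k N R \<sigma> C\<^sub>S"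
    and adm: "A_admissible m \<Omega> w A \<B> \<phi>" and u: "weak_solution A \<Omega> \<phi> u"
  shows "locally_bounded \<Omega> u"
  unfolding locally_bounded_def
proof (intro allI impI)
  fix K assume "compact K \<and> K \<subseteq> \<Omega>"
  then have K: "compact K" "K \<subseteq> \<Omega>" by auto
  note u' = weak_solution_uminus[OF u] and adm' = A_admissible_uminus[OF adm]
  obtain G where G: "W12A A \<Omega> u G" using u by (auto simp: weak_solution_def weak_relation_def)
  have "\<exists>U c. open U \<and> y \<in> U \<and> U \<subseteq> \<Omega> \<and> (AE x in lebesgue_on U. \<bar>u x\<bar> \<le> c)" if y: "y \<in> \<Omega>" for y
  proof -
    obtain r where B: "ball_in m \<Omega> y r" "r \<le> R" "wmeas w (mball_of m y r) < top" using y
      by (rule small_ball)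
    have r: "0 < r" using B(1) by (simp add: ball_in_def)
    define U where "U = mball_of m y (r / 4)"
    have B4: "ball_in m \<Omega> y (r / 4)" using B(1) by (rule ball_in_mono) (use r in auto)
    obtain c1 where c1: "AE x in lebesgue_on U. u x \<le> c1"
      using u_positive_part_locally_bounded[OF est[OF adm weak_solution_imp_weak_subsolution[OF u]]
        \<sigma> OS adm G B]
      unfolding U_def by blast
    obtain c2 where c2: "AE x in lebesgue_on U. - u x \<le> c2"
      using u_positive_part_locally_bounded[OF
        est[OF adm' weak_solution_imp_weak_subsolution[OF u']] \<sigma> OS adm' W12A_uminus[OF G] B]
      unfolding U_def by blast
    have "AE x in lebesgue_on U. \<bar>u x\<bar> \<le> max c1 c2" using c1 c2 by eventually_elim auto
    moreover have "open U" unfolding U_def by (rule open_mball[OF B4])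
    moreover have "y \<in> U" unfolding U_def using y r \<Omega>_mspace by (intro centre_in_mball_of) auto
    moreover have "U \<subseteq> \<Omega>" using B4 unfolding U_def ball_in_def by blast
    ultimately show ?thesis by blast
  qed
  then obtain U c where U: "\<And>y. y \<in> \<Omega> \<Longrightarrow> open (U y)" "\<And>y. y \<in> \<Omega> \<Longrightarrow> y \<in> U y" "\<And>y. y \<in> \<Omega> \<Longrightarrow> U y \<subseteq> \<Omega>"
    "\<And>y. y \<in> \<Omega> \<Longrightarrow> AE x in lebesgue_on (U y). \<bar>u x\<bar> \<le> c y" by metis
  obtain F where F: "F \<subseteq> K" "finite F" "K \<subseteq> (\<Union>y\<in>F. U y)"
  proof (rule compactE_image[OF K(1), of K U])
    show "open (U y)" if "y \<in> K" for y using U(1) K(2) that by blast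
    show "K \<subseteq> (\<Union>y\<in>K. U y)" using U(2) K(2) by blast
  qed blast
  define C where "C = (\<Sum>y\<in>F. \<bar>c y\<bar>)"
  have AE: "AE x in lebesgue. \<forall>y\<in>F. x \<in> U y \<longrightarrow> \<bar>u x\<bar> \<le> c y"
  proof (rule AE_finite_allI[OF F(2)])
    fix y assume "y \<in> F"
    then have y: "y \<in> \<Omega>" using F(1) K(2) by blast
    then show "AE x in lebesgue. x \<in> U y \<longrightarrow> \<bar>u x\<bar> \<le> c y"
      using U(4)[OF y] U(1)[OF y] by (simp add: AE_restrict_space_iff)
  qed
  have K_leb: "K \<in> sets lebesgue" using K(1) by (simp add: lmeasurable_compact fmeasurableD)
  have "AE x in lebesgue. x \<in> K \<longrightarrow> \<bar>u x\<bar> \<le> C"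
    using AE
  proof eventually_elim
    case (elim x)
    show ?case
    proof
      assume "x \<in> K"
      then obtain y where y: "y \<in> F" "x \<in> U y" using F(3) by blast
      then have "\<bar>u x\<bar> \<le> \<bar>c y\<bar>" using elim by force
      also have "\<dots> \<le> C" unfolding C_def using F(2) y(1) by (intro member_le_sum) auto
      finally show "\<bar>u x\<bar> \<le> C" .
    qed
  qed
  then have "AE x in lebesgue_on K. \<bar>u x\<bar> \<le> C"
    using K_leb by (simp add: AE_restrict_space_iff)
  then have AE': "AE x in lebesgue_on K. ennreal \<bar>u x\<bar> \<le> ennreal C"
    by eventually_elim (rule ennreal_leI)
  have "u \<in> borel_measurable (lebesgue_on \<Omega>)" using G by (auto simp: W12A_def sobolev_closure_def)
  then have [measurable]: "u \<in> borel_measurable (lebesgue_on K)" using K(2)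
    by (rule measurable_restrict_mono)
  have "Linf_norm K u \<le> ennreal C"
    unfolding Linf_norm_def by (rule esssup_I[OF _ AE']) measurable
  then show "Linf_norm K u < top" by (simp add: le_less_trans)
qed

text \<open>The order of quantifiers is the point: the constant from
  \<open>iteration_constant\<close> depends on k, N, R, the structural constants and
  \<open>radius_const\<close> only, so one pair serves all superradii, right-hand sides,
  subsolutions and balls.\<close>

lemma (in adapted) local_boundedness_constants:
  assumes "\<Omega> \<noteq> {}"
  shows "\<exists>C\<^sub>1>0. \<exists>C\<^sub>2>0. \<forall>\<sigma> \<phi> u x r. superradius R \<sigma> \<longrightarrow> orlicz_sobolev m \<Omega> w \<B> k N R \<sigma> C\<^sub>S \<longrightarrow>
      A_admissible m \<Omega> w A \<B> \<phi> \<longrightarrow> weak_subsolution A \<Omega> \<phi> u \<longrightarrow>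
      ball_in m \<Omega> x r \<longrightarrow> r \<le> R \<longrightarrow> wmeas w (mball_of m x r) < top \<longrightarrow>
      Linf_norm (mball_of m x (r / 2)) (\<lambda>y. max (u y) 0) \<le>
        ennreal (C\<^sub>1 * sqrt ((exp ^^ k) (C\<^sub>2 * (\<sigma> r / r) powr (2 / (N - 1))))) *
          ennsqrt ((\<integral>\<^sup>+ y. ennreal ((max (u y) 0)\<^sup>2 * w y) \<partial>lebesgue_on (mball_of m x r)) / wmeas w
            (mball_of m x r))
        + X_norm w A \<B> (mball_of m x r) \<phi>"
proof -
  let ?K = "4 * C\<^sub>S\<^sup>2 * (1 + 2 * C\<^sub>A\<^sup>2 + 2 * C\<^sub>A / c\<^sub>A) *
    (R\<^sup>2 / (4 * (radius_const k N)\<^sup>2) + C\<^sub>\<psi>\<^sup>2)"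
  have "0 < ?K"
    using C\<^sub>S C\<^sub>A c\<^sub>A C\<^sub>\<psi> by (intro mult_pos_pos add_pos_pos add_nonneg_pos) auto
  from iteration_constant[OF k N this radius_const_pos[OF assms]]
  obtain K\<^sub>3 where K3: "1 \<le> K\<^sub>3" and num: "\<And>s j y. s \<ge> 1 \<Longrightarrow> j \<ge> 1 \<Longrightarrow>
      y = (exp ^^ (k-1)) (K\<^sub>3 * s powr (2 / (N - 1))) + real j \<Longrightarrow> E_const k N \<le> exp y \<and>
      ?K * s\<^sup>2 * (kappa k N j)\<^sup>2 *
       (exp (- 3 * y) * (kappa k N j)\<^sup>2 / (4 * (radius_const k N)\<^sup>2) + 1 / Phi_gain k N (exp y)) \<le>
         exp (- 4)"
    by blast
  show ?thesis
  proof (rule exI[of _ "exp 2"], rule conjI[rotated], rule exI[of _ "4 * K\<^sub>3"], intro conjI allI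
    impI)
    show "0 < (exp 2 :: real)" "0 < 4 * K\<^sub>3" using K3 by auto
  qed (rule local_boundedness_estimate[OF K3 num])
qed

theorem theorem2p4:
  fixes \<Omega> :: "(real ^ 'n) set" and w :: "real ^ 'n \<Rightarrow> real"
    and A \<B> :: "real ^ 'n \<Rightarrow> real ^ 'n ^ 'n"
    and m :: "(real ^ 'n) metric"
    and k :: nat and N R C\<^sub>S C\<^sub>\<psi> :: real
  assumes "degenerate_setting \<Omega> w A \<B>"
    and "\<Omega> \<subseteq> mspace m" and "openin (mtopology_of m) \<Omega>"
    and "k \<ge> 1" and "N > 1" and "R > 0" and "C\<^sub>S > 0" and "C\<^sub>\<psi> > 0"
    and "\<forall>x r. ball_in m \<Omega> x r \<and> r \<le> R \<longrightarrow> (\<exists>\<psi>. adapted_cutoffs m \<Omega> w \<B> k N C\<^sub>\<psi> x r \<psi>)"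
  shows "\<exists>C\<^sub>1>0. \<exists>C\<^sub>2>0. \<forall>\<sigma> \<phi>.
    superradius R \<sigma> \<and> orlicz_sobolev m \<Omega> w \<B> k N R \<sigma> C\<^sub>S \<and> A_admissible m \<Omega> w A \<B> \<phi> \<longrightarrow>
      (\<forall>u x r. weak_subsolution A \<Omega> \<phi> u \<and>
         ball_in m \<Omega> x r \<and> r \<le> R \<and> wmeas w (mball_of m x r) < top \<longrightarrow>
         Linf_norm (mball_of m x (r / 2)) (\<lambda>y. max (u y) 0) \<le>
           ennreal (C\<^sub>1 * sqrt ((exp ^^ k) (C\<^sub>2 * (\<sigma> r / r) powr (2 / (N - 1))))) *
             ennsqrt ((\<integral>\<^sup>+ y. ennreal ((max (u y) 0)\<^sup>2 * w y) \<partial>lebesgue_on (mball_of m x r))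
                      / wmeas w (mball_of m x r))
           + X_norm w A \<B> (mball_of m x r) \<phi>) \<and>
      (\<forall>u. weak_solution A \<Omega> \<phi> u \<longrightarrow> locally_bounded \<Omega> u)"
proof -
  obtain Q c C L where "degenerate \<Omega> w A \<B> Q c C L"
    using assms(1) by (rule degenerate_setting_imp_degenerate)
  then interpret adapted \<Omega> w A \<B> Q c C L m k N R C\<^sub>S C\<^sub>\<psi>
    using assms by (intro adapted.intro adapted_axioms.intro) auto
  have "\<Omega> \<noteq> {}" using assms(1) by (simp add: degenerate_setting_def)
  from local_boundedness_constants[OF this] obtain C\<^sub>1 C\<^sub>2
    where C: "0 < C\<^sub>1" "0 < C\<^sub>2" and est: "\<And>\<sigma> \<phi> u x r. superradius R \<sigma> \<Longrightarrow>
      orlicz_sobolev m \<Omega> w \<B> k N R \<sigma> C\<^sub>S \<Longrightarrow> A_admissible m \<Omega> w A \<B> \<phi> \<Longrightarrow>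
      weak_subsolution A \<Omega> \<phi> u \<Longrightarrow> ball_in m \<Omega> x r \<Longrightarrow> r \<le> R \<Longrightarrow> wmeas w (mball_of m x r) < top \<Longrightarrow>
      Linf_norm (mball_of m x (r / 2)) (\<lambda>y. max (u y) 0) \<le>
        ennreal (C\<^sub>1 * sqrt ((exp ^^ k) (C\<^sub>2 * (\<sigma> r / r) powr (2 / (N - 1))))) *
          ennsqrt ((\<integral>\<^sup>+ y. ennreal ((max (u y) 0)\<^sup>2 * w y) \<partial>lebesgue_on (mball_of m x r))
                   / wmeas w (mball_of m x r))
        + X_norm w A \<B> (mball_of m x r) \<phi>"
    by blast
  show ?thesis
  proof (rule exI[of _ C\<^sub>1], rule conjI[OF C(1)], rule exI[of _ C\<^sub>2], rule conjI[OF C(2)],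
      intro allI impI conjI; elim conjE)
    fix \<sigma> \<phi> u
    assume *: "superradius R \<sigma>" "orlicz_sobolev m \<Omega> w \<B> k N R \<sigma> C\<^sub>S" "A_admissible m \<Omega> w A \<B> \<phi>"
    show "Linf_norm (mball_of m x (r / 2)) (\<lambda>y. max (u y) 0) \<le>
        ennreal (C\<^sub>1 * sqrt ((exp ^^ k) (C\<^sub>2 * (\<sigma> r / r) powr (2 / (N - 1))))) *
          ennsqrt ((\<integral>\<^sup>+ y. ennreal ((max (u y) 0)\<^sup>2 * w y) \<partial>lebesgue_on (mball_of m x r))
                   / wmeas w (mball_of m x r))
        + X_norm w A \<B> (mball_of m x r) \<phi>"
      if "weak_subsolution A \<Omega> \<phi> u" "ball_in m \<Omega> x r" "r \<le> R" "wmeas w (mball_of m x r) < top" for x r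
      by (rule est[OF * that])
    show "locally_bounded \<Omega> u" if "weak_solution A \<Omega> \<phi> u"
      by (rule weak_solution_locally_bounded[OF est[OF *(1,2)] * that])
  qed
qed

end
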